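(* For a fixed sofic approximation $\Sigma$ to $G$, the quantities $\mathrm h^{\mathrm q}_\Sigma(\mu)$ and $\mathrm h^{\mathrm{dq}}_\Sigma(\mu)$ are isomorphism-invariants of the metric $G$-process $(\mathcal X^G,\mu,S,d)$: if $(\mathcal X^G,\mu,S,d_{\mathcal X})$ and $(\mathcal Y^G,\nu,S,d_{\mathcal Y})$ are metric $G$-processes such that $(\mathcal X^G,\mu,S)$ and $(\mathcal Y^G,\nu,S)$ are measure-theoretically isomorphic as $G$-systems, then $\mathrm h^{\mathrm q}_\Sigma(\mu)=\mathrm h^{\mathrm q}_\Sigma(\nu)$ and $\mathrm h^{\mathrm{dq}}_\Sigma(\mu)=\mathrm h^{\mathrm{dq}}_\Sigma(\nu)$. In particular, these quantities do not depend on the choice of $d$.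
   Context: $G$ is a countable discrete sofic group. A sofic approximation $\Sigma=(\sigma_n)_{n\ge1}$ to $G$ is a sequence of nonempty finite sets $V_n$ and maps $\sigma_n:G\to\mathrm{Sym}(V_n)$, $g\mapsto\sigma_n^g$ (not necessarily homomorphisms), such that for all $g,h\in G$ the proportion of $v\in V_n$ with $\sigma_n^g(\sigma_n^h(v))=\sigma_n^{gh}(v)$ tends to $1$, and for all $g\ne e$ the proportion of $v\in V_n$ with $\sigma_n^g(v)\neq v$ tends to $1$. A metric $G$-process $(\mathcal{X}^G,\mu,S,d)$ consists of a standard measurable space $\mathcal{X}$, a compact metric $d$ on $\mathcal X$ whose Borel $\sigma$-algebra is that of $\mathcal X$, the right-shift action $S^g((x_h)_{h})=(x_{hg})_{h}$, and an $S$-invariant probability measure $\mu$ on $\mathcal{X}^G$. $\mathcal{X}^G$ has the product topology from $d$, and $\mathrm{Prob}(\mathcal X^G)$ the resulting weak$^\ast$ topology. For a finite set $V$, a map $\sigma:G\to\mathrm{Sym}(V)$, $\mathbf{x}\in\mathcal{X}^V$, $v\in V$: $\Pi^\sigma_v(\mathbf{x})=(x_{\sigma^g(v)})_{g\in G}\in\mathcal{X}^G$; $P^\sigma_{\mathbf x}=\frac1{|V|}\sum_{v}\delta_{\Pi^\sigma_v(\mathbf x)}$; $\Omega(\mathcal O,\sigma)=\{\mathbf x\in\mathcal X^V: P^\sigma_{\mathbf x}\in\mathcal O\}$ for $\mathcal{O}\subseteq\mathrm{Prob}(\mathcal X^G)$; $d^{(V)}(\mathbf x,\mathbf x')=\frac1{|V|}\sum_v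 d(x_v,x'_v)$. For a Borel probability $\nu$ on a metric space $(Y,d_Y)$, $\mathrm{cov}_{\varepsilon,\delta}(\nu,d_Y)=\min\{|F|: F\subseteq Y,\ \nu(B_\delta(F))>1-\varepsilon\}$, with $B_\delta(F)$ the $\delta$-neighbourhood of $F$. A sequence $\mu_i\in\mathrm{Prob}(\mathcal X^{V_{n_i}})$ quenched converges to $\mu$ over $(\sigma_{n_i})_{i\ge1}$ if for every weak$^\ast$ neighbourhood $\mathcal O$ of $\mu$ the proportion of $v\in V_{n_i}$ with $(\Pi^{\sigma_{n_i}}_v)_\ast\mu_i\in\mathcal O$ tends to $1$ and $\mu_i(\Omega(\mathcal O,\sigma_{n_i}))\to1$. It doubly-quenched converges to $\mu$ if $\mu_i\times\mu_i\in\mathrm{Prob}((\mathcal X\times\mathcal X)^{V_{n_i}})$ quenched converges to $\mu\times\mu$ (on $(\mathcal X\times\mathcal X)^G$, with the average of the two copies of $d$). Then $$\mathrm h^{\mathrm{q}}_\Sigma(\mu)=\sup\Big\{\sup_{\delta,\varepsilon>0}\limsup_{i\to\infty}\tfrac1{|V_{n_i}|}\log\mathrm{cov}_{\varepsilon,\delta}(\mu_i,d^{(V_{n_i})})\Big\},$$ the outer supremum being over all subsequences $n_i\uparrow\infty$ and all sequences $(\mu_i)$ quenched converging to $\mu$ over $(\sigma_{n_i})_{i\ge1}$ (and $\sup\emptyset=-\infty$); $\mathrm h^{\mathrm{dq}}_\Sigma(\mu)$ is defined identically with doubly-quenched convergence. A priori these depend on $d$. *)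

theory Defs
  imports "HOL-Analysis.Analysis" "HOL-Probability.Probability"
    "HOL-Algebra.Group" "HOL-Combinatorics.Permutations"
begin

section \<open>Sofic approximations\<close>

text \<open>All sequences are indexed by \<open>nat\<close>, starting at 0. A map from \<open>G\<close> into the symmetric
  group of \<open>V n\<close> is only constrained on \<open>carrier G\<close>.\<close>

definition sofic_approximation ::
  "('g, 'm) monoid_scheme \<Rightarrow> (nat \<Rightarrow> 'v set) \<Rightarrow> (nat \<Rightarrow> 'g \<Rightarrow> 'v \<Rightarrow> 'v) \<Rightarrow> bool" where
  "sofic_approximation G V \<sigma> \<longleftrightarrow>
     (\<forall>n. finite (V n) \<and> V n \<noteq> {}) \<and>
     (\<forall>n. \<forall>g\<in>carrier G. \<sigma> n g permutes V n) \<and>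
     (\<forall>g\<in>carrier G. \<forall>h\<in>carrier G.
        (\<lambda>n. real (card {v \<in> V n. \<sigma> n g (\<sigma> n h v) = \<sigma> n (g \<otimes>\<^bsub>G\<^esub> h) v}) / real (card (V n)))
          \<longlonglongrightarrow> 1) \<and>
     (\<forall>g\<in>carrier G. g \<noteq> \<one>\<^bsub>G\<^esub> \<longrightarrow>
        (\<lambda>n. real (card {v \<in> V n. \<sigma> n g v \<noteq> v}) / real (card (V n))) \<longlonglongrightarrow> 1)"

section \<open>Probability measures and the weak-star topology\<close>

text \<open>A measurable space is encoded as a value \<open>X :: 'a measure\<close> of which only \<open>space X\<close> and
  \<open>sets X\<close> are used.\<close>

definition Prob :: "'a measure \<Rightarrow> 'a measure set" where
  "Prob B = {N. prob_space N \<and> sets N = sets B}"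

text \<open>\<open>T\<close> is a compact topology and \<open>B\<close> carries its Borel sets, so continuous functions are
  bounded and the integrals below are genuine.\<close>

definition weak_star_topology :: "'a topology \<Rightarrow> 'a measure \<Rightarrow> 'a measure topology" where
  "weak_star_topology T B = topology_generated_by
     {{N \<in> Prob B. (\<integral>x. f x \<partial>N) \<in> U} | f U. continuous_map T euclideanreal f \<and> open U}"

section \<open>Metric processes\<close>

definition right_shift :: "('g, 'm) monoid_scheme \<Rightarrow> 'g \<Rightarrow> ('g \<Rightarrow> 'x) \<Rightarrow> ('g \<Rightarrow> 'x)" where
  "right_shift G g x = (\<lambda>h\<in>carrier G. x (h \<otimes>\<^bsub>G\<^esub> g))"

text \<open>That \<open>X\<close> is a standard measurable space follows from the requirement that its measurable
  sets be the Borel sets of a compact metric.\<close>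

definition metric_process ::
  "('g, 'm) monoid_scheme \<Rightarrow> 'x measure \<Rightarrow> ('x \<Rightarrow> 'x \<Rightarrow> real) \<Rightarrow> ('g \<Rightarrow> 'x) measure \<Rightarrow> bool" where
  "metric_process G X d \<mu> \<longleftrightarrow>
     Metric_space (space X) d \<and>
     compact_space (Metric_space.mtopology (space X) d) \<and>
     sets X = sigma_sets (space X) {U. openin (Metric_space.mtopology (space X) d) U} \<and>
     \<mu> \<in> Prob (PiM (carrier G) (\<lambda>_. X)) \<and>
     (\<forall>g\<in>carrier G. distr \<mu> (PiM (carrier G) (\<lambda>_. X)) (right_shift G g) = \<mu>)"

text \<open>Isomorphism of measure-preserving \<open>G\<close>-systems \<open>(M, T)\<close> and \<open>(N, R)\<close>: an almost everywhere
  equivariant factor map with a measurable inverse modulo null sets.\<close>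

definition isomorphic_systems ::
  "('g, 'm) monoid_scheme \<Rightarrow> 'a measure \<Rightarrow> ('g \<Rightarrow> 'a \<Rightarrow> 'a) \<Rightarrow> 'b measure \<Rightarrow> ('g \<Rightarrow> 'b \<Rightarrow> 'b) \<Rightarrow> bool" where
  "isomorphic_systems G M T N R \<longleftrightarrow>
     (\<exists>\<phi> \<psi>. \<phi> \<in> measurable M N \<and> \<psi> \<in> measurable N M \<and>
        distr M N \<phi> = N \<and> distr N M \<psi> = M \<and>
        (AE x in M. \<psi> (\<phi> x) = x) \<and> (AE y in N. \<phi> (\<psi> y) = y) \<and>
        (\<forall>g\<in>carrier G. AE x in M. \<phi> (T g x) = R g (\<phi> x)))"

section \<open>Empirical distributions and covering numbers\<close>

definition pullback_name ::
  "('g, 'm) monoid_scheme \<Rightarrow> ('g \<Rightarrow> 'v \<Rightarrow> 'v) \<Rightarrow> 'v \<Rightarrow> ('v \<Rightarrow> 'x) \<Rightarrow> ('g \<Rightarrow> 'x)" where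
  "pullback_name G s v x = (\<lambda>g\<in>carrier G. x (s g v))"

text \<open>The average of the point masses at \<open>pullback_name G s v x\<close>, \<open>v \<in> V\<close>, written as the
  image of the uniform distribution on \<open>V\<close>.\<close>

definition empirical_distribution ::
  "('g, 'm) monoid_scheme \<Rightarrow> 'x measure \<Rightarrow> 'v set \<Rightarrow> ('g \<Rightarrow> 'v \<Rightarrow> 'v) \<Rightarrow> ('v \<Rightarrow> 'x) \<Rightarrow>
    ('g \<Rightarrow> 'x) measure" where
  "empirical_distribution G X V s x =
     distr (uniform_count_measure V) (PiM (carrier G) (\<lambda>_. X)) (\<lambda>v. pullback_name G s v x)"

lemma measure_empirical_distribution:
  assumes "finite V" "V \<noteq> {}" "\<And>g. g \<in> carrier G \<Longrightarrow> s g permutes V"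
    and "x \<in> space (PiM V (\<lambda>_. X))" "A \<in> sets (PiM (carrier G) (\<lambda>_. X))"
  shows "measure (empirical_distribution G X V s x) A =
    (\<Sum>v\<in>V. indicator A (pullback_name G s v x)) / real (card V)"
proof -
  have "(\<lambda>v. pullback_name G s v x) \<in> V \<rightarrow> space (PiM (carrier G) (\<lambda>_. X))"
    using assms(3,4) permutes_in_image by (fastforce simp: pullback_name_def space_PiM PiE_iff)
  then have "(\<lambda>v. pullback_name G s v x) \<in> measurable (uniform_count_measure V) (PiM (carrier G) (\<lambda>_. X))"
    by (auto simp: measurable_def space_uniform_count_measure sets_uniform_count_measure)
  then have "measure (empirical_distribution G X V s x) A =
      measure (uniform_count_measure V) {v \<in> V. pullback_name G s v x \<in> A}"
    using assms(5) unfolding empirical_distribution_def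
    by (subst measure_distr)
       (auto simp: space_uniform_count_measure vimage_def Int_def conj_commute intro: arg_cong)
  also have "\<dots> = real (card {v \<in> V. pullback_name G s v x \<in> A}) / real (card V)"
    using assms(1) by (subst measure_uniform_count_measure) auto
  also have "real (card {v \<in> V. pullback_name G s v x \<in> A}) =
      (\<Sum>v\<in>V. indicator A (pullback_name G s v x))"
    using assms(1) by (simp add: indicator_def sum.If_cases Int_def)
  finally show ?thesis .
qed

definition good_models ::
  "('g, 'm) monoid_scheme \<Rightarrow> 'x measure \<Rightarrow> ('g \<Rightarrow> 'x) measure set \<Rightarrow> 'v set \<Rightarrow>
    ('g \<Rightarrow> 'v \<Rightarrow> 'v) \<Rightarrow> ('v \<Rightarrow> 'x) set" where
  "good_models G X U V s =
     {x \<in> space (PiM V (\<lambda>_. X)). empirical_distribution G X V s x \<in> U}"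

definition hamming_avg :: "'v set \<Rightarrow> ('x \<Rightarrow> 'x \<Rightarrow> real) \<Rightarrow> ('v \<Rightarrow> 'x) \<Rightarrow> ('v \<Rightarrow> 'x) \<Rightarrow> real" where
  "hamming_avg V d x y = (\<Sum>v\<in>V. d (x v) (y v)) / real (card V)"

definition cov :: "real \<Rightarrow> real \<Rightarrow> 'a measure \<Rightarrow> ('a \<Rightarrow> 'a \<Rightarrow> real) \<Rightarrow> nat" where
  "cov \<epsilon> \<delta> N d = (LEAST k. \<exists>F. finite F \<and> F \<subseteq> space N \<and> card F = k \<and>
     measure N {y \<in> space N. \<exists>x\<in>F. d x y < \<delta>} > 1 - \<epsilon>)"

text \<open>Logarithm of a natural number with \<open>log 0 = -\<infinity>\<close>; covering numbers vanish for \<open>\<epsilon> > 1\<close>.\<close>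

definition ext_log :: "nat \<Rightarrow> ereal" where
  "ext_log k = (if k = 0 then -\<infinity> else ereal (ln (real k)))"

section \<open>Quenched and doubly-quenched convergence\<close>

text \<open>Only open neighbourhoods of \<open>\<mu>\<close> are used: every neighbourhood contains an open one, and for
  open \<open>U\<close> the set \<open>good_models G X U (V i) (\<sigma> i)\<close> is measurable.\<close>

definition quenched_converges ::
  "('g, 'm) monoid_scheme \<Rightarrow> 'x measure \<Rightarrow> ('x \<Rightarrow> 'x \<Rightarrow> real) \<Rightarrow> ('g \<Rightarrow> 'x) measure \<Rightarrow>
    (nat \<Rightarrow> 'v set) \<Rightarrow> (nat \<Rightarrow> 'g \<Rightarrow> 'v \<Rightarrow> 'v) \<Rightarrow> (nat \<Rightarrow> ('v \<Rightarrow> 'x) measure) \<Rightarrow> bool" where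
  "quenched_converges G X d \<mu> V \<sigma> \<mu>s \<longleftrightarrow>
     (\<forall>i. \<mu>s i \<in> Prob (PiM (V i) (\<lambda>_. X))) \<and>
     (\<forall>U. openin (weak_star_topology
              (product_topology (\<lambda>_. Metric_space.mtopology (space X) d) (carrier G))
              (PiM (carrier G) (\<lambda>_. X))) U \<and> \<mu> \<in> U \<longrightarrow>
        (\<lambda>i. real (card {v \<in> V i.
                distr (\<mu>s i) (PiM (carrier G) (\<lambda>_. X)) (pullback_name G (\<sigma> i) v) \<in> U})
             / real (card (V i))) \<longlonglongrightarrow> 1 \<and>
        (\<lambda>i. measure (\<mu>s i) (good_models G X U (V i) (\<sigma> i))) \<longlonglongrightarrow> 1)"

definition avg_dist :: "('x \<Rightarrow> 'x \<Rightarrow> real) \<Rightarrow> ('x \<times> 'x) \<Rightarrow> ('x \<times> 'x) \<Rightarrow> real" where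
  "avg_dist d p q = (d (fst p) (fst q) + d (snd p) (snd q)) / 2"

text \<open>The product of two measures on \<open>X\<^sup>I\<close>, transported from \<open>X\<^sup>I \<times> X\<^sup>I\<close> to
  \<open>(X \<times> X)\<^sup>I\<close>.\<close>

definition paired :: "'i set \<Rightarrow> 'x measure \<Rightarrow> ('i \<Rightarrow> 'x) measure \<Rightarrow> ('i \<Rightarrow> 'x) measure \<Rightarrow>
    ('i \<Rightarrow> 'x \<times> 'x) measure" where
  "paired I X M N =
     distr (M \<Otimes>\<^sub>M N) (PiM I (\<lambda>_. X \<Otimes>\<^sub>M X)) (\<lambda>(x, y). \<lambda>i\<in>I. (x i, y i))"

definition doubly_quenched_converges ::
  "('g, 'm) monoid_scheme \<Rightarrow> 'x measure \<Rightarrow> ('x \<Rightarrow> 'x \<Rightarrow> real) \<Rightarrow> ('g \<Rightarrow> 'x) measure \<Rightarrow>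
    (nat \<Rightarrow> 'v set) \<Rightarrow> (nat \<Rightarrow> 'g \<Rightarrow> 'v \<Rightarrow> 'v) \<Rightarrow> (nat \<Rightarrow> ('v \<Rightarrow> 'x) measure) \<Rightarrow> bool" where
  "doubly_quenched_converges G X d \<mu> V \<sigma> \<mu>s \<longleftrightarrow>
     (\<forall>i. \<mu>s i \<in> Prob (PiM (V i) (\<lambda>_. X))) \<and>
     quenched_converges G (X \<Otimes>\<^sub>M X) (avg_dist d) (paired (carrier G) X \<mu> \<mu>) V \<sigma>
       (\<lambda>i. paired (V i) X (\<mu>s i) (\<mu>s i))"

section \<open>Model-measure sofic entropies\<close>

definition covering_rate ::
  "(nat \<Rightarrow> 'v set) \<Rightarrow> ('x \<Rightarrow> 'x \<Rightarrow> real) \<Rightarrow> (nat \<Rightarrow> ('v \<Rightarrow> 'x) measure) \<Rightarrow> ereal" where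
  "covering_rate V d \<mu>s =
     (SUP (\<delta>, \<epsilon>) \<in> {0<..} \<times> {0<..}.
        limsup (\<lambda>i. ext_log (cov \<epsilon> \<delta> (\<mu>s i) (hamming_avg (V i) d)) / ereal (real (card (V i)))))"

definition quenched_entropy ::
  "('g, 'm) monoid_scheme \<Rightarrow> (nat \<Rightarrow> 'v set) \<Rightarrow> (nat \<Rightarrow> 'g \<Rightarrow> 'v \<Rightarrow> 'v) \<Rightarrow>
    'x measure \<Rightarrow> ('x \<Rightarrow> 'x \<Rightarrow> real) \<Rightarrow> ('g \<Rightarrow> 'x) measure \<Rightarrow> ereal" where
  "quenched_entropy G V \<sigma> X d \<mu> =
     Sup {covering_rate (V \<circ> n) d \<mu>s | n \<mu>s.
        strict_mono n \<and> quenched_converges G X d \<mu> (V \<circ> n) (\<sigma> \<circ> n) \<mu>s}"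

definition doubly_quenched_entropy ::
  "('g, 'm) monoid_scheme \<Rightarrow> (nat \<Rightarrow> 'v set) \<Rightarrow> (nat \<Rightarrow> 'g \<Rightarrow> 'v \<Rightarrow> 'v) \<Rightarrow>
    'x measure \<Rightarrow> ('x \<Rightarrow> 'x \<Rightarrow> real) \<Rightarrow> ('g \<Rightarrow> 'x) measure \<Rightarrow> ereal" where
  "doubly_quenched_entropy G V \<sigma> X d \<mu> =
     Sup {covering_rate (V \<circ> n) d \<mu>s | n \<mu>s.
        strict_mono n \<and> doubly_quenched_converges G X d \<mu> (V \<circ> n) (\<sigma> \<circ> n) \<mu>s}"

end

theory Submission
  imports Defs
begin

text \<open>
  By symmetry it suffices to show that the entropies of \<open>\<mu>\<close> are at most those of \<open>\<nu>\<close>. So let \<open>\<mu>s\<close> be a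
  sequence that converges to \<open>\<mu>\<close>. The task is to find a sequence \<open>\<nu>s\<close> that converges to \<open>\<nu>\<close> and needs
  at least as many balls to cover. For one process with two metrics the isomorphism is the identity.

  An isomorphism is determined by its coordinate at the identity, a measurable map \<open>\<phi>\<close> from
  configurations on \<open>G\<close> to \<open>Y\<close>. If \<open>\<phi>\<close> depended on finitely many coordinates and were Lipschitz, one
  would apply it at every site of \<open>V i\<close> and let \<open>\<nu>s i\<close> be the image of \<open>\<mu>s i\<close>. In general no
  continuous map approximates \<open>\<phi>\<close>, because \<open>Y\<close> may be disconnected. But there are maps close to \<open>\<phi>\<close>
  in mean that are Lipschitz up to an error function which has small integral and is itself
  Lipschitz in finitely many coordinates (\<open>almost_lipschitz_approx\<close>). Such maps are good enough:
  the error function is an admissible test function, so its averages over sites and labellings are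
  again small. Replacing \<open>\<phi>\<close> by these approximations, with an accuracy that improves slowly along
  the sequence, gives \<open>\<nu>s\<close>; in fact the joint labellings converge to the joint process
  (\<open>joint_deviation_bound\<close> and \<open>joint_lift\<close>).

  For the covering numbers the same approximation is applied to the inverse isomorphism. The
  resulting decoder recovers most labels of a \<open>\<mu>s i\<close>-typical labelling \<open>x\<close> from its image \<open>y\<close>, and
  labellings that are close to \<open>y\<close> in the Hamming average decode to labellings close to \<open>x\<close>, up to the
  site average of the error function at \<open>y\<close>, which is small with high probability. Hence decoding
  turns an efficient cover for \<open>\<nu>s i\<close> into one for \<open>\<mu>s i\<close> (\<open>covering_rate_le\<close>).

  All limits are taken against functions that are Lipschitz in finitely many coordinates. For such a
  test function the two halves of quenched convergence say that two averages tend to 0; their sum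
  is called the deviation. It changes little when the test function changes little in mean, which
  is what all estimates use. That deviations capture quenched convergence is
  \<open>quenched_converges_iff_observables\<close>. It rests on compactness and holds as well for pairs of
  labels, so the doubly-quenched case follows by applying the joint construction to the product
  process with the code \<open>\<phi> \<times> \<phi>\<close>.
\<close>

section \<open>Metrics with measurable finite approximations\<close>

text \<open>
  Total boundedness, with nearest-point maps that can be chosen measurable. For Borel sets of a
  compact metric this holds by \<open>compact_borel_imp_measurably_precompact\<close> below. In contrast to that
  description it passes directly to the product \<open>\<sigma>\<close>-algebras on pairs and on finite powers.
\<close>

definition measurably_precompact :: "'x measure \<Rightarrow> ('x \<Rightarrow> 'x \<Rightarrow> real) \<Rightarrow> bool" where
  "measurably_precompact X d \<longleftrightarrow> Metric_space (space X) d \<and> space X \<noteq> {} \<and>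
     (\<forall>r>0. \<exists>A p. finite A \<and> A \<subseteq> space X \<and> p \<in> measurable X (count_space A) \<and>
        (\<forall>x\<in>space X. d x (p x) < r))"

lemma measurably_precompactE:
  assumes "measurably_precompact X d" "0 < r"
  obtains A p where "finite A" "A \<subseteq> space X" "p \<in> measurable X (count_space A)"
    "\<And>x. x \<in> space X \<Longrightarrow> p x \<in> A" "\<And>x. x \<in> space X \<Longrightarrow> d x (p x) < r"
  using assms unfolding measurably_precompact_def
  by (metis (no_types, lifting) measurable_space space_count_space)

text \<open>
  Two points are at most 2 further apart than their images in a finite set.
\<close>

lemma measurably_precompact_bounded:
  assumes "measurably_precompact X d"
  obtains C where "C > 0" "\<And>x y. x \<in> space X \<Longrightarrow> y \<in> space X \<Longrightarrow> d x y \<le> C"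
proof -
  interpret Metric_space "space X" d using assms by (simp add: measurably_precompact_def)
  obtain A p where A: "finite A" "A \<subseteq> space X"
    "\<And>x. x \<in> space X \<Longrightarrow> p x \<in> A" "\<And>x. x \<in> space X \<Longrightarrow> d x (p x) < 1"
    using measurably_precompactE[OF assms zero_less_one] by metis
  define C where "C = 2 + (\<Sum>(a,b)\<in>A\<times>A. d a b)"
  have "d x y \<le> C" if "x \<in> space X" "y \<in> space X" for x y
  proof -
    have px: "p x \<in> space X" "p y \<in> space X" using A that by auto
    have "d x y \<le> d x (p x) + d (p x) y" using triangle that px by blast
    also have "d (p x) y \<le> d (p x) (p y) + d (p y) y" using triangle that px by blast
    finally have "d x y \<le> 2 + d (p x) (p y)"
      using A(4)[OF that(1)] A(4)[OF that(2)] commute[of "p y" y] by linarith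
    moreover have "(\<lambda>(a,b). d a b) (p x, p y) \<le> (\<Sum>(a,b)\<in>A\<times>A. d a b)"
      by (rule member_le_sum) (use A that in auto)
    ultimately show ?thesis by (simp add: C_def)
  qed
  moreover have "C > 0"
  proof -
    have "(\<Sum>(a,b)\<in>A\<times>A. d a b) \<ge> 0" by (rule sum_nonneg) auto
    then show ?thesis by (simp add: C_def)
  qed
  ultimately show ?thesis using that by blast
qed

text \<open>
  The function is the pointwise limit of its compositions with finite-valued approximations of
  the identity.
\<close>

lemma lipschitz_measurable:
  fixes F :: "'x \<Rightarrow> real"
  assumes X: "measurably_precompact X d"
    and L: "\<And>x y. x \<in> space X \<Longrightarrow> y \<in> space X \<Longrightarrow> \<bar>F x - F y\<bar> \<le> L * d x y"
  shows "F \<in> borel_measurable X"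
proof -
  interpret Metric_space "space X" d using X by (simp add: measurably_precompact_def)
  have "\<exists>A p. finite A \<and> A \<subseteq> space X \<and> p \<in> measurable X (count_space A) \<and>
        (\<forall>x\<in>space X. p x \<in> A \<and> d x (p x) < 1 / Suc n)" for n
    by (rule measurably_precompactE[OF X, of "1 / Suc n"]) (simp, blast)
  then obtain A p where A: "\<And>n. A n \<subseteq> space X"
    and p: "\<And>n. p n \<in> measurable X (count_space (A n))"
    and px: "\<And>n x. x \<in> space X \<Longrightarrow> p n x \<in> A n \<and> d x (p n x) < 1 / Suc n"
    by metis
  show ?thesis
  proof (rule borel_measurable_LIMSEQ_metric)
    show "(\<lambda>x. F (p n x)) \<in> borel_measurable X" for n
      using measurable_compose[OF p[of n], of F borel] by simp
    fix x assume x: "x \<in> space X"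
    show "(\<lambda>n. F (p n x)) \<longlonglongrightarrow> F x"
    proof (rule LIMSEQ_I)
      fix r :: real assume r: "r > 0"
      obtain N where N: "\<bar>L\<bar> / r < real (Suc N)"
        using reals_Archimedean2[of "\<bar>L\<bar> / r"] by (metis less_trans lessI of_nat_less_iff)
      have "norm (F (p n x) - F x) < r" if "n \<ge> N" for n
      proof -
        have "p n x \<in> space X" using px[OF x, of n] A by auto
        then have "\<bar>F x - F (p n x)\<bar> \<le> L * d x (p n x)" using L x by blast
        also have "\<dots> \<le> \<bar>L\<bar> * d x (p n x)" by (intro mult_right_mono) auto
        also have "\<dots> \<le> \<bar>L\<bar> * (1 / Suc n)" using px[OF x, of n] by (intro mult_left_mono) auto
        also have "\<dots> < r"
        proof -
          have "\<bar>L\<bar> / r < real (Suc n)" using N that by (simp add: less_le_trans)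
          then show ?thesis using r by (simp add: field_simps)
        qed
        finally show ?thesis by (simp add: abs_minus_commute)
      qed
      then show "\<exists>no. \<forall>n\<ge>no. norm (F (p n x) - F x) < r" by blast
    qed
  qed
qed

text \<open>
  An open set is the union of those cells of the countably many finite partitions that it
  contains.
\<close>

lemma metric_open_measurable:
  assumes X: "measurably_precompact X d" and sub: "S \<subseteq> space X"
    and op: "\<And>x. x \<in> S \<Longrightarrow> \<exists>r>0. \<forall>y\<in>space X. d x y < r \<longrightarrow> y \<in> S"
  shows "S \<in> sets X"
proof -
  interpret Metric_space "space X" d using X by (simp add: measurably_precompact_def)
  have "\<exists>A p. finite A \<and> A \<subseteq> space X \<and> p \<in> measurable X (count_space A) \<and>
        (\<forall>x\<in>space X. p x \<in> A \<and> d x (p x) < 1 / Suc n)" for n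
    by (rule measurably_precompactE[OF X, of "1 / Suc n"]) (simp, blast)
  then obtain A p where A: "\<And>n. finite (A n)" "\<And>n. A n \<subseteq> space X"
    and p: "\<And>n. p n \<in> measurable X (count_space (A n))"
    and px: "\<And>n x. x \<in> space X \<Longrightarrow> p n x \<in> A n \<and> d x (p n x) < 1 / Suc n"
    by metis
  let ?B = "\<lambda>n. {a\<in>A n. p n -` {a} \<inter> space X \<subseteq> S}"
  have "S = (\<Union>n. \<Union>a\<in>?B n. p n -` {a} \<inter> space X)"
  proof (intro equalityI subsetI)
    fix x assume x: "x \<in> S"
    then obtain r where r: "r > 0" "\<forall>y\<in>space X. d x y < r \<longrightarrow> y \<in> S" using op by blast
    obtain n where n: "1 / Suc n < r / 2" using r reals_Archimedean[of "r/2"] by (auto simp: inverse_eq_divide)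
    have xs: "x \<in> space X" using x sub by auto
    have "y \<in> S" if "y \<in> space X" "p n y = p n x" for y
    proof -
      have "p n x \<in> space X" using px[OF xs, of n] A by auto
      then have "d x y \<le> d x (p n x) + d (p n y) y" using triangle[of x "p n x" y] xs that by auto
      also have "\<dots> < r" using px[OF xs, of n] px[OF that(1), of n] n commute[of "p n y" y] by linarith
      finally show ?thesis using r that by auto
    qed
    then have "p n x \<in> ?B n" "x \<in> p n -` {p n x} \<inter> space X" using px[OF xs] xs by auto
    then show "x \<in> (\<Union>n. \<Union>a\<in>?B n. p n -` {a} \<inter> space X)" by blast
  qed auto
  also have "\<dots> \<in> sets X"
  proof (intro sets.countable_UN image_subsetI sets.finite_UN)
    show "p n -` {a} \<inter> space X \<in> sets X" if "a \<in> ?B n" for n a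
      using that p[of n] by (intro measurable_sets[of _ _ "count_space (A n)"]) auto
  qed (use A(1) in auto)
  finally show ?thesis .
qed

text \<open>
  The factor \<open>1/2\<close> makes \<open>pair_dist d d\<close> the metric \<open>avg_dist d\<close> of doubled labels.
\<close>

definition pair_dist :: "('x \<Rightarrow> 'x \<Rightarrow> real) \<Rightarrow> ('y \<Rightarrow> 'y \<Rightarrow> real) \<Rightarrow> 'x \<times> 'y \<Rightarrow> 'x \<times> 'y \<Rightarrow> real" where
  "pair_dist d e p q = (d (fst p) (fst q) + e (snd p) (snd q)) / 2"

lemma avg_dist_eq_pair_dist: "avg_dist d = pair_dist d d"
  by (intro ext) (simp add: avg_dist_def pair_dist_def)

lemma Metric_space_pair_dist:
  assumes "Metric_space A d" "Metric_space B e"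
  shows "Metric_space (A \<times> B) (pair_dist d e)"
proof -
  interpret a: Metric_space A d by fact
  interpret b: Metric_space B e by fact
  show ?thesis
  proof
    show "0 \<le> pair_dist d e x y" for x y by (simp add: pair_dist_def)
    show "pair_dist d e x y = pair_dist d e y x" for x y by (simp add: pair_dist_def a.commute b.commute)
    show "pair_dist d e x y = 0 \<longleftrightarrow> x = y" if "x \<in> A \<times> B" "y \<in> A \<times> B" for x y
      using that by (auto simp: pair_dist_def add_nonneg_eq_0_iff)
    show "pair_dist d e x z \<le> pair_dist d e x y + pair_dist d e y z"
      if "x \<in> A \<times> B" "y \<in> A \<times> B" "z \<in> A \<times> B" for x y z
      using that a.triangle[of "fst x" "fst y" "fst z"] b.triangle[of "snd x" "snd y" "snd z"]
      unfolding pair_dist_def by (simp add: mem_Times_iff field_simps)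
  qed
qed

lemma measurably_precompact_pair:
  assumes X: "measurably_precompact X d" and Y: "measurably_precompact Y e"
  shows "measurably_precompact (X \<Otimes>\<^sub>M Y) (pair_dist d e)"
  unfolding measurably_precompact_def
proof (intro conjI allI impI)
  show "Metric_space (space (X \<Otimes>\<^sub>M Y)) (pair_dist d e)"
    unfolding space_pair_measure using X Y
    by (intro Metric_space_pair_dist) (auto simp: measurably_precompact_def)
  show "space (X \<Otimes>\<^sub>M Y) \<noteq> {}" using X Y by (auto simp: measurably_precompact_def space_pair_measure)
  fix r :: real assume r: "r > 0"
  obtain A p where A: "finite A" "A \<subseteq> space X" "p \<in> measurable X (count_space A)"
    "\<And>x. x \<in> space X \<Longrightarrow> p x \<in> A" "\<And>x. x \<in> space X \<Longrightarrow> d x (p x) < r"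
    using measurably_precompactE[OF X r] by metis
  obtain B q where B: "finite B" "B \<subseteq> space Y" "q \<in> measurable Y (count_space B)"
    "\<And>x. x \<in> space Y \<Longrightarrow> q x \<in> B" "\<And>x. x \<in> space Y \<Longrightarrow> e x (q x) < r"
    using measurably_precompactE[OF Y r] by metis
  note [measurable] = A(3) B(3)
  let ?p = "\<lambda>z. (p (fst z), q (snd z))"
  have "?p \<in> measurable (X \<Otimes>\<^sub>M Y) (count_space A \<Otimes>\<^sub>M count_space B)" by measurable
  then have "?p \<in> measurable (X \<Otimes>\<^sub>M Y) (count_space (A \<times> B))"
    using A B by (simp add: pair_measure_countable countable_finite)
  moreover have "\<forall>x\<in>space (X \<Otimes>\<^sub>M Y). pair_dist d e x (?p x) < r"
  proof
    fix x assume "x \<in> space (X \<Otimes>\<^sub>M Y)"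
    then show "pair_dist d e x (?p x) < r"
      using A(5)[of "fst x"] B(5)[of "snd x"] by (auto simp: pair_dist_def space_pair_measure)
  qed
  ultimately show "\<exists>A p. finite A \<and> A \<subseteq> space (X \<Otimes>\<^sub>M Y) \<and> p \<in> measurable (X \<Otimes>\<^sub>M Y) (count_space A) \<and>
        (\<forall>x\<in>space (X \<Otimes>\<^sub>M Y). pair_dist d e x (p x) < r)"
    using A B by (intro exI[of _ "A \<times> B"] exI[of _ ?p]) (auto simp: space_pair_measure)
qed

definition window_dist :: "'i set \<Rightarrow> ('x \<Rightarrow> 'x \<Rightarrow> real) \<Rightarrow> ('i \<Rightarrow> 'x) \<Rightarrow> ('i \<Rightarrow> 'x) \<Rightarrow> real" where
  "window_dist W d x y = (\<Sum>i\<in>W. d (x i) (y i))"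

abbreviation config :: "'i set \<Rightarrow> 'x measure \<Rightarrow> ('i \<Rightarrow> 'x) measure" where
  "config I X \<equiv> PiM I (\<lambda>_. X)"

lemma config_component: "x \<in> space (config I X) \<Longrightarrow> i \<in> I \<Longrightarrow> x i \<in> space X"
  by (auto simp: space_PiM)

lemma Metric_space_window_dist:
  assumes "Metric_space M d" "finite I"
  shows "Metric_space (PiE I (\<lambda>_. M)) (window_dist I d)"
proof -
  interpret Metric_space M d by fact
  show ?thesis
  proof
    show "0 \<le> window_dist I d x y" for x y by (simp add: window_dist_def sum_nonneg)
    show "window_dist I d x y = window_dist I d y x" for x y
      by (simp add: window_dist_def commute)
    show "window_dist I d x y = 0 \<longleftrightarrow> x = y" if "x \<in> PiE I (\<lambda>_. M)" "y \<in> PiE I (\<lambda>_. M)" for x y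
    proof
      assume "window_dist I d x y = 0"
      then have "\<forall>i\<in>I. d (x i) (y i) = 0"
        using assms(2) by (simp add: window_dist_def sum_nonneg_eq_0_iff)
      then have "\<forall>i\<in>I. x i = y i" using that by (metis PiE_mem zero)
      then show "x = y" using that by (meson PiE_ext)
    next
      assume "x = y" then show "window_dist I d x y = 0"
        using that unfolding window_dist_def by (intro sum.neutral) (metis PiE_mem zero)
    qed
    show "window_dist I d x z \<le> window_dist I d x y + window_dist I d y z"
      if "x \<in> PiE I (\<lambda>_. M)" "y \<in> PiE I (\<lambda>_. M)" "z \<in> PiE I (\<lambda>_. M)" for x y z
      unfolding window_dist_def sum.distrib[symmetric]
      using that by (intro sum_mono triangle) auto
  qed
qed

text \<open>
  Applying the approximation of a single label in every coordinate adds up the errors, so each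
  coordinate gets the share \<open>s\<close> of \<open>r\<close>.
\<close>

lemma measurably_precompact_config:
  assumes X: "measurably_precompact X d" and I: "finite I"
  shows "measurably_precompact (config I X) (window_dist I d)"
  unfolding measurably_precompact_def
proof (intro conjI allI impI)
  show "Metric_space (space (config I X)) (window_dist I d)"
    unfolding space_PiM using X I
    by (intro Metric_space_window_dist) (auto simp: measurably_precompact_def)
  show "space (config I X) \<noteq> {}" using X by (auto simp: measurably_precompact_def space_PiM PiE_eq_empty_iff)
  fix r :: real assume r: "r > 0"
  define s where "s = r / real (Suc (card I))"
  have s: "s > 0" using r by (simp add: s_def)
  interpret Metric_space "space X" d using X by (simp add: measurably_precompact_def)
  obtain A p where A: "finite A" "A \<subseteq> space X" "p \<in> measurable X (count_space A)"
    "\<And>x. x \<in> space X \<Longrightarrow> p x \<in> A" "\<And>x. x \<in> space X \<Longrightarrow> d x (p x) < s"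
    using measurably_precompactE[OF X s] by metis
  let ?p = "\<lambda>z. \<lambda>i\<in>I. p (z i)" and ?A = "PiE I (\<lambda>_. A)"
  have fin: "finite ?A" using A I by (intro finite_PiE) auto
  have "?p \<in> measurable (config I X) (count_space ?A)"
    unfolding measurable_count_space_eq2[OF fin]
  proof (intro conjI ballI)
    show "?p \<in> space (config I X) \<rightarrow> ?A"
    proof
      fix x assume "x \<in> space (config I X)"
      then show "?p x \<in> ?A" using A(4) by (simp add: space_PiM PiE_iff)
    qed
    fix a assume a: "a \<in> ?A"
    have "?p -` {a} \<inter> space (config I X) = {x\<in>space (config I X). \<forall>i\<in>I. p (x i) = a i}"
      using a by (auto simp: fun_eq_iff PiE_iff extensional_def)
    also have "\<dots> \<in> sets (config I X)"
    proof (rule sets.sets_Collect_finite_All[OF _ I])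
      fix i assume i: "i \<in> I"
      have "(\<lambda>x. p (x i)) \<in> measurable (config I X) (count_space A)"
        using i A(3) by (intro measurable_compose[OF measurable_component_singleton]) auto
      then have "(\<lambda>x. p (x i)) -` {a i} \<inter> space (config I X) \<in> sets (config I X)"
        using a i by (intro measurable_sets) auto
      then show "{x \<in> space (config I X). p (x i) = a i} \<in> sets (config I X)"
        by (simp add: vimage_def Int_def conj_commute)
    qed
    finally show "?p -` {a} \<inter> space (config I X) \<in> sets (config I X)" .
  qed
  moreover have "\<forall>x\<in>space (config I X). window_dist I d x (?p x) < r"
  proof
    fix x assume x: "x \<in> space (config I X)"
    have "window_dist I d x (?p x) \<le> (\<Sum>i\<in>I. s)"
      unfolding window_dist_def using A(5) config_component[OF x] by (intro sum_mono) (auto intro: less_imp_le)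
    also have "\<dots> < r" using r by (simp add: s_def field_simps)
    finally show "window_dist I d x (?p x) < r" .
  qed
  ultimately show "\<exists>A p. finite A \<and> A \<subseteq> space (config I X) \<and> p \<in> measurable (config I X) (count_space A) \<and>
        (\<forall>x\<in>space (config I X). window_dist I d x (p x) < r)"
    using A fin by (intro exI[of _ ?A] exI[of _ ?p]) (auto simp: space_PiM)
qed

lemma dist_measurable:
  assumes X: "measurably_precompact X d"
  shows "(\<lambda>z. d (fst z) (snd z)) \<in> borel_measurable (X \<Otimes>\<^sub>M X)"
proof (rule lipschitz_measurable[OF measurably_precompact_pair[OF X X], where L=2])
  interpret Metric_space "space X" d using X by (simp add: measurably_precompact_def)
  fix x y assume "x \<in> space (X \<Otimes>\<^sub>M X)" "y \<in> space (X \<Otimes>\<^sub>M X)"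
  then have m: "fst x \<in> space X" "snd x \<in> space X" "fst y \<in> space X" "snd y \<in> space X"
    by (auto simp: space_pair_measure)
  have "d (fst x) (snd x) - d (fst y) (snd y) \<le> d (fst x) (fst y) + d (snd x) (snd y)"
    using triangle[OF m(1,3,2)] triangle[OF m(3,4,2)] commute[of "snd x" "snd y"] by linarith
  moreover have "d (fst y) (snd y) - d (fst x) (snd x) \<le> d (fst x) (fst y) + d (snd x) (snd y)"
    using triangle[OF m(3,1,4)] triangle[OF m(1,2,4)] commute[of "fst x" "fst y"] by linarith
  ultimately have "\<bar>d (fst x) (snd x) - d (fst y) (snd y)\<bar> \<le> d (fst x) (fst y) + d (snd x) (snd y)"
    by (simp only: abs_le_iff minus_diff_eq)
  then show "\<bar>d (fst x) (snd x) - d (fst y) (snd y)\<bar> \<le> 2 * pair_dist d d x y"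
    by (simp only: pair_dist_def mult_2 field_sum_of_halves)
qed

lemma dist_compose_measurable:
  assumes X: "measurably_precompact X d" and [measurable]: "f \<in> measurable M X" "g \<in> measurable M X"
  shows "(\<lambda>z. d (f z) (g z)) \<in> borel_measurable M"
  using measurable_compose[of "\<lambda>z. (f z, g z)" M "X \<Otimes>\<^sub>M X", OF _ dist_measurable[OF X]] by simp

section \<open>Functions that are Lipschitz in finitely many coordinates\<close>

text \<open>
  These are the test functions: they are uniformly dense in the continuous functions, and their
  Lipschitz bounds become bounds in the Hamming average once they are averaged over all sites.
\<close>

definition window_lipschitz :: "'i set \<Rightarrow> 'x measure \<Rightarrow> ('x \<Rightarrow> 'x \<Rightarrow> real) \<Rightarrow> (('i \<Rightarrow> 'x) \<Rightarrow> real) \<Rightarrow> bool" where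
  "window_lipschitz I X d F \<longleftrightarrow> (\<exists>W L. finite W \<and> W \<subseteq> I \<and> 0 \<le> L \<and>
     (\<forall>x\<in>space (config I X). \<forall>y\<in>space (config I X). \<bar>F x - F y\<bar> \<le> L * window_dist W d x y))"

lemma window_lipschitzI:
  assumes "finite W" "W \<subseteq> I" "0 \<le> L"
    "\<And>x y. x \<in> space (config I X) \<Longrightarrow> y \<in> space (config I X) \<Longrightarrow> \<bar>F x - F y\<bar> \<le> L * window_dist W d x y"
  shows "window_lipschitz I X d F"
  using assms unfolding window_lipschitz_def by blast

lemma window_lipschitzE:
  assumes "window_lipschitz I X d F"
  obtains W L where "finite W" "W \<subseteq> I" "0 \<le> L"
    "\<And>x y. x \<in> space (config I X) \<Longrightarrow> y \<in> space (config I X) \<Longrightarrow> \<bar>F x - F y\<bar> \<le> L * window_dist W d x y"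
  using assms unfolding window_lipschitz_def by blast

lemma window_dist_nonneg: "Metric_space M d \<Longrightarrow> 0 \<le> window_dist W d x y"
  unfolding window_dist_def by (intro sum_nonneg) (simp add: Metric_space.nonneg)

lemma window_dist_mono:
  "Metric_space M d \<Longrightarrow> W \<subseteq> W' \<Longrightarrow> finite W' \<Longrightarrow> window_dist W d x y \<le> window_dist W' d x y"
  unfolding window_dist_def by (intro sum_mono2) (auto simp: Metric_space.nonneg)

lemma window_lipschitz_const: "Metric_space (space X) d \<Longrightarrow> window_lipschitz I X d (\<lambda>_. c)"
  by (rule window_lipschitzI[of "{}" _ 0]) auto

lemma window_lipschitz_compose2:
  assumes d: "Metric_space (space X) d"
    and F: "window_lipschitz I X d F" and G: "window_lipschitz I X d G" and K: "0 \<le> K"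
    and \<phi>: "\<And>a b a' b'. \<bar>\<phi> a b - \<phi> a' b'\<bar> \<le> K * (\<bar>a - a'\<bar> + \<bar>b - b'\<bar>)"
  shows "window_lipschitz I X d (\<lambda>x. \<phi> (F x) (G x))"
proof -
  obtain W L where W: "finite W" "W \<subseteq> I" "0 \<le> L"
    "\<And>x y. x \<in> space (config I X) \<Longrightarrow> y \<in> space (config I X) \<Longrightarrow> \<bar>F x - F y\<bar> \<le> L * window_dist W d x y"
    using window_lipschitzE[OF F] by metis
  obtain W' L' where W': "finite W'" "W' \<subseteq> I" "0 \<le> L'"
    "\<And>x y. x \<in> space (config I X) \<Longrightarrow> y \<in> space (config I X) \<Longrightarrow> \<bar>G x - G y\<bar> \<le> L' * window_dist W' d x y"
    using window_lipschitzE[OF G] by metis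
  show ?thesis
  proof (rule window_lipschitzI[of "W \<union> W'" _ "K * (L + L')"])
    fix x y assume xy: "x \<in> space (config I X)" "y \<in> space (config I X)"
    have "\<bar>\<phi> (F x) (G x) - \<phi> (F y) (G y)\<bar> \<le> K * (\<bar>F x - F y\<bar> + \<bar>G x - G y\<bar>)" by (rule \<phi>)
    also have "\<dots> \<le> K * (L * window_dist W d x y + L' * window_dist W' d x y)"
      using W(4)[OF xy] W'(4)[OF xy] K by (intro mult_left_mono) auto
    also have "\<dots> \<le> K * (L * window_dist (W \<union> W') d x y + L' * window_dist (W \<union> W') d x y)"
      using W W' K d by (intro mult_left_mono add_mono window_dist_mono) auto
    finally show "\<bar>\<phi> (F x) (G x) - \<phi> (F y) (G y)\<bar> \<le> K * (L + L') * window_dist (W \<union> W') d x y"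
      by (simp add: algebra_simps)
  qed (use W W' K in auto)
qed

lemma window_lipschitz_add:
  assumes "Metric_space (space X) d" "window_lipschitz I X d F" "window_lipschitz I X d G"
  shows "window_lipschitz I X d (\<lambda>x. F x + G x)"
  by (rule window_lipschitz_compose2[OF assms, where K=1 and \<phi>="\<lambda>a b. a + b"]) auto

lemma window_lipschitz_max:
  assumes "Metric_space (space X) d" "window_lipschitz I X d F" "window_lipschitz I X d G"
  shows "window_lipschitz I X d (\<lambda>x. max (F x) (G x))"
  by (rule window_lipschitz_compose2[OF assms, where K=1 and \<phi>="max"]) (auto simp: max_def)

lemma window_lipschitz_compose:
  assumes "Metric_space (space X) d" "window_lipschitz I X d F" "0 \<le> K"
    "\<And>a a' :: real. \<bar>\<phi> a - \<phi> a'\<bar> \<le> K * \<bar>a - a'\<bar>"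
  shows "window_lipschitz I X d (\<lambda>x. \<phi> (F x))"
proof (rule window_lipschitz_compose2[OF assms(1,2,2,3), where \<phi>="\<lambda>a _. \<phi> a"])
  fix a b a' b' :: real
  have "\<bar>\<phi> a - \<phi> a'\<bar> \<le> K * \<bar>a - a'\<bar>" by (rule assms)
  also have "\<dots> \<le> K * (\<bar>a - a'\<bar> + \<bar>b - b'\<bar>)" using assms(3) by (intro mult_left_mono) auto
  finally show "\<bar>\<phi> a - \<phi> a'\<bar> \<le> K * (\<bar>a - a'\<bar> + \<bar>b - b'\<bar>)" .
qed

lemma window_lipschitz_cmult:
  assumes "Metric_space (space X) d" "window_lipschitz I X d F"
  shows "window_lipschitz I X d (\<lambda>x. c * F x)"
  by (rule window_lipschitz_compose[OF assms, where K="\<bar>c\<bar>" and \<phi>="\<lambda>a. c * a"])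
     (auto simp: abs_mult[symmetric] algebra_simps)

lemma window_lipschitz_sum:
  assumes d: "Metric_space (space X) d" and "\<And>j. j \<in> J \<Longrightarrow> window_lipschitz I X d (F j)"
  shows "window_lipschitz I X d (\<lambda>x. \<Sum>j\<in>J. F j x)"
proof (cases "finite J")
  case True
  then show ?thesis using assms(2)
  proof (induction J rule: finite_induct)
    case empty then show ?case by (simp add: window_lipschitz_const[OF d])
  next
    case (insert j J)
    have "window_lipschitz I X d (\<lambda>x. F j x + (\<Sum>j\<in>J. F j x))"
      by (rule window_lipschitz_add[OF d]) (use insert in auto)
    then show ?case using insert by simp
  qed
qed (simp add: window_lipschitz_const[OF d])

text \<open>
  Covers shifts and coordinate projections: maps for which every output coordinate depends on a
  single input coordinate.
\<close>

lemma window_lipschitz_reindex: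
  assumes d: "Metric_space (space X) d" and e: "Metric_space (space Y) e"
    and F: "window_lipschitz J Y e F" and K: "0 \<le> K"
    and r: "\<And>j. j \<in> J \<Longrightarrow> r j \<in> I"
    and T: "\<And>x. x \<in> space (config I X) \<Longrightarrow> T x \<in> space (config J Y)"
    and le: "\<And>x y j. x \<in> space (config I X) \<Longrightarrow> y \<in> space (config I X) \<Longrightarrow> j \<in> J \<Longrightarrow>
        e (T x j) (T y j) \<le> K * d (x (r j)) (y (r j))"
  shows "window_lipschitz I X d (\<lambda>x. F (T x))"
proof -
  obtain W L where W: "finite W" "W \<subseteq> J" "0 \<le> L"
    "\<And>x y. x \<in> space (config J Y) \<Longrightarrow> y \<in> space (config J Y) \<Longrightarrow> \<bar>F x - F y\<bar> \<le> L * window_dist W e x y"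
    using window_lipschitzE[OF F] by metis
  show ?thesis
  proof (rule window_lipschitzI[of "r ` W" _ "L * (K * real (card W))"])
    fix x y assume xy: "x \<in> space (config I X)" "y \<in> space (config I X)"
    have "\<bar>F (T x) - F (T y)\<bar> \<le> L * window_dist W e (T x) (T y)" using W(4) T xy by blast
    also have "\<dots> \<le> L * (\<Sum>j\<in>W. K * window_dist (r ` W) d x y)"
      unfolding window_dist_def[of W]
    proof (intro mult_left_mono sum_mono)
      fix j assume j: "j \<in> W"
      have "e (T x j) (T y j) \<le> K * d (x (r j)) (y (r j))" using le xy j W by blast
      also have "\<dots> \<le> K * window_dist (r ` W) d x y"
        unfolding window_dist_def using j W K d
        by (intro mult_left_mono member_le_sum) (auto simp: Metric_space.nonneg)
      finally show "e (T x j) (T y j) \<le> K * window_dist (r ` W) d x y" .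
    qed (use W in auto)
    finally show "\<bar>F (T x) - F (T y)\<bar> \<le> L * (K * real (card W)) * window_dist (r ` W) d x y"
      by (simp add: algebra_simps)
  qed (use W r K in auto)
qed

lemma window_dist_bounded:
  assumes X: "measurably_precompact X d" and W: "W \<subseteq> I"
  obtains C where "C > 0"
    "\<And>x y. x \<in> space (config I X) \<Longrightarrow> y \<in> space (config I X) \<Longrightarrow> window_dist W d x y \<le> C"
proof -
  obtain C where C: "C > 0" "\<And>x y. x \<in> space X \<Longrightarrow> y \<in> space X \<Longrightarrow> d x y \<le> C"
    using measurably_precompact_bounded[OF X] by metis
  have "window_dist W d x y \<le> C * real (card W) + 1"
    if "x \<in> space (config I X)" "y \<in> space (config I X)" for x y
  proof -
    have "window_dist W d x y \<le> (\<Sum>i\<in>W. C)"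
      unfolding window_dist_def using that C(2) W by (intro sum_mono) (auto simp: config_component subset_iff)
    then show ?thesis by (simp add: mult.commute)
  qed
  moreover have "C * real (card W) + 1 > 0" using C by (simp add: add_nonneg_pos)
  ultimately show ?thesis using that by blast
qed

lemma window_lipschitz_bounded:
  assumes X: "measurably_precompact X d" and F: "window_lipschitz I X d F"
  obtains C where "C > 0" "\<And>x. x \<in> space (config I X) \<Longrightarrow> \<bar>F x\<bar> \<le> C"
proof -
  obtain W L where W: "finite W" "W \<subseteq> I" "0 \<le> L"
    "\<And>x y. x \<in> space (config I X) \<Longrightarrow> y \<in> space (config I X) \<Longrightarrow> \<bar>F x - F y\<bar> \<le> L * window_dist W d x y"
    using window_lipschitzE[OF F] by metis
  obtain K where K: "K > 0" "\<And>x y. x \<in> space (config I X) \<Longrightarrow> y \<in> space (config I X) \<Longrightarrow> window_dist W d x y \<le> K"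
    using window_dist_bounded[OF X W(2)] by metis
  have "space (config I X) \<noteq> {}"
    using X by (auto simp: measurably_precompact_def space_PiM PiE_eq_empty_iff)
  then obtain a where a: "a \<in> space (config I X)" by blast
  have "\<bar>F x\<bar> \<le> \<bar>F a\<bar> + L * K + 1" if x: "x \<in> space (config I X)" for x
  proof -
    have "L * window_dist W d x a \<le> L * K"
      using W K(2)[OF x a] by (intro mult_left_mono) auto
    then show ?thesis using W(4)[OF x a] by linarith
  qed
  moreover have "\<bar>F a\<bar> + L * K + 1 > 0" using W K by (simp add: add_nonneg_pos)
  ultimately show ?thesis using that by blast
qed

text \<open>
  The function factors through the finitely many coordinates in its window, and there
  \<open>lipschitz_measurable\<close> applies.
\<close>

lemma window_lipschitz_measurable:
  assumes X: "measurably_precompact X d" and F: "window_lipschitz I X d F"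
  shows "F \<in> borel_measurable (config I X)"
proof -
  interpret Metric_space "space X" d using X by (simp add: measurably_precompact_def)
  obtain W L where W: "finite W" "W \<subseteq> I" "0 \<le> L"
    and FW: "\<And>x y. x \<in> space (config I X) \<Longrightarrow> y \<in> space (config I X) \<Longrightarrow> \<bar>F x - F y\<bar> \<le> L * window_dist W d x y"
    using window_lipschitzE[OF F] by metis
  obtain a where a: "a \<in> space X" using X by (auto simp: measurably_precompact_def)
  define E where "E w = (\<lambda>i\<in>I. if i \<in> W then w i else a)" for w
  have E: "E w \<in> space (config I X)" if "w \<in> space (config W X)" for w
    using that a by (auto simp: E_def space_PiM PiE_iff)
  have "(\<lambda>w. F (E w)) \<in> borel_measurable (config W X)"
  proof (rule lipschitz_measurable[OF measurably_precompact_config[OF X W(1)]])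
    fix w w' assume "w \<in> space (config W X)" "w' \<in> space (config W X)"
    then have "\<bar>F (E w) - F (E w')\<bar> \<le> L * window_dist W d (E w) (E w')" using FW E by blast
    also have "window_dist W d (E w) (E w') = window_dist W d w w'"
      unfolding window_dist_def E_def using W by (intro sum.cong) auto
    finally show "\<bar>F (E w) - F (E w')\<bar> \<le> L * window_dist W d w w'" .
  qed
  moreover have "(\<lambda>x. restrict x W) \<in> measurable (config I X) (config W X)"
    using W by (intro measurable_restrict_subset) auto
  ultimately have "(\<lambda>x. F (E (restrict x W))) \<in> borel_measurable (config I X)"
    by (rule measurable_compose[rotated])
  moreover have "F (E (restrict x W)) = F x" if x: "x \<in> space (config I X)" for x
  proof -
    have "E (restrict x W) \<in> space (config I X)"
      using x W by (intro E) (auto simp: space_PiM PiE_iff)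
    moreover have "window_dist W d (E (restrict x W)) x = 0"
      unfolding window_dist_def E_def using W x by (intro sum.neutral) (auto simp: subset_iff config_component)
    ultimately show ?thesis using FW[of "E (restrict x W)" x] x by simp
  qed
  ultimately show ?thesis using measurable_cong[of "config I X" "\<lambda>x. F (E (restrict x W))" F] by blast
qed

text \<open>
  McShane's formula. The supremum of \<open>h y - \<rho> y - L * window_dist W d x y\<close> over \<open>y\<close> is Lipschitz in
  \<open>x\<close>; it is at most \<open>h x\<close> by hypothesis, and at least \<open>h x - \<rho> x\<close> by the choice \<open>y = x\<close>. Charging the
  error to one endpoint lets the lemma apply to indicators of open sets, with an error supported
  near the boundary.
\<close>

lemma lipschitz_envelope:
  fixes h \<rho> :: "('i \<Rightarrow> 'x) \<Rightarrow> real"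
  assumes d: "Metric_space (space X) d" and W: "finite W" "W \<subseteq> I" and L: "0 \<le> L"
    and h: "\<And>x y. x \<in> space (config I X) \<Longrightarrow> y \<in> space (config I X) \<Longrightarrow> h x - h y \<le> \<rho> x + L * window_dist W d x y"
  obtains f where "window_lipschitz I X d f" "\<And>x. x \<in> space (config I X) \<Longrightarrow> \<bar>h x - f x\<bar> \<le> \<rho> x"
proof -
  let ?S = "space (config I X)"
  interpret Metric_space "space X" d by fact
  define f where "f x = (SUP y\<in>?S. h y - \<rho> y - L * window_dist W d x y)" for x
  have sym: "window_dist W d x y = window_dist W d y x" for x y
    by (simp add: window_dist_def commute)
  have tri: "window_dist W d x z \<le> window_dist W d x y + window_dist W d y z"
    if "x \<in> ?S" "y \<in> ?S" "z \<in> ?S" for x y z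
    unfolding window_dist_def sum.distrib[symmetric]
    using that W by (intro sum_mono triangle) (auto simp: config_component subset_iff)
  have up: "h y - \<rho> y - L * window_dist W d x y \<le> h x" if "x \<in> ?S" "y \<in> ?S" for x y
    using h[OF that(2,1)] sym[of x y] by auto
  have bdd: "bdd_above ((\<lambda>y. h y - \<rho> y - L * window_dist W d x y) ` ?S)" if "x \<in> ?S" for x
    by (rule bdd_aboveI2) (rule up[OF that])
  have "\<bar>h x - f x\<bar> \<le> \<rho> x" if x: "x \<in> ?S" for x
  proof -
    have "f x \<le> h x" unfolding f_def 
    proof (rule cSUP_least)
      show "?S \<noteq> {}" using x by blast
    qed (rule up[OF x])
    moreover have "h x - \<rho> x - L * window_dist W d x x \<le> f x"
      unfolding f_def by (rule cSUP_upper[OF x bdd[OF x]])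
    moreover have "window_dist W d x x = 0"
      unfolding window_dist_def using x W by (intro sum.neutral) (auto simp: config_component subset_iff)
    ultimately show ?thesis by auto
  qed
  moreover have le: "f x - f y \<le> L * window_dist W d x y" if "x \<in> ?S" "y \<in> ?S" for x y
  proof -
    have "f x \<le> f y + L * window_dist W d x y"
      unfolding f_def[of x]
    proof (rule cSUP_least)
      show "?S \<noteq> {}" using that by blast
      fix z assume z: "z \<in> ?S"
      have "h z - \<rho> z - L * window_dist W d y z \<le> f y"
        unfolding f_def by (rule cSUP_upper[OF z bdd[OF that(2)]])
      moreover have "L * window_dist W d y z \<le> L * (window_dist W d y x + window_dist W d x z)"
        using tri that z L by (intro mult_left_mono) auto
      ultimately show "h z - \<rho> z - L * window_dist W d x z \<le> f y + L * window_dist W d x y"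
        using sym[of x y] by (simp add: algebra_simps)
    qed
    then show ?thesis by simp
  qed
  have "window_lipschitz I X d f"
  proof (rule window_lipschitzI[OF W L])
    fix x y assume "x \<in> ?S" "y \<in> ?S"
    then show "\<bar>f x - f y\<bar> \<le> L * window_dist W d x y"
      using le[of x y] le[of y x] sym[of x y] by (simp add: abs_le_iff)
  qed
  ultimately show ?thesis using that by blast
qed

lemma compact_borel_imp_measurably_precompact:
  assumes d: "Metric_space (space X) d" and ne: "space X \<noteq> {}"
    and comp: "compact_space (Metric_space.mtopology (space X) d)"
    and sets: "sets X = sigma_sets (space X) {U. openin (Metric_space.mtopology (space X) d) U}"
  shows "measurably_precompact X d"
  unfolding measurably_precompact_def
proof (intro conjI d ne allI impI)
  interpret Metric_space "space X" d by fact
  fix r :: real assume r: "r > 0"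
  obtain K where K: "finite K" "K \<subseteq> space X" "space X \<subseteq> (\<Union>x\<in>K. mball x r)"
    using comp r compactin_imp_mtotally_bounded[of "space X"]
    unfolding mtotally_bounded_def compact_space_def by auto
  obtain f :: "'a \<Rightarrow> nat" where f: "inj_on f K" using K finite_imp_inj_to_nat_seg by metis
  \<comment> \<open>\<open>p x\<close> is the first of the finitely many centres whose ball contains \<open>x\<close>\<close>
  define R where "R x a \<longleftrightarrow> a \<in> K \<and> d a x < r \<and> (\<forall>b\<in>K. f b < f a \<longrightarrow> \<not> d b x < r)" for x a
  have ex: "\<exists>a. R x a" if x: "x \<in> space X" for x
  proof -
    obtain a where "a \<in> K" "x \<in> mball a r" using K(3) x by blast
    then have "\<exists>a. a \<in> K \<and> d a x < r" by (intro exI[of _ a]) simp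
    then have "\<exists>a. (a \<in> K \<and> d a x < r) \<and> (\<forall>b. b \<in> K \<and> d b x < r \<longrightarrow> f a \<le> f b)"
      using ex_has_least_nat[of "\<lambda>a. a \<in> K \<and> d a x < r" _ f] by blast
    then show ?thesis unfolding R_def by (meson linorder_not_le)
  qed
  have uniq: "a = b" if "R x a" "R x b" for x a b
    using that f unfolding R_def by (metis inj_on_def linorder_neqE_nat)
  define p where "p x = (THE a. R x a)" for x
  have p: "p x = a \<longleftrightarrow> R x a" if "x \<in> space X" for x a
    unfolding p_def using ex[OF that] uniq by (metis the_equality)
  have "p \<in> measurable X (count_space K)"
    unfolding measurable_count_space_eq2[OF K(1)]
  proof (intro conjI ballI)
    show "p \<in> space X \<rightarrow> K" using p R_def by blast
    fix a assume a: "a \<in> K"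
    have ball: "{x \<in> space X. d b x < r} \<in> sets X" if "b \<in> K" for b
    proof -
      have "{x \<in> space X. d b x < r} = mball b r" using that K by (auto simp: mball_def)
      moreover have "mball b r \<in> sets X" unfolding sets by (intro sigma_sets.Basic) auto
      ultimately show ?thesis by simp
    qed
    have "p -` {a} \<inter> space X = {x \<in> space X. d a x < r \<and> (\<forall>b\<in>{b\<in>K. f b < f a}. \<not> d b x < r)}"
      using p a by (auto simp: R_def)
    also have "\<dots> \<in> sets X"
      using ball a K by (intro sets.sets_Collect_conj sets.sets_Collect_finite_All sets.sets_Collect_neg) auto
    finally show "p -` {a} \<inter> space X \<in> sets X" .
  qed
  moreover have "\<forall>x\<in>space X. d x (p x) < r" using p R_def commute by metis
  ultimately show "\<exists>A p. finite A \<and> A \<subseteq> space X \<and> p \<in> measurable X (count_space A) \<and> (\<forall>x\<in>space X. d x (p x) < r)"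
    using K by blast
qed

text \<open>
  The identity is continuous from the product topology, which is compact.
\<close>

lemma compact_space_pair_dist:
  assumes d: "Metric_space A d" and e: "Metric_space B e"
    and A: "compact_space (Metric_space.mtopology A d)" and B: "compact_space (Metric_space.mtopology B e)"
  shows "compact_space (Metric_space.mtopology (A \<times> B) (pair_dist d e))"
proof -
  interpret a: Metric_space A d by fact
  interpret b: Metric_space B e by fact
  interpret p: Metric_space "A \<times> B" "pair_dist d e" by (rule Metric_space_pair_dist[OF d e])
  have "continuous_map (prod_topology a.mtopology b.mtopology) p.mtopology (\<lambda>x. x)"
    unfolding continuous_map_def
  proof (intro conjI allI impI)
    fix U assume U: "openin p.mtopology U"
    have "{x \<in> topspace (prod_topology a.mtopology b.mtopology). x \<in> U} = U"
      using openin_subset[OF U] by auto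
    moreover have "openin (prod_topology a.mtopology b.mtopology) U"
      unfolding openin_prod_topology_alt
    proof (intro allI impI)
      fix x y assume xy: "(x, y) \<in> U"
      then obtain r where r: "r > 0" "p.mball (x, y) r \<subseteq> U" using U p.openin_mtopology by blast
      have "(x, y) \<in> A \<times> B" using xy openin_subset[OF U] by auto
      moreover have "a.mball x r \<times> b.mball y r \<subseteq> p.mball (x, y) r"
        by (auto simp: pair_dist_def)
      ultimately show "\<exists>S T. openin a.mtopology S \<and> openin b.mtopology T \<and> x \<in> S \<and> y \<in> T \<and> S \<times> T \<subseteq> U"
        using r by (intro exI[of _ "a.mball x r"] exI[of _ "b.mball y r"]) auto
    qed
    ultimately show "openin (prod_topology a.mtopology b.mtopology)
        {x \<in> topspace (prod_topology a.mtopology b.mtopology). x \<in> U}" by simp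
  qed auto
  moreover have "compactin (prod_topology a.mtopology b.mtopology) (A \<times> B)"
    using A B by (simp add: compactin_Times compact_space_def)
  ultimately have "compactin p.mtopology ((\<lambda>x. x) ` (A \<times> B))"
    by (rule image_compactin[rotated])
  then show ?thesis by (simp add: compact_space_def)
qed

lemma window_lipschitz_continuous:
  assumes d: "Metric_space (space X) d" and F: "window_lipschitz I X d F"
  shows "continuous_map (product_topology (\<lambda>_. Metric_space.mtopology (space X) d) I) euclideanreal F"
proof -
  interpret Metric_space "space X" d by fact
  let ?S = "space (config I X)"
  obtain W L where W: "finite W" "W \<subseteq> I" "0 \<le> L"
    and FW: "\<And>x y. x \<in> ?S \<Longrightarrow> y \<in> ?S \<Longrightarrow> \<bar>F x - F y\<bar> \<le> L * window_dist W d x y"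
    using window_lipschitzE[OF F] by metis
  have top: "topspace (product_topology (\<lambda>_. mtopology) I) = ?S" by (simp add: space_PiM)
  show ?thesis
    unfolding continuous_map_def top
  proof (intro conjI allI impI)
    fix U :: "real set" assume "openin euclideanreal U"
    then have U: "open U" by simp
    show "openin (product_topology (\<lambda>_. mtopology) I) {x \<in> ?S. F x \<in> U}"
      unfolding openin_product_topology_alt
    proof
      fix x assume "x \<in> {x \<in> ?S. F x \<in> U}"
      then have x: "x \<in> ?S" "F x \<in> U" by auto
      obtain r where r: "r > 0" "ball (F x) r \<subseteq> U" using U x(2) open_contains_ball by blast
      define q where "q = r / (L * card W + 1)"
      have den: "L * card W + 1 > 0" using W by (simp add: add_nonneg_pos)
      have q: "q > 0" using r den by (simp add: q_def)
      let ?N = "\<lambda>i. if i \<in> W then mball (x i) q else space X"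
      have "y \<in> ?S \<and> F y \<in> U" if y: "y \<in> PiE I ?N" for y
      proof -
        have yS: "y \<in> ?S" using y by (auto simp: space_PiM PiE_iff split: if_splits)
        have "window_dist W d x y \<le> (\<Sum>i\<in>W. q)"
          unfolding window_dist_def using y W by (intro sum_mono) (auto simp: PiE_iff subset_iff split: if_splits intro: less_imp_le)
        then have "L * window_dist W d x y \<le> L * (card W * q)" using W by (intro mult_left_mono) auto
        also have "\<dots> = q * (L * card W + 1) - q" by (simp add: algebra_simps)
        also have "\<dots> < r" using q den by (simp add: q_def)
        finally have "\<bar>F x - F y\<bar> < r" using FW[OF x(1) yS] by linarith
        then show ?thesis using r yS by (auto simp: dist_real_def subset_iff)
      qed
      moreover have "finite {i \<in> I. ?N i \<noteq> topspace mtopology}"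
        by (rule finite_subset[OF _ W(1)]) auto
      moreover have "x \<in> PiE I ?N" using x(1) q by (auto simp: space_PiM PiE_iff)
      ultimately show "\<exists>U'. finite {i \<in> I. U' i \<noteq> topspace mtopology} \<and> (\<forall>i\<in>I. openin mtopology (U' i)) \<and>
          x \<in> PiE I U' \<and> PiE I U' \<subseteq> {x \<in> ?S. F x \<in> U}"
        by (intro exI[of _ ?N]) auto
    qed
  qed auto
qed

text \<open>
  By compactness there are a finite window and a scale \<open>q\<close> at which \<open>f\<close> varies by at most \<open>\<eta>\<close>; beyond
  that scale boundedness of \<open>f\<close> gives a Lipschitz bound. So the envelope applies with constant error.
\<close>

lemma continuous_approx_window_lipschitz:
  assumes d: "Metric_space (space X) d" and comp: "compact_space (Metric_space.mtopology (space X) d)"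
    and f: "continuous_map (product_topology (\<lambda>_. Metric_space.mtopology (space X) d) I) euclideanreal f"
    and \<eta>: "0 < \<eta>"
  obtains F where "window_lipschitz I X d F" "\<And>x. x \<in> space (config I X) \<Longrightarrow> \<bar>f x - F x\<bar> \<le> \<eta>"
proof -
  interpret Metric_space "space X" d by fact
  let ?S = "space (config I X)" and ?T = "product_topology (\<lambda>_. mtopology) I"
  have top: "topspace ?T = ?S" by (simp add: space_PiM)
  have "\<exists>W r. finite W \<and> W \<subseteq> I \<and> 0 < r \<and> (\<forall>y\<in>?S. (\<forall>i\<in>W. d (x i) (y i) < 2 * r) \<longrightarrow> \<bar>f y - f x\<bar> < \<eta> / 2)"
    if x: "x \<in> ?S" for x
  proof -
    have "openin ?T {y \<in> topspace ?T. f y \<in> ball (f x) (\<eta> / 2)}"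
      using f by (intro openin_continuous_map_preimage[OF f]) auto
    moreover have "x \<in> {y \<in> topspace ?T. f y \<in> ball (f x) (\<eta> / 2)}" using x top \<eta> by auto
    ultimately obtain U where U: "finite {i \<in> I. U i \<noteq> topspace mtopology}" "\<forall>i\<in>I. openin mtopology (U i)"
      "x \<in> PiE I U" "PiE I U \<subseteq> {y \<in> topspace ?T. f y \<in> ball (f x) (\<eta> / 2)}"
      unfolding openin_product_topology_alt by blast
    let ?W = "{i \<in> I. U i \<noteq> space X}"
    have W: "finite ?W" using U(1) by simp
    have "\<exists>s>0. mball (x i) s \<subseteq> U i" if "i \<in> I" for i
      using U(2,3) that openin_mtopology by (metis PiE_mem)
    then obtain s where s: "\<And>i. i \<in> I \<Longrightarrow> 0 < s i \<and> mball (x i) (s i) \<subseteq> U i" by metis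
    \<comment> \<open>halved because the cover below uses radius \<open>r x\<close> and the oscillation bound twice that radius\<close>
    define r where "r = Min (insert 1 (s ` ?W)) / 2"
    have r: "0 < r" unfolding r_def using W s by (simp add: Min_gr_iff)
    have "\<bar>f y - f x\<bar> < \<eta> / 2" if y: "y \<in> ?S" "\<forall>i\<in>?W. d (x i) (y i) < 2 * r" for y
    proof -
      have "y i \<in> U i" if i: "i \<in> I" for i
      proof (cases "i \<in> ?W")
        case True
        have "2 * r \<le> s i" unfolding r_def using True W by simp
        then have "d (x i) (y i) < s i" using y(2) True by fastforce
        then have "y i \<in> mball (x i) (s i)" using config_component[OF x i] config_component[OF y(1) i] by simp
        then show ?thesis using s[OF i] by blast
      next
        case False then show ?thesis using i config_component[OF y(1) i] by auto
      qed
      then have "y \<in> PiE I U" using y(1) by (auto simp: space_PiM PiE_iff)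
      then have "f y \<in> ball (f x) (\<eta> / 2)" using U(4) by auto
      then show ?thesis by (simp add: dist_real_def abs_minus_commute)
    qed
    then show ?thesis using W r by (intro exI[of _ ?W] exI[of _ r]) auto
  qed
  then obtain W r where Wr: "\<And>x. x \<in> ?S \<Longrightarrow> finite (W x) \<and> W x \<subseteq> I \<and> 0 < r x"
    and osc: "\<And>x y. x \<in> ?S \<Longrightarrow> y \<in> ?S \<Longrightarrow> (\<forall>i\<in>W x. d (x i) (y i) < 2 * r x) \<Longrightarrow> \<bar>f y - f x\<bar> < \<eta> / 2"
    by metis
  define N where "N x = PiE I (\<lambda>i. if i \<in> W x then mball (x i) (r x) else space X)" for x
  have opN: "openin ?T (N x)" if x: "x \<in> ?S" for x
    unfolding N_def
  proof (rule product_topology_basis)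
    show "openin mtopology (if i \<in> W x then mball (x i) (r x) else space X)" for i
      by auto
    show "finite {i. (if i \<in> W x then mball (x i) (r x) else space X) \<noteq> topspace mtopology}"
      by (rule finite_subset[of _ "W x"]) (use Wr[OF x] in auto)
  qed
  have mem: "x \<in> N x" if "x \<in> ?S" for x
    using that Wr[OF that] by (auto simp: N_def space_PiM PiE_iff)
  have "compact_space ?T" using comp by (simp add: compact_space_product_topology)
  then have "compactin ?T ?S" using top unfolding compact_space_def by simp
  moreover have "\<forall>U\<in>N ` ?S. openin ?T U" using opN by blast
  moreover have "?S \<subseteq> \<Union>(N ` ?S)" using mem by blast
  ultimately obtain \<F> where \<F>: "finite \<F>" "\<F> \<subseteq> N ` ?S" "?S \<subseteq> \<Union>\<F>"
    unfolding compactin_def by blast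
  obtain T where "T \<subseteq> ?S" "finite T" "\<F> = N ` T" using finite_subset_image[OF \<F>(1,2)] by blast
  then have T: "finite T" "T \<subseteq> ?S" "?S \<subseteq> (\<Union>x\<in>T. N x)" using \<F>(3) by auto
  define V where "V = (\<Union>x\<in>T. W x)"
  have V: "finite V" "V \<subseteq> I" using T Wr by (auto simp: V_def)
  \<comment> \<open>the 1 covers the case of an empty \<open>T\<close>\<close>
  define q where "q = Min (insert 1 (r ` T))"
  have q: "0 < q" unfolding q_def using T Wr by (auto simp: Min_gr_iff)
  have near: "\<exists>z\<in>T. \<bar>f x - f z\<bar> < \<eta> / 2 \<and> (\<forall>y\<in>?S. window_dist V d x y < q \<longrightarrow> \<bar>f y - f z\<bar> < \<eta> / 2)"
    if x: "x \<in> ?S" for x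
  proof -
    obtain z where z: "z \<in> T" "x \<in> N z" using T x by blast
    have zS: "z \<in> ?S" using z T by auto
    have dz: "d (z i) (x i) < r z" if "i \<in> W z" for i
      using z(2) that Wr[OF zS] by (auto simp: N_def PiE_iff split: if_splits)
    have "\<bar>f x - f z\<bar> < \<eta> / 2"
      using dz Wr[OF zS] by (intro osc[OF zS x]) force
    moreover have "\<bar>f y - f z\<bar> < \<eta> / 2" if y: "y \<in> ?S" "window_dist V d x y < q" for y
    proof (rule osc[OF zS y(1)], rule ballI)
      fix i assume i: "i \<in> W z"
      then have iV: "i \<in> V" "i \<in> I" using z(1) V by (auto simp: V_def)
      have "d (x i) (y i) \<le> window_dist V d x y"
        unfolding window_dist_def using iV V by (intro member_le_sum) auto
      moreover have "q \<le> r z" unfolding q_def using T z by simp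
      ultimately have "d (x i) (y i) < r z" using y by linarith
      then show "d (z i) (y i) < 2 * r z"
        using dz[OF i] triangle[of "z i" "x i" "y i"] config_component[OF _ iV(2)] zS x y(1) by fastforce
    qed
    ultimately show ?thesis using z by blast
  qed
  define B where "B = (\<Sum>z\<in>T. \<bar>f z\<bar>) + \<eta>"
  have B: "\<bar>f x\<bar> \<le> B" if x: "x \<in> ?S" for x
  proof -
    obtain z where z: "z \<in> T" "\<bar>f x - f z\<bar> < \<eta> / 2" using near[OF x] by blast
    have "\<bar>f z\<bar> \<le> (\<Sum>z\<in>T. \<bar>f z\<bar>)" using z T by (intro member_le_sum) auto
    then show ?thesis using z \<eta> unfolding B_def by linarith
  qed
  have B0: "0 \<le> B" unfolding B_def using \<eta> by (simp add: sum_nonneg)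
  have "\<bar>f x - f y\<bar> \<le> \<eta> + 2 * B / q * window_dist V d x y" if xy: "x \<in> ?S" "y \<in> ?S" for x y
  proof (cases "window_dist V d x y < q")
    case True
    obtain z where "\<bar>f x - f z\<bar> < \<eta> / 2" "\<bar>f y - f z\<bar> < \<eta> / 2" using near[OF xy(1)] True xy by blast
    then have "\<bar>f x - f y\<bar> \<le> \<eta>" by linarith
    moreover have "0 \<le> 2 * B / q * window_dist V d x y"
      using B0 q by (intro mult_nonneg_nonneg divide_nonneg_pos window_dist_nonneg[OF d]) auto
    ultimately show ?thesis by linarith
  next
    case False
    have "\<bar>f x - f y\<bar> \<le> 2 * B" using B[OF xy(1)] B[OF xy(2)] by linarith
    also have "\<dots> = 2 * B / q * q" using q by simp
    also have "\<dots> \<le> 2 * B / q * window_dist V d x y" using False B0 q by (intro mult_left_mono) auto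
    finally show ?thesis using \<eta> by linarith
  qed
  moreover have "0 \<le> 2 * B / q" using B0 q by simp
  ultimately obtain F where "window_lipschitz I X d F" "\<And>x. x \<in> ?S \<Longrightarrow> \<bar>f x - F x\<bar> \<le> \<eta>"
    using lipschitz_envelope[OF d V, of "2 * B / q" f "\<lambda>_. \<eta>"] by (metis abs_le_D1)
  then show ?thesis using that by blast
qed

text \<open>
  For a given window and Lipschitz constant, a function is determined up to a small error by its
  rounded values on a finite net, and there are only countably many such tables of values. One
  function is chosen for each table that occurs.
\<close>

lemma countable_dense_window_lipschitz:
  assumes X: "measurably_precompact X d" and I: "countable I"
  obtains \<F> :: "nat \<Rightarrow> ('i \<Rightarrow> 'x) \<Rightarrow> real"
  where "\<And>n. window_lipschitz I X d (\<F> n)"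
    "\<And>F r. window_lipschitz I X d F \<Longrightarrow> 0 < r \<Longrightarrow> \<exists>n. \<forall>x\<in>space (config I X). \<bar>F x - \<F> n x\<bar> \<le> r"
proof -
  interpret Metric_space "space X" d using X by (simp add: measurably_precompact_def)
  let ?S = "space (config I X)"
  obtain a where a: "a \<in> space X" using X by (auto simp: measurably_precompact_def)
  have "\<exists>A p. finite A \<and> A \<subseteq> space X \<and> (\<forall>x\<in>space X. p x \<in> A \<and> d x (p x) < 1 / Suc n)" for n
    by (rule measurably_precompactE[OF X, of "1 / Suc n"]) (simp, blast)
  then obtain A p where A: "\<And>n. finite (A n)" "\<And>n. A n \<subseteq> space X"
    and p: "\<And>n x. x \<in> space X \<Longrightarrow> p n x \<in> A n \<and> d x (p n x) < 1 / Suc n"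
    by metis
  define E where "E W w = (\<lambda>i\<in>I. if i \<in> W then w i else a)" for W w
  define K where "K m W = {F. \<forall>x\<in>?S. \<forall>y\<in>?S. \<bar>F x - F y\<bar> \<le> real m * window_dist W d x y}" for m W
  \<comment> \<open>the code of \<open>F\<close> lists its values, rounded to multiples of \<open>1/(n+1)\<close>, on a finite net\<close>
  define code where "code n W F = (\<lambda>w\<in>PiE W (\<lambda>_. A n). \<lfloor>real (Suc n) * F (E W w)\<rfloor>)" for n W and F :: "('i \<Rightarrow> 'x) \<Rightarrow> real"
  define D where "D = (\<Union>m. \<Union>W\<in>{W. finite W \<and> W \<subseteq> I}. \<Union>n. inv_into (K m W) (code n W) ` (code n W ` K m W))"
  have "countable (code n W ` K m W)" if "finite W" for n W m
  proof (rule countable_subset)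
    show "code n W ` K m W \<subseteq> PiE (PiE W (\<lambda>_. A n)) (\<lambda>_. UNIV)"
      unfolding code_def by (rule image_subsetI) (simp only: restrict_PiE_iff UNIV_I ball_simps, simp)
    show "countable (PiE (PiE W (\<lambda>_. A n)) (\<lambda>_. UNIV :: int set))"
      using that A by (intro countable_PiE finite_PiE) auto
  qed
  then have "countable (inv_into (K m W) (code n W) ` code n W ` K m W)" if "finite W" for n W m
    using that by blast
  then have "countable D"
    unfolding D_def by (intro countable_UN countable_Collect_finite_subset[OF I]) auto
  have in_D: "inv_into (K m W) (code n W) (code n W F) \<in> D" if "F \<in> K m W" "finite W" "W \<subseteq> I" for m n W F
    using that unfolding D_def by blast
  have "(\<lambda>_. 0) \<in> K 0 {}" by (simp add: K_def)
  then have "D \<noteq> {}" using in_D[of "\<lambda>_. 0" 0 "{}" 0] by auto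
  have lip: "window_lipschitz I X d F" if "F \<in> D" for F
  proof -
    obtain m W n c where "finite W" "W \<subseteq> I" "F = inv_into (K m W) (code n W) c" "c \<in> code n W ` K m W"
      using \<open>F \<in> D\<close> unfolding D_def by blast
    then have "F \<in> K m W" "finite W" "W \<subseteq> I" by (auto intro: inv_into_into)
    then show ?thesis unfolding K_def by (intro window_lipschitzI[of W I "real m"]) auto
  qed
  have approx: "\<exists>F'\<in>D. \<forall>x\<in>?S. \<bar>F x - F' x\<bar> \<le> r" if F: "window_lipschitz I X d F" and r: "0 < r" for F r
  proof -
    obtain W L where W: "finite W" "W \<subseteq> I" "0 \<le> L"
      and FW: "\<And>x y. x \<in> ?S \<Longrightarrow> y \<in> ?S \<Longrightarrow> \<bar>F x - F y\<bar> \<le> L * window_dist W d x y"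
      using window_lipschitzE[OF F] by metis
    obtain m :: nat where m: "L \<le> real m" using real_arch_simple by blast
    have FK: "F \<in> K m W"
      unfolding K_def using FW m window_dist_nonneg[of "space X" d W]
      by (auto intro!: order_trans[OF FW] mult_right_mono Metric_space_axioms)
    obtain n :: nat where n: "(2 * real m * card W + 1) / r \<le> real n" using real_arch_simple by blast
    define F' where "F' = inv_into (K m W) (code n W) (code n W F)"
    have F'K: "F' \<in> K m W" unfolding F'_def using FK by (intro inv_into_into) auto
    have code: "code n W F' = code n W F" unfolding F'_def by (rule f_inv_into_f[OF imageI[OF FK]])
    have "\<bar>F x - F' x\<bar> \<le> r" if x: "x \<in> ?S" for x
    proof -
      let ?w = "\<lambda>i\<in>W. p n (x i)"
      have w: "?w \<in> PiE W (\<lambda>_. A n)" using p config_component[OF x] W by auto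
      have ES: "E W ?w \<in> ?S"
        using p config_component[OF x] W a A(2)[of n] by (auto simp: E_def space_PiM PiE_iff subset_iff)
      have "window_dist W d x (E W ?w) \<le> (\<Sum>i\<in>W. 1 / Suc n)"
        unfolding window_dist_def
      proof (rule sum_mono)
        fix i assume "i \<in> W"
        then show "d (x i) (E W ?w i) \<le> 1 / Suc n"
          using p[of "x i" n] config_component[OF x, of i] W by (auto simp: E_def)
      qed
      then have wd: "real m * window_dist W d x (E W ?w) \<le> real m * (card W / Suc n)"
        by (intro mult_left_mono) auto
      have near: "\<bar>H x - H (E W ?w)\<bar> \<le> real m * (card W / Suc n)" if "H \<in> K m W" for H
        using that x ES unfolding K_def by (intro order_trans[OF _ wd]) blast
      note 1 = near[OF FK] and 2 = near[OF F'K]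
      have "\<lfloor>real (Suc n) * F (E W ?w)\<rfloor> = \<lfloor>real (Suc n) * F' (E W ?w)\<rfloor>"
        using fun_cong[OF code, of ?w] w by (simp add: code_def)
      then have "\<bar>real (Suc n) * F (E W ?w) - real (Suc n) * F' (E W ?w)\<bar> \<le> 1"
        by linarith
      then have "real (Suc n) * \<bar>F (E W ?w) - F' (E W ?w)\<bar> \<le> 1"
        by (simp add: abs_mult right_diff_distrib[symmetric])
      then have 3: "\<bar>F (E W ?w) - F' (E W ?w)\<bar> \<le> 1 / Suc n" by (simp add: field_simps)
      have "\<bar>F x - F' x\<bar> \<le> (2 * real m * card W + 1) / Suc n"
        using 1 2 3 by (simp add: add_divide_distrib) 
      also have "\<dots> \<le> r" using n r by (simp add: field_simps)
      finally show ?thesis .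
    qed
    then show ?thesis using in_D[OF FK W(1,2), of n] unfolding F'_def by blast
  qed
  show ?thesis
  proof (rule that[of "from_nat_into D"])
    show "window_lipschitz I X d (from_nat_into D n)" for n using lip from_nat_into[OF \<open>D \<noteq> {}\<close>] by blast
    show "\<exists>n. \<forall>x\<in>?S. \<bar>F x - from_nat_into D n x\<bar> \<le> r" if "window_lipschitz I X d F" "0 < r" for F r
      using approx[OF that] from_nat_into_surj[OF \<open>countable D\<close>] by metis
  qed
qed

section \<open>Deviation of a random labelling from a target value\<close>

definition average :: "'v set \<Rightarrow> 'c measure \<Rightarrow> ('v \<Rightarrow> 'c \<Rightarrow> real) \<Rightarrow> real" where
  "average V M H = (\<Sum>v\<in>V. \<integral>x. H v x \<partial>M) / real (card V)"

text \<open>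
  With \<open>H v x\<close> the value of a test function at the configuration seen from site \<open>v\<close> of the labelling
  \<open>x\<close>, the first term is small if the law of this configuration gives the right mean at most sites
  \<open>v\<close>, and the second if the empirical distribution does so for most \<open>x\<close>.
\<close>

definition deviation :: "'v set \<Rightarrow> 'c measure \<Rightarrow> ('v \<Rightarrow> 'c \<Rightarrow> real) \<Rightarrow> real \<Rightarrow> real" where
  "deviation V M H c = (\<Sum>v\<in>V. \<bar>(\<integral>x. H v x \<partial>M) - c\<bar>) / real (card V) +
     (\<integral>x. \<bar>(\<Sum>v\<in>V. H v x) / real (card V) - c\<bar> \<partial>M)"

lemma deviation_nonneg: "0 \<le> deviation V M H c"
  by (simp add: deviation_def sum_nonneg)

text \<open>
  The deviation also controls the average over sites and labellings together, which is all that
  the covering estimate needs.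
\<close>

lemma average_deviation:
  assumes V: "finite V" "V \<noteq> {}"
  shows "\<bar>average V M H - c\<bar> \<le> deviation V M H c"
proof -
  have n: "real (card V) > 0" using V by (simp add: card_gt_0_iff)
  have "average V M H - c = (\<Sum>v\<in>V. (\<integral>x. H v x \<partial>M) - c) / real (card V)"
    using n by (simp add: average_def sum_subtractf field_simps)
  also have "\<bar>\<dots>\<bar> \<le> (\<Sum>v\<in>V. \<bar>(\<integral>x. H v x \<partial>M) - c\<bar>) / real (card V)"
    using n by (simp add: divide_right_mono)
  also have "\<dots> \<le> deviation V M H c" by (simp add: deviation_def)
  finally show ?thesis .
qed

lemma average_eq_integral:
  assumes "\<And>v. v \<in> V \<Longrightarrow> integrable M (H v)"
  shows "average V M H = (\<integral>x. (\<Sum>v\<in>V. H v x) / real (card V) \<partial>M)"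
  using assms by (simp add: average_def)

text \<open>
  In both terms of the deviation an absolute value stands between two averaging operations, so
  each term changes by at most the joint average of \<open>K\<close> and the difference of the constants.
\<close>

lemma deviation_le:
  assumes M: "prob_space M" and V: "finite V" "V \<noteq> {}"
    and H: "\<And>v. v \<in> V \<Longrightarrow> integrable M (H v)" and H': "\<And>v. v \<in> V \<Longrightarrow> integrable M (H' v)"
    and K: "\<And>v. v \<in> V \<Longrightarrow> integrable M (K v)"
    and le: "\<And>v x. v \<in> V \<Longrightarrow> x \<in> space M \<Longrightarrow> \<bar>H v x - H' v x\<bar> \<le> K v x"
  shows "deviation V M H c \<le> deviation V M H' c' + 2 * average V M K + 2 * \<bar>c - c'\<bar>"
proof -
  interpret prob_space M by fact
  have n: "real (card V) > 0" using V by (simp add: card_gt_0_iff)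
  have "(\<Sum>v\<in>V. \<bar>(\<integral>x. H v x \<partial>M) - c\<bar>) \<le> (\<Sum>v\<in>V. \<bar>(\<integral>x. H' v x \<partial>M) - c'\<bar> + (\<integral>x. K v x \<partial>M) + \<bar>c - c'\<bar>)"
  proof (rule sum_mono)
    fix v assume v: "v \<in> V"
    have "\<bar>(\<integral>x. H v x \<partial>M) - (\<integral>x. H' v x \<partial>M)\<bar> = \<bar>\<integral>x. H v x - H' v x \<partial>M\<bar>"
      using H H' v by simp
    also have "\<dots> \<le> (\<integral>x. \<bar>H v x - H' v x\<bar> \<partial>M)" by (rule integral_abs_bound)
    also have "\<dots> \<le> (\<integral>x. K v x \<partial>M)" using H H' K v le by (intro integral_mono) auto
    finally show "\<bar>(\<integral>x. H v x \<partial>M) - c\<bar> \<le> \<bar>(\<integral>x. H' v x \<partial>M) - c'\<bar> + (\<integral>x. K v x \<partial>M) + \<bar>c - c'\<bar>"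
      by linarith
  qed
  also have "\<dots> = (\<Sum>v\<in>V. \<bar>(\<integral>x. H' v x \<partial>M) - c'\<bar>) + real (card V) * average V M K + real (card V) * \<bar>c - c'\<bar>"
    using n by (simp add: sum.distrib average_def)
  finally have 1: "(\<Sum>v\<in>V. \<bar>(\<integral>x. H v x \<partial>M) - c\<bar>) / real (card V) \<le>
      (\<Sum>v\<in>V. \<bar>(\<integral>x. H' v x \<partial>M) - c'\<bar>) / real (card V) + average V M K + \<bar>c - c'\<bar>"
    using n by (simp add: field_simps)
  have "(\<integral>x. \<bar>(\<Sum>v\<in>V. H v x) / real (card V) - c\<bar> \<partial>M) \<le>
     (\<integral>x. \<bar>(\<Sum>v\<in>V. H' v x) / real (card V) - c'\<bar> + (\<Sum>v\<in>V. K v x) / real (card V) + \<bar>c - c'\<bar> \<partial>M)"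
  proof (rule integral_mono)
    fix x assume x: "x \<in> space M"
    have "\<bar>(\<Sum>v\<in>V. H v x) - (\<Sum>v\<in>V. H' v x)\<bar> \<le> (\<Sum>v\<in>V. K v x)"
      unfolding sum_subtractf[symmetric] using le x by (intro order_trans[OF sum_abs] sum_mono) auto
    then have "\<bar>(\<Sum>v\<in>V. H v x) / real (card V) - (\<Sum>v\<in>V. H' v x) / real (card V)\<bar> \<le> (\<Sum>v\<in>V. K v x) / real (card V)"
      unfolding diff_divide_distrib[symmetric] abs_divide using n by (simp add: divide_right_mono)
    then show "\<bar>(\<Sum>v\<in>V. H v x) / real (card V) - c\<bar> \<le>
      \<bar>(\<Sum>v\<in>V. H' v x) / real (card V) - c'\<bar> + (\<Sum>v\<in>V. K v x) / real (card V) + \<bar>c - c'\<bar>" by linarith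
  qed (use H H' K in auto)
  also have "\<dots> = (\<integral>x. \<bar>(\<Sum>v\<in>V. H' v x) / real (card V) - c'\<bar> \<partial>M) + average V M K + \<bar>c - c'\<bar>"
    using H' K by (simp add: average_def prob_space)
  finally have 2: "(\<integral>x. \<bar>(\<Sum>v\<in>V. H v x) / real (card V) - c\<bar> \<partial>M) \<le>
     (\<integral>x. \<bar>(\<Sum>v\<in>V. H' v x) / real (card V) - c'\<bar> \<partial>M) + average V M K + \<bar>c - c'\<bar>" .
  have "a + b \<le> a' + b' + 2 * k + 2 * e" if "a \<le> a' + k + e" "b \<le> b' + k + e" for a b a' b' k e :: real
    using that by linarith
  from this[OF 1 2] show ?thesis unfolding deviation_def .
qed

lemma integrable_bounded:
  fixes f :: "'c \<Rightarrow> real"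
  assumes "prob_space M" "f \<in> borel_measurable M" "\<And>x. x \<in> space M \<Longrightarrow> \<bar>f x\<bar> \<le> C"
  shows "integrable M f"
proof -
  interpret prob_space M by fact
  show ?thesis using assms by (intro integrable_const_bound[of f C]) auto
qed

lemma ProbD: "N \<in> Prob B \<Longrightarrow> prob_space N" "N \<in> Prob B \<Longrightarrow> sets N = sets B"
    "N \<in> Prob B \<Longrightarrow> space N = space B"
  by (auto simp: Prob_def dest: sets_eq_imp_space_eq)

lemma Prob_measurable: "N \<in> Prob B \<Longrightarrow> measurable N C = measurable B C"
  by (rule measurable_cong_sets) (auto simp: Prob_def)

lemma window_lipschitz_integrable:
  assumes X: "measurably_precompact X d" and F: "window_lipschitz I X d F" and M: "M \<in> Prob (config I X)"
  shows "integrable M F"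
proof -
  obtain C where C: "\<And>x. x \<in> space (config I X) \<Longrightarrow> \<bar>F x\<bar> \<le> C"
    using window_lipschitz_bounded[OF X F] by metis
  show ?thesis
    using C window_lipschitz_measurable[OF X F] ProbD[OF M] Prob_measurable[OF M]
    by (intro integrable_bounded[of _ _ C]) auto
qed

section \<open>Pulling labellings back to the group\<close>

lemma pullback_measurable:
  assumes "\<forall>g\<in>carrier G. s g permutes V" "v \<in> V"
  shows "pullback_name G s v \<in> measurable (config V X) (config (carrier G) X)"
  unfolding pullback_name_def using assms
  by (intro measurable_restrict measurable_component_singleton) (simp add: permutes_in_image)

lemma pullback_space:
  assumes "\<forall>g\<in>carrier G. s g permutes V" "v \<in> V" "x \<in> space (config V X)"
  shows "pullback_name G s v x \<in> space (config (carrier G) X)"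
  using assms by (auto simp: pullback_name_def space_PiM PiE_iff permutes_in_image)

text \<open>
  For fixed \<open>g\<close> the map \<open>s g\<close> permutes the sites, so every \<open>g\<close> in the window contributes the full
  distance between the labellings once.
\<close>

lemma sum_window_dist_pullback:
  assumes s: "\<forall>g\<in>carrier G. s g permutes V" and W: "W \<subseteq> carrier G"
  shows "(\<Sum>v\<in>V. window_dist W d (pullback_name G s v x) (pullback_name G s v y)) = real (card W) * window_dist V d x y"
proof -
  have "(\<Sum>v\<in>V. window_dist W d (pullback_name G s v x) (pullback_name G s v y)) =
      (\<Sum>g\<in>W. \<Sum>v\<in>V. d (x (s g v)) (y (s g v)))"
    unfolding window_dist_def pullback_name_def
    by (subst sum.swap) (use W in \<open>auto intro!: sum.cong\<close>)
  also have "\<dots> = (\<Sum>g\<in>W. window_dist V d x y)"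
    unfolding window_dist_def
  proof (rule sum.cong)
    fix g assume "g \<in> W"
    then have "s g permutes V" using s W by auto
    then have "bij_betw (s g) V V" by (rule permutes_imp_bij)
    then show "(\<Sum>v\<in>V. d (x (s g v)) (y (s g v))) = (\<Sum>v\<in>V. d (x v) (y v))"
      by (rule sum.reindex_bij_betw[of "s g" V V "\<lambda>v. d (x v) (y v)"])
  qed auto
  finally show ?thesis by simp
qed

section \<open>Quenched convergence in terms of test functions\<close>

text \<open>
  Quenched convergence in terms of deviations of test functions.
\<close>

definition observables_converge ::
  "('g, 'm) monoid_scheme \<Rightarrow> 'x measure \<Rightarrow> ('x \<Rightarrow> 'x \<Rightarrow> real) \<Rightarrow> ('g \<Rightarrow> 'x) measure \<Rightarrow>
    (nat \<Rightarrow> 'v set) \<Rightarrow> (nat \<Rightarrow> 'g \<Rightarrow> 'v \<Rightarrow> 'v) \<Rightarrow> (nat \<Rightarrow> ('v \<Rightarrow> 'x) measure) \<Rightarrow> bool" where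
  "observables_converge G X d \<mu> V \<sigma> \<mu>s \<longleftrightarrow> (\<forall>F. window_lipschitz (carrier G) X d F \<longrightarrow>
     (\<lambda>i. deviation (V i) (\<mu>s i) (\<lambda>v x. F (pullback_name G (\<sigma> i) v x)) (\<integral>z. F z \<partial>\<mu>)) \<longlonglongrightarrow> 0)"

lemma continuous_measurable:
  assumes X: "measurably_precompact X d" and comp: "compact_space (Metric_space.mtopology (space X) d)"
    and f: "continuous_map (product_topology (\<lambda>_. Metric_space.mtopology (space X) d) I) euclideanreal f"
  shows "f \<in> borel_measurable (config I X)"
proof -
  have d: "Metric_space (space X) d" using X by (simp add: measurably_precompact_def)
  have "\<exists>F. window_lipschitz I X d F \<and> (\<forall>x\<in>space (config I X). \<bar>f x - F x\<bar> \<le> 1 / Suc n)" for n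
    by (rule continuous_approx_window_lipschitz[OF d comp f, of "1 / Suc n"]) auto
  then obtain F where F: "\<And>n. window_lipschitz I X d (F n)"
    "\<And>n x. x \<in> space (config I X) \<Longrightarrow> \<bar>f x - F n x\<bar> \<le> 1 / Suc n" by metis
  show ?thesis
  proof (rule borel_measurable_LIMSEQ_metric)
    show "F n \<in> borel_measurable (config I X)" for n by (rule window_lipschitz_measurable[OF X F(1)])
    fix x assume x: "x \<in> space (config I X)"
    have "(\<lambda>n. f x - F n x) \<longlonglongrightarrow> 0"
      by (rule Lim_null_comparison[OF _ LIMSEQ_inverse_real_of_nat]) (use F(2)[OF x] in \<open>auto simp: inverse_eq_divide\<close>)
    from tendsto_diff[OF tendsto_const[of "f x"] this] show "(\<lambda>n. F n x) \<longlonglongrightarrow> f x" by simp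
  qed
qed

text \<open>
  Finite intersections and unions of open sets keep the property, and a subbasic set given by a
  continuous function contains one given by a uniformly close test function.
\<close>

lemma weak_star_neighbourhood:
  assumes X: "measurably_precompact X d" and comp: "compact_space (Metric_space.mtopology (space X) d)"
    and U: "openin (weak_star_topology (product_topology (\<lambda>_. Metric_space.mtopology (space X) d) I) (config I X)) U"
    and N: "N \<in> U"
  shows "N \<in> Prob (config I X) \<and> (\<exists>\<F> r. finite \<F> \<and> (\<forall>F\<in>\<F>. window_lipschitz I X d F) \<and> 0 < r \<and>
     (\<forall>N'\<in>Prob (config I X). (\<forall>F\<in>\<F>. \<bar>(\<integral>x. F x \<partial>N') - (\<integral>x. F x \<partial>N)\<bar> < r) \<longrightarrow> N' \<in> U))"
proof -
  have d: "Metric_space (space X) d" using X by (simp add: measurably_precompact_def)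
  let ?T = "product_topology (\<lambda>_. Metric_space.mtopology (space X) d) I" and ?B = "config I X"
  let ?S = "{{N \<in> Prob ?B. (\<integral>x. f x \<partial>N) \<in> U} | f U. continuous_map ?T euclideanreal f \<and> open U}"
  have "generate_topology_on ?S U"
    using openin_topology_generated_by[OF U[unfolded weak_star_topology_def]] .
  then show ?thesis using N
  proof (induction arbitrary: N rule: generate_topology_on.induct)
    case Empty then show ?case by simp
  next
    case (Int U U')
    obtain \<F> r where 1: "finite \<F>" "\<forall>F\<in>\<F>. window_lipschitz I X d F" "0 < r"
      "\<forall>N'\<in>Prob ?B. (\<forall>F\<in>\<F>. \<bar>(\<integral>x. F x \<partial>N') - (\<integral>x. F x \<partial>N)\<bar> < r) \<longrightarrow> N' \<in> U"
      using Int.IH(1)[of N] Int.prems by blast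
    obtain \<F>' r' where 2: "finite \<F>'" "\<forall>F\<in>\<F>'. window_lipschitz I X d F" "0 < r'"
      "\<forall>N'\<in>Prob ?B. (\<forall>F\<in>\<F>'. \<bar>(\<integral>x. F x \<partial>N') - (\<integral>x. F x \<partial>N)\<bar> < r') \<longrightarrow> N' \<in> U'"
      using Int.IH(2)[of N] Int.prems by blast
    have "\<forall>N'\<in>Prob ?B. (\<forall>F\<in>\<F> \<union> \<F>'. \<bar>(\<integral>x. F x \<partial>N') - (\<integral>x. F x \<partial>N)\<bar> < min r r') \<longrightarrow> N' \<in> U \<inter> U'"
      using 1(4) 2(4) by auto
    moreover have "finite (\<F> \<union> \<F>')" "\<forall>F\<in>\<F> \<union> \<F>'. window_lipschitz I X d F" "0 < min r r'"
      using 1 2 by auto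
    moreover have "N \<in> Prob ?B" using Int.IH(1)[of N] Int.prems by blast
    ultimately show ?case by blast
  next
    case (UN K)
    then obtain U where U: "U \<in> K" "N \<in> U" by blast
    show ?case using UN.IH[OF U] U by blast
  next
    case (Basis U)
    then obtain f O' where f: "continuous_map ?T euclideanreal f" and O': "open O'"
      and Ueq: "U = {N \<in> Prob ?B. (\<integral>x. f x \<partial>N) \<in> O'}" by blast
    have N: "N \<in> Prob ?B" "(\<integral>x. f x \<partial>N) \<in> O'" using Basis.prems Ueq by auto
    obtain r where r: "r > 0" "ball (\<integral>x. f x \<partial>N) r \<subseteq> O'" using O' N(2) open_contains_ball by blast
    obtain F where F: "window_lipschitz I X d F" and fF: "\<And>x. x \<in> space ?B \<Longrightarrow> \<bar>f x - F x\<bar> \<le> r / 3"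
      using continuous_approx_window_lipschitz[OF d comp f, of "r / 3"] r by auto
    obtain C where C: "\<And>x. x \<in> space ?B \<Longrightarrow> \<bar>F x\<bar> \<le> C"
      using window_lipschitz_bounded[OF X F] by metis
    have close: "\<bar>(\<integral>x. f x \<partial>M) - (\<integral>x. F x \<partial>M)\<bar> \<le> r / 3" if M: "M \<in> Prob ?B" for M
    proof -
      interpret prob_space M using M by (rule ProbD)
      have sp: "space M = space ?B" by (rule ProbD(3)[OF M])
      have "\<bar>f x\<bar> \<le> C + r / 3" if "x \<in> space M" for x
        using C[OF that[unfolded sp]] fF[OF that[unfolded sp]] by linarith
      then have fi: "integrable M f"
        using continuous_measurable[OF X comp f] Prob_measurable[OF M]
        by (intro integrable_bounded[of _ _ "C + r / 3"] prob_space_axioms) auto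
      have Fi: "integrable M F" by (rule window_lipschitz_integrable[OF X F M])
      have "\<bar>(\<integral>x. f x \<partial>M) - (\<integral>x. F x \<partial>M)\<bar> = \<bar>\<integral>x. f x - F x \<partial>M\<bar>" using fi Fi by simp
      also have "\<dots> \<le> (\<integral>x. \<bar>f x - F x\<bar> \<partial>M)" by (rule integral_abs_bound)
      also have "\<dots> \<le> (\<integral>x. r / 3 \<partial>M)" using fi Fi fF sp by (intro integral_mono) auto
      finally show ?thesis by (simp add: prob_space)
    qed
    have "N' \<in> U" if N': "N' \<in> Prob ?B" and lt: "\<forall>F\<in>{F}. \<bar>(\<integral>x. F x \<partial>N') - (\<integral>x. F x \<partial>N)\<bar> < r / 3" for N'
    proof -
      have "\<bar>(\<integral>x. F x \<partial>N') - (\<integral>x. F x \<partial>N)\<bar> < r / 3" using lt by simp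
      moreover have "\<bar>a - b\<bar> < r" if "\<bar>a - a'\<bar> \<le> r / 3" "\<bar>b - b'\<bar> \<le> r / 3" "\<bar>a' - b'\<bar> < r / 3" for a b a' b' :: real
        using that by arith
      ultimately have "\<bar>(\<integral>x. f x \<partial>N') - (\<integral>x. f x \<partial>N)\<bar> < r" using close[OF N'] close[OF N(1)] by blast
      then have "(\<integral>x. f x \<partial>N') \<in> ball (\<integral>x. f x \<partial>N) r" by (simp add: dist_real_def abs_minus_commute)
      then show ?thesis using r N' Ueq by auto
    qed
    moreover have "finite {F}" "\<forall>F\<in>{F}. window_lipschitz I X d F" "0 < r / 3" using F r by auto
    ultimately show ?case using N(1) by blast
  qed
qed

lemma weak_star_subbasic:
  assumes "continuous_map T euclideanreal f" "open O'"
  shows "openin (weak_star_topology T B) {N \<in> Prob B. (\<integral>x. f x \<partial>N) \<in> O'}"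
  unfolding weak_star_topology_def using assms by (intro topology_generated_by_Basis) blast


lemma empirical_in_Prob:
  assumes V: "finite V" "V \<noteq> {}" and s: "\<forall>g\<in>carrier G. s g permutes V" and x: "x \<in> space (config V X)"
  shows "empirical_distribution G X V s x \<in> Prob (config (carrier G) X)"
    and "F \<in> borel_measurable (config (carrier G) X) \<Longrightarrow>
      (\<integral>z. F z \<partial>empirical_distribution G X V s x) = (\<Sum>v\<in>V. (F (pullback_name G s v x) :: real)) / real (card V)"
proof -
  have sp: "\<And>v. v \<in> V \<Longrightarrow> pullback_name G s v x \<in> space (config (carrier G) X)"
    using pullback_space[OF s _ x] by blast
  then have m: "(\<lambda>v. pullback_name G s v x) \<in> measurable (uniform_count_measure V) (config (carrier G) X)"
    by (auto simp: measurable_def space_uniform_count_measure sets_uniform_count_measure)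
  have "prob_space (uniform_count_measure V)" using V by (intro prob_space_uniform_count_measure)
  then show "empirical_distribution G X V s x \<in> Prob (config (carrier G) X)"
    unfolding Prob_def empirical_distribution_def using prob_space.prob_space_distr[OF _ m] by auto
  assume F: "F \<in> borel_measurable (config (carrier G) X)"
  have "(\<integral>z. F z \<partial>empirical_distribution G X V s x) = (\<integral>v. F (pullback_name G s v x) \<partial>uniform_count_measure V)"
    unfolding empirical_distribution_def by (rule integral_distr[OF m F])
  also have "\<dots> = (\<Sum>v\<in>V. (1 / real (card V)) * F (pullback_name G s v x))"
    unfolding uniform_count_measure_def using V
    by (subst lebesgue_integral_point_measure_finite) auto
  finally show "(\<integral>z. F z \<partial>empirical_distribution G X V s x) = (\<Sum>v\<in>V. F (pullback_name G s v x)) / real (card V)"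
    by (simp add: sum_divide_distrib)
qed

lemma distr_pullback_in_Prob:
  assumes s: "\<forall>g\<in>carrier G. s g permutes V" and v: "v \<in> V" and M: "M \<in> Prob (config V X)"
  shows "distr M (config (carrier G) X) (pullback_name G s v) \<in> Prob (config (carrier G) X)"
    and "F \<in> borel_measurable (config (carrier G) X) \<Longrightarrow>
      (\<integral>z. F z \<partial>distr M (config (carrier G) X) (pullback_name G s v)) = (\<integral>x. (F (pullback_name G s v x) :: real) \<partial>M)"
proof -
  have m: "pullback_name G s v \<in> measurable M (config (carrier G) X)"
    unfolding Prob_measurable[OF M] by (rule pullback_measurable[OF s v])
  show "distr M (config (carrier G) X) (pullback_name G s v) \<in> Prob (config (carrier G) X)"
    using prob_space.prob_space_distr[OF ProbD(1)[OF M] m] by (simp add: Prob_def)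
  show "(\<integral>z. F z \<partial>distr M (config (carrier G) X) (pullback_name G s v)) = (\<integral>x. F (pullback_name G s v x) \<partial>M)"
    if "F \<in> borel_measurable (config (carrier G) X)" using that by (rule integral_distr[OF m])
qed

lemma observable_integrable:
  assumes X: "measurably_precompact X d" and F: "window_lipschitz (carrier G) X d F"
    and s: "\<forall>g\<in>carrier G. s g permutes V" and v: "v \<in> V" and M: "M \<in> Prob (config V X)"
  shows "integrable M (\<lambda>x. F (pullback_name G s v x))"
proof -
  obtain C where C: "\<And>x. x \<in> space (config (carrier G) X) \<Longrightarrow> \<bar>F x\<bar> \<le> C"
    using window_lipschitz_bounded[OF X F] by metis
  have "(\<lambda>x. F (pullback_name G s v x)) \<in> borel_measurable M"
    unfolding Prob_measurable[OF M]
    by (rule measurable_compose[OF pullback_measurable[OF s v] window_lipschitz_measurable[OF X F]])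
  then show ?thesis
    using C pullback_space[OF s v] ProbD[OF M]
    by (intro integrable_bounded[of _ _ C]) auto
qed

text \<open>
  Enlarging a neighbourhood can only increase the probability of its good models once these sets
  are measurable. They are even open: the site average of a test function is a Lipschitz function
  of the labelling.
\<close>

lemma good_models_measurable:
  assumes X: "measurably_precompact X d" and comp: "compact_space (Metric_space.mtopology (space X) d)"
    and V: "finite V" "V \<noteq> {}" and s: "\<forall>g\<in>carrier G. s g permutes V"
    and U: "openin (weak_star_topology (product_topology (\<lambda>_. Metric_space.mtopology (space X) d) (carrier G)) (config (carrier G) X)) U"
  shows "good_models G X U V s \<in> sets (config V X)"
proof (rule metric_open_measurable[OF measurably_precompact_config[OF X V(1)]])
  show "good_models G X U V s \<subseteq> space (config V X)" by (auto simp: good_models_def)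
  fix x assume "x \<in> good_models G X U V s"
  then have x: "x \<in> space (config V X)" "empirical_distribution G X V s x \<in> U" by (auto simp: good_models_def)
  have d: "Metric_space (space X) d" using X by (simp add: measurably_precompact_def)
  have n: "real (card V) > 0" using V by (simp add: card_gt_0_iff)
  obtain \<F> r where \<F>0: "finite \<F>" "\<forall>F\<in>\<F>. window_lipschitz (carrier G) X d F" and r: "0 < r"
    and U0: "\<forall>N'\<in>Prob (config (carrier G) X).
       (\<forall>F\<in>\<F>. \<bar>(\<integral>z. F z \<partial>N') - (\<integral>z. F z \<partial>empirical_distribution G X V s x)\<bar> < r) \<longrightarrow> N' \<in> U"
    using conjunct2[OF weak_star_neighbourhood[OF X comp U x(2)]] by (elim exE conjE)
  note \<F> = \<F>0(1) bspec[OF \<F>0(2)]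
  note U' = mp[OF bspec[OF U0], OF _ ballI]
  have "\<exists>K\<ge>0. \<forall>y\<in>space (config V X).
     \<bar>(\<Sum>v\<in>V. F (pullback_name G s v y)) - (\<Sum>v\<in>V. F (pullback_name G s v x))\<bar> / real (card V) \<le> K * window_dist V d x y"
    if F: "F \<in> \<F>" for F
  proof -
    obtain W L where W: "finite W" "W \<subseteq> carrier G" "0 \<le> L"
      and FW: "\<And>x y. x \<in> space (config (carrier G) X) \<Longrightarrow> y \<in> space (config (carrier G) X) \<Longrightarrow> \<bar>F x - F y\<bar> \<le> L * window_dist W d x y"
      using window_lipschitzE[OF \<F>(2)[OF F]] by metis
    have "\<bar>(\<Sum>v\<in>V. F (pullback_name G s v y)) - (\<Sum>v\<in>V. F (pullback_name G s v x))\<bar> / real (card V)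
        \<le> (L * card W / card V) * window_dist V d x y" if y: "y \<in> space (config V X)" for y
    proof -
      have "\<bar>(\<Sum>v\<in>V. F (pullback_name G s v y)) - (\<Sum>v\<in>V. F (pullback_name G s v x))\<bar>
         \<le> (\<Sum>v\<in>V. L * window_dist W d (pullback_name G s v x) (pullback_name G s v y))"
        unfolding sum_subtractf[symmetric]
      proof (intro order_trans[OF sum_abs] sum_mono)
        fix v assume v: "v \<in> V"
        show "\<bar>F (pullback_name G s v y) - F (pullback_name G s v x)\<bar> \<le> L * window_dist W d (pullback_name G s v x) (pullback_name G s v y)"
          using FW[OF pullback_space[OF s v x(1)] pullback_space[OF s v y]] by (simp add: abs_minus_commute)
      qed
      also have "\<dots> = L * (card W * window_dist V d x y)"
        unfolding sum_distrib_left[symmetric] by (subst sum_window_dist_pullback[OF s W(2)]) auto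
      finally show ?thesis using n by (simp add: field_simps)
    qed
    moreover have "0 \<le> L * card W / card V" using W n by simp
    ultimately show ?thesis by blast
  qed
  then obtain K where K0: "\<And>F. F \<in> \<F> \<Longrightarrow> 0 \<le> K F" and K: "\<And>F y. F \<in> \<F> \<Longrightarrow> y \<in> space (config V X) \<Longrightarrow>
     \<bar>(\<Sum>v\<in>V. F (pullback_name G s v y)) - (\<Sum>v\<in>V. F (pullback_name G s v x))\<bar> / real (card V) \<le> K F * window_dist V d x y"
    by metis
  define k where "k = sum K \<F> + 1"
  have k: "0 < k" using K0 unfolding k_def by (simp add: add_nonneg_pos sum_nonneg)
  have "y \<in> good_models G X U V s" if y: "y \<in> space (config V X)" "window_dist V d x y < r / k" for y
  proof -
    have "empirical_distribution G X V s y \<in> U"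
    proof (rule U')
      show "empirical_distribution G X V s y \<in> Prob (config (carrier G) X)"
        by (rule empirical_in_Prob[OF V s y(1)])
      fix F assume F: "F \<in> \<F>"
      have mF: "F \<in> borel_measurable (config (carrier G) X)" by (rule window_lipschitz_measurable[OF X \<F>(2)[OF F]])
      have "K F \<le> sum K \<F>" using F \<F>(1) K0 by (intro member_le_sum) auto
      then have "K F * window_dist V d x y \<le> k * window_dist V d x y"
        unfolding k_def using window_dist_nonneg[OF d] by (intro mult_right_mono) auto
      also have "\<dots> < r" using y(2) k by (simp add: field_simps)
      finally have "\<bar>(\<Sum>v\<in>V. F (pullback_name G s v y)) - (\<Sum>v\<in>V. F (pullback_name G s v x))\<bar> / real (card V) < r"
        using K[OF F y(1)] by linarith
      then show "\<bar>(\<integral>z. F z \<partial>empirical_distribution G X V s y) - (\<integral>z. F z \<partial>empirical_distribution G X V s x)\<bar> < r"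
        by (simp add: empirical_in_Prob(2)[OF V s y(1) mF] empirical_in_Prob(2)[OF V s x(1) mF] diff_divide_distrib[symmetric])
    qed
    then show ?thesis using y by (simp add: good_models_def)
  qed
  then show "\<exists>r>0. \<forall>y\<in>space (config V X). window_dist V d x y < r \<longrightarrow> y \<in> good_models G X U V s"
    using r k by (intro exI[of _ "r / k"]) auto
qed

text \<open>
  A deviation is small if the two quantities inside it are small on most sites and with high
  probability, since bounded functions contribute at most \<open>2 * C\<close> on the exceptional set. The
  converse, by Markov's inequality, is \<open>good_of_deviation\<close>.
\<close>

lemma deviation_le_of_good:
  assumes M: "prob_space M" and V: "finite V" "V \<noteq> {}"
    and H: "\<And>v. v \<in> V \<Longrightarrow> H v \<in> borel_measurable M"
    and C: "\<And>v x. v \<in> V \<Longrightarrow> x \<in> space M \<Longrightarrow> \<bar>H v x\<bar> \<le> C" "\<bar>c\<bar> \<le> C" and \<eta>: "0 \<le> \<eta>"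
  shows "deviation V M H c \<le> 2 * \<eta> + 2 * C * (1 - real (card {v\<in>V. \<bar>(\<integral>x. H v x \<partial>M) - c\<bar> < \<eta>}) / real (card V))
     + 2 * C * (1 - measure M {x\<in>space M. \<bar>(\<Sum>v\<in>V. H v x) / real (card V) - c\<bar> < \<eta>})"
proof -
  interpret prob_space M by fact
  have n: "real (card V) > 0" using V by (simp add: card_gt_0_iff)
  have C0: "0 \<le> C" using C(2) by linarith
  have Hi: "integrable M (H v)" if "v \<in> V" for v using H C that by (intro integrable_bounded[OF M, of _ C]) auto
  let ?A = "{v\<in>V. \<bar>(\<integral>x. H v x \<partial>M) - c\<bar> < \<eta>}"
  have HC: "\<bar>\<integral>x. H v x \<partial>M\<bar> \<le> C" if v: "v \<in> V" for v
  proof -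
    have "\<bar>\<integral>x. H v x \<partial>M\<bar> \<le> (\<integral>x. \<bar>H v x\<bar> \<partial>M)" by (rule integral_abs_bound)
    also have "\<dots> \<le> (\<integral>x. C \<partial>M)" using Hi C v by (intro integral_mono) auto
    finally show ?thesis by (simp add: prob_space)
  qed
  have "(\<Sum>v\<in>V. \<bar>(\<integral>x. H v x \<partial>M) - c\<bar>) \<le> (\<Sum>v\<in>V. \<eta> + 2 * C * (1 - indicator ?A v))"
  proof (rule sum_mono)
    fix v assume v: "v \<in> V"
    show "\<bar>(\<integral>x. H v x \<partial>M) - c\<bar> \<le> \<eta> + 2 * C * (1 - indicator ?A v)"
    proof (cases "v \<in> ?A")
      case True then show ?thesis by simp
    next
      case False then show ?thesis using HC[OF v] C(2) \<eta> by auto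
    qed
  qed
  also have "\<dots> = real (card V) * \<eta> + 2 * C * (real (card V) - real (card ?A))"
    using V by (simp add: sum.distrib sum_distrib_left[symmetric] sum_subtractf indicator_def sum.If_cases Int_def conj_commute)
  finally have 1: "(\<Sum>v\<in>V. \<bar>(\<integral>x. H v x \<partial>M) - c\<bar>) / card V \<le> \<eta> + 2 * C * (1 - real (card ?A) / card V)"
    using n by (simp add: field_simps)
  let ?g = "\<lambda>x. (\<Sum>v\<in>V. H v x) / real (card V)"
  have gm: "?g \<in> borel_measurable M" using H by auto
  let ?B = "{x\<in>space M. \<bar>?g x - c\<bar> < \<eta>}"
  have B: "?B \<in> sets M" using gm by measurable
  have gC: "\<bar>?g x\<bar> \<le> C" if x: "x \<in> space M" for x
  proof -
    have "\<bar>\<Sum>v\<in>V. H v x\<bar> \<le> (\<Sum>v\<in>V. C)" using C x by (intro order_trans[OF sum_abs] sum_mono) auto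
    then show ?thesis using n by (simp add: field_simps)
  qed
  have "(\<integral>x. \<bar>?g x - c\<bar> \<partial>M) \<le> (\<integral>x. \<eta> + 2 * C * (1 - indicator ?B x) \<partial>M)"
  proof (rule integral_mono)
    have "integrable M ?g" using gm gC by (intro integrable_bounded[OF M, of _ C]) auto
    then show "integrable M (\<lambda>x. \<bar>?g x - c\<bar>)" by simp
    show "integrable M (\<lambda>x. \<eta> + 2 * C * (1 - indicator ?B x))" using B by (simp add: emeasure_eq_measure)
    fix x assume x: "x \<in> space M"
    show "\<bar>?g x - c\<bar> \<le> \<eta> + 2 * C * (1 - indicator ?B x)"
    proof (cases "x \<in> ?B")
      case True then show ?thesis by simp
    next
      case False
      have "\<bar>a - c\<bar> \<le> \<eta> + 2 * C" if "\<bar>a\<bar> \<le> C" for a using that C(2) \<eta> by linarith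
      from this[OF gC[OF x]] show ?thesis using False by simp
    qed
  qed
  also have "\<dots> = \<eta> + 2 * C * (1 - measure M ?B)"
    using B by (simp add: prob_space emeasure_eq_measure)
  finally have 2: "(\<integral>x. \<bar>?g x - c\<bar> \<partial>M) \<le> \<eta> + 2 * C * (1 - measure M ?B)" .
  have "a + b \<le> 2 * \<eta> + p + q" if "a \<le> \<eta> + p" "b \<le> \<eta> + q" for a b p q :: real using that by linarith
  from this[OF 1 2] show ?thesis unfolding deviation_def .
qed

lemma good_of_deviation:
  assumes M: "prob_space M" and V: "finite V" "V \<noteq> {}" and H: "\<And>v. v \<in> V \<Longrightarrow> integrable M (H v)" and r: "0 < r"
  shows "real (card {v\<in>V. r \<le> \<bar>(\<integral>x. H v x \<partial>M) - c\<bar>}) / real (card V) \<le> deviation V M H c / r"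
    and "measure M {x\<in>space M. r \<le> \<bar>(\<Sum>v\<in>V. H v x) / real (card V) - c\<bar>} \<le> deviation V M H c / r"
proof -
  interpret prob_space M by fact
  have n: "real (card V) > 0" using V by (simp add: card_gt_0_iff)
  let ?A = "{v\<in>V. r \<le> \<bar>(\<integral>x. H v x \<partial>M) - c\<bar>}"
  have "r * card ?A = (\<Sum>v\<in>?A. r)" by simp
  also have "\<dots> \<le> (\<Sum>v\<in>?A. \<bar>(\<integral>x. H v x \<partial>M) - c\<bar>)" by (intro sum_mono) auto
  also have "\<dots> \<le> (\<Sum>v\<in>V. \<bar>(\<integral>x. H v x \<partial>M) - c\<bar>)" using V by (intro sum_mono2) auto
  finally have "r * card ?A / card V \<le> (\<Sum>v\<in>V. \<bar>(\<integral>x. H v x \<partial>M) - c\<bar>) / card V"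
    using n by (intro divide_right_mono) auto
  also have "\<dots> \<le> deviation V M H c" by (simp add: deviation_def)
  finally show "real (card ?A) / real (card V) \<le> deviation V M H c / r" using r by (simp add: field_simps)
  let ?g = "\<lambda>x. \<bar>(\<Sum>v\<in>V. H v x) / real (card V) - c\<bar>"
  have "measure M {x\<in>space M. r \<le> ?g x} \<le> (\<integral>x. ?g x \<partial>M) / r"
    using H r by (intro integral_Markov_inequality_measure[where A="{}"]) auto
  also have "\<dots> \<le> deviation V M H c / r"
    using r by (intro divide_right_mono) (auto simp: deviation_def sum_nonneg)
  finally show "measure M {x\<in>space M. r \<le> ?g x} \<le> deviation V M H c / r" .
qed


text \<open>
  Test functions are continuous, so they define neighbourhoods; conversely every neighbourhood
  contains one defined by finitely many test functions. For bounded functions convergence in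
  probability and in mean agree, which turns proportions of sites and probabilities into
  deviations and back.
\<close>

lemma quenched_converges_iff_observables:
  assumes X: "measurably_precompact X d" and comp: "compact_space (Metric_space.mtopology (space X) d)"
    and V: "\<And>i. finite (V i)" "\<And>i. V i \<noteq> {}" and s: "\<And>i. \<forall>g\<in>carrier G. \<sigma> i g permutes V i"
    and \<mu>: "\<mu> \<in> Prob (config (carrier G) X)"
  shows "quenched_converges G X d \<mu> V \<sigma> \<mu>s \<longleftrightarrow>
     (\<forall>i. \<mu>s i \<in> Prob (config (V i) X)) \<and> observables_converge G X d \<mu> V \<sigma> \<mu>s"
proof (intro iffI conjI)
  let ?B = "config (carrier G) X"
  let ?T = "product_topology (\<lambda>_. Metric_space.mtopology (space X) d) (carrier G)"
  have d: "Metric_space (space X) d" using X by (simp add: measurably_precompact_def)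
  {
    assume q: "quenched_converges G X d \<mu> V \<sigma> \<mu>s"
    then show P: "\<forall>i. \<mu>s i \<in> Prob (config (V i) X)" unfolding quenched_converges_def by blast
    show "observables_converge G X d \<mu> V \<sigma> \<mu>s"
      unfolding observables_converge_def
    proof (intro allI impI)
      fix F assume F: "window_lipschitz (carrier G) X d F"
      have mF: "F \<in> borel_measurable ?B" by (rule window_lipschitz_measurable[OF X F])
      define c where "c = (\<integral>z. F z \<partial>\<mu>)"
      define D where "D i = deviation (V i) (\<mu>s i) (\<lambda>v x. F (pullback_name G (\<sigma> i) v x)) c" for i
      obtain C where C0: "C > 0" and C: "\<And>x. x \<in> space ?B \<Longrightarrow> \<bar>F x\<bar> \<le> C"
        using window_lipschitz_bounded[OF X F] by metis
      have cC: "\<bar>c\<bar> \<le> C"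
      proof -
        interpret prob_space \<mu> by (rule ProbD(1)[OF \<mu>])
        have "\<bar>c\<bar> \<le> (\<integral>z. \<bar>F z\<bar> \<partial>\<mu>)" unfolding c_def by (rule integral_abs_bound)
        also have "\<dots> \<le> (\<integral>z. C \<partial>\<mu>)"
          using window_lipschitz_integrable[OF X F \<mu>] C ProbD(3)[OF \<mu>] by (intro integral_mono) auto
        finally show ?thesis by (simp add: prob_space)
      qed
      have "eventually (\<lambda>i. D i < \<epsilon>) sequentially" if \<epsilon>: "\<epsilon> > 0" for \<epsilon>
      proof -
        define \<eta> where "\<eta> = \<epsilon> / 4"
        let ?U = "{N \<in> Prob ?B. (\<integral>x. F x \<partial>N) \<in> ball c \<eta>}"
        define a where "a i = real (card {v \<in> V i. \<bar>(\<integral>x. F (pullback_name G (\<sigma> i) v x) \<partial>\<mu>s i) - c\<bar> < \<eta>}) / real (card (V i))" for i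
        define b where "b i = measure (\<mu>s i) {x\<in>space (\<mu>s i). \<bar>(\<Sum>v\<in>V i. F (pullback_name G (\<sigma> i) v x)) / real (card (V i)) - c\<bar> < \<eta>}" for i
        have "openin (weak_star_topology ?T ?B) ?U"
          by (rule weak_star_subbasic[OF window_lipschitz_continuous[OF d F]]) simp
        moreover have "\<mu> \<in> ?U" using \<mu> \<epsilon> by (simp add: c_def \<eta>_def)
        ultimately have lim: "(\<lambda>i. real (card {v \<in> V i. distr (\<mu>s i) ?B (pullback_name G (\<sigma> i) v) \<in> ?U}) / real (card (V i))) \<longlonglongrightarrow> 1"
          "(\<lambda>i. measure (\<mu>s i) (good_models G X ?U (V i) (\<sigma> i))) \<longlonglongrightarrow> 1"
          using q unfolding quenched_converges_def by blast+
        have "{v \<in> V i. distr (\<mu>s i) ?B (pullback_name G (\<sigma> i) v) \<in> ?U} =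
            {v \<in> V i. \<bar>(\<integral>x. F (pullback_name G (\<sigma> i) v x) \<partial>\<mu>s i) - c\<bar> < \<eta>}" for i
        proof (rule Collect_cong)
          fix v
          show "(v \<in> V i \<and> distr (\<mu>s i) ?B (pullback_name G (\<sigma> i) v) \<in> ?U) \<longleftrightarrow>
            (v \<in> V i \<and> \<bar>(\<integral>x. F (pullback_name G (\<sigma> i) v x) \<partial>\<mu>s i) - c\<bar> < \<eta>)"
          proof (cases "v \<in> V i")
            case True
            note dp = distr_pullback_in_Prob[OF s True P[rule_format]]
            show ?thesis using True dp(1) by (simp add: dp(2)[OF mF] dist_real_def abs_minus_commute)
          qed simp
        qed
        then have a: "a \<longlonglongrightarrow> 1" using lim(1) unfolding a_def by simp
        have "good_models G X ?U (V i) (\<sigma> i) =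
            {x\<in>space (\<mu>s i). \<bar>(\<Sum>v\<in>V i. F (pullback_name G (\<sigma> i) v x)) / real (card (V i)) - c\<bar> < \<eta>}" for i
          unfolding good_models_def ProbD(3)[OF P[rule_format]]
        proof (rule Collect_cong)
          fix x
          show "(x \<in> space (config (V i) X) \<and> empirical_distribution G X (V i) (\<sigma> i) x \<in> ?U) \<longleftrightarrow>
            (x \<in> space (config (V i) X) \<and> \<bar>(\<Sum>v\<in>V i. F (pullback_name G (\<sigma> i) v x)) / real (card (V i)) - c\<bar> < \<eta>)"
          proof (cases "x \<in> space (config (V i) X)")
            case True
            note ep = empirical_in_Prob[OF V s True]
            show ?thesis using True ep(1) by (simp add: ep(2)[OF mF] dist_real_def abs_minus_commute)
          qed simp
        qed
        then have b: "b \<longlonglongrightarrow> 1" using lim(2) unfolding b_def by simp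
        have "D i \<le> 2 * \<eta> + 2 * C * (1 - a i) + 2 * C * (1 - b i)" for i
          unfolding D_def a_def b_def
        proof (rule deviation_le_of_good[OF ProbD(1)[OF P[rule_format]] V])
          fix v assume v: "v \<in> V i"
          show "(\<lambda>x. F (pullback_name G (\<sigma> i) v x)) \<in> borel_measurable (\<mu>s i)"
            using observable_integrable[OF X F s v P[rule_format]] by auto
          show "\<bar>F (pullback_name G (\<sigma> i) v x)\<bar> \<le> C" if "x \<in> space (\<mu>s i)" for x
            by (rule C[OF pullback_space[OF s v that[unfolded ProbD(3)[OF P[rule_format]]]]])
        qed (use cC \<epsilon> in \<open>auto simp: \<eta>_def\<close>)
        moreover have "(\<lambda>i. 2 * \<eta> + 2 * C * (1 - a i) + 2 * C * (1 - b i)) \<longlonglongrightarrow> 2 * \<eta> + 2 * C * (1 - 1) + 2 * C * (1 - 1)"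
          by (intro tendsto_intros a b)
        then have "eventually (\<lambda>i. 2 * \<eta> + 2 * C * (1 - a i) + 2 * C * (1 - b i) < \<epsilon>) sequentially"
          by (rule order_tendstoD(2)) (use \<epsilon> in \<open>simp add: \<eta>_def\<close>)
        ultimately show ?thesis by (elim eventually_mono) (meson le_less_trans)
      qed
      moreover have "0 \<le> D i" for i unfolding D_def by (rule deviation_nonneg)
      ultimately have "D \<longlonglongrightarrow> 0"
        by (intro order_tendstoI) (auto intro: less_le_trans always_eventually)
      then show "(\<lambda>i. deviation (V i) (\<mu>s i) (\<lambda>v x. F (pullback_name G (\<sigma> i) v x)) (\<integral>z. F z \<partial>\<mu>)) \<longlonglongrightarrow> 0"
        unfolding D_def c_def .
    qed
  }
  {
    assume "(\<forall>i. \<mu>s i \<in> Prob (config (V i) X)) \<and> observables_converge G X d \<mu> V \<sigma> \<mu>s"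
    then have P: "\<And>i. \<mu>s i \<in> Prob (config (V i) X)" and oc: "observables_converge G X d \<mu> V \<sigma> \<mu>s" by auto
    show "quenched_converges G X d \<mu> V \<sigma> \<mu>s"
      unfolding quenched_converges_def
    proof (rule conjI)
      show "\<forall>i. \<mu>s i \<in> Prob (config (V i) X)" using P by blast
      show "\<forall>U. openin (weak_star_topology ?T ?B) U \<and> \<mu> \<in> U \<longrightarrow>
         (\<lambda>i. real (card {v \<in> V i. distr (\<mu>s i) ?B (pullback_name G (\<sigma> i) v) \<in> U}) / real (card (V i))) \<longlonglongrightarrow> 1 \<and>
         (\<lambda>i. measure (\<mu>s i) (good_models G X U (V i) (\<sigma> i))) \<longlonglongrightarrow> 1"
      proof (rule allI, rule impI)
        fix U assume UU: "openin (weak_star_topology ?T ?B) U \<and> \<mu> \<in> U"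
        obtain \<F> r where \<F>0: "finite \<F>" "\<forall>F\<in>\<F>. window_lipschitz (carrier G) X d F" and r: "0 < r"
          and U0: "\<forall>N'\<in>Prob ?B. (\<forall>F\<in>\<F>. \<bar>(\<integral>z. F z \<partial>N') - (\<integral>z. F z \<partial>\<mu>)\<bar> < r) \<longrightarrow> N' \<in> U"
          using conjunct2[OF weak_star_neighbourhood[OF X comp conjunct1[OF UU] conjunct2[OF UU]]] by (elim exE conjE)
        note \<F> = \<F>0(1) bspec[OF \<F>0(2)]
        note U' = mp[OF bspec[OF U0], OF _ ballI]
        define D where "D F i = deviation (V i) (\<mu>s i) (\<lambda>v x. F (pullback_name G (\<sigma> i) v x)) (\<integral>z. F z \<partial>\<mu>)" for F i
        define e where "e i = (\<Sum>F\<in>\<F>. D F i / r)" for i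
        have "(\<lambda>i. D F i) \<longlonglongrightarrow> 0" if "F \<in> \<F>" for F
          using oc \<F>(2)[OF that] unfolding observables_converge_def D_def by blast
        then have "e \<longlonglongrightarrow> (\<Sum>F\<in>\<F>. 0 / r)"
          unfolding e_def using r by (intro tendsto_sum tendsto_divide tendsto_const) auto
        then have e: "(\<lambda>i. 1 - e i) \<longlonglongrightarrow> 1" using tendsto_diff[OF tendsto_const[of "1::real"], of e 0] by simp
        let ?p = "\<lambda>i. real (card {v \<in> V i. distr (\<mu>s i) ?B (pullback_name G (\<sigma> i) v) \<in> U}) / real (card (V i))"
        let ?q = "\<lambda>i. measure (\<mu>s i) (good_models G X U (V i) (\<sigma> i))"
        have p1: "1 - e i \<le> ?p i" and p2: "?p i \<le> 1" and q1: "1 - e i \<le> ?q i" and q2: "?q i \<le> 1" for i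
        proof -
          interpret prob_space "\<mu>s i" by (rule ProbD(1)[OF P])
          have n: "real (card (V i)) > 0" using V[of i] by (simp add: card_gt_0_iff)
          have int: "integrable (\<mu>s i) (\<lambda>x. F (pullback_name G (\<sigma> i) v x))" if "F \<in> \<F>" "v \<in> V i" for F v
            by (rule observable_integrable[OF X \<F>(2)[OF that(1)] s that(2) P])
          have mF: "F \<in> borel_measurable ?B" if "F \<in> \<F>" for F by (rule window_lipschitz_measurable[OF X \<F>(2)[OF that]])
          let ?bad = "\<lambda>F. {v\<in>V i. r \<le> \<bar>(\<integral>x. F (pullback_name G (\<sigma> i) v x) \<partial>\<mu>s i) - (\<integral>z. F z \<partial>\<mu>)\<bar>}"
          let ?good = "{v \<in> V i. distr (\<mu>s i) ?B (pullback_name G (\<sigma> i) v) \<in> U}"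
          have "V i \<subseteq> ?good \<union> (\<Union>F\<in>\<F>. ?bad F)"
          proof
            fix v assume v: "v \<in> V i"
            note dp = distr_pullback_in_Prob[OF s v P]
            have "v \<in> ?good" if nb: "v \<notin> (\<Union>F\<in>\<F>. ?bad F)"
            proof -
              have "distr (\<mu>s i) ?B (pullback_name G (\<sigma> i) v) \<in> U"
              proof (rule U'[OF dp(1)])
                fix F assume F: "F \<in> \<F>"
                show "\<bar>(\<integral>z. F z \<partial>distr (\<mu>s i) ?B (pullback_name G (\<sigma> i) v)) - (\<integral>z. F z \<partial>\<mu>)\<bar> < r"
                  using nb v F unfolding dp(2)[OF mF[OF F]] by auto
              qed
              then show ?thesis using v by simp
            qed
            then show "v \<in> ?good \<union> (\<Union>F\<in>\<F>. ?bad F)" by blast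
          qed
          then have "card (V i) \<le> card (?good \<union> (\<Union>F\<in>\<F>. ?bad F))"
            using V[of i] \<F>(1) by (intro card_mono) auto
          also have "\<dots> \<le> card ?good + (\<Sum>F\<in>\<F>. card (?bad F))"
            by (rule order_trans[OF card_Un_le add_left_mono[OF card_UN_le[OF \<F>(1)]]])
          finally have "real (card (V i)) \<le> real (card ?good) + (\<Sum>F\<in>\<F>. real (card (?bad F)))"
            unfolding of_nat_add[symmetric] of_nat_sum[symmetric] of_nat_le_iff .
          then have "1 \<le> ?p i + (\<Sum>F\<in>\<F>. real (card (?bad F)) / real (card (V i)))"
            unfolding sum_divide_distrib[symmetric] add_divide_distrib[symmetric] using n by simp
          also have "(\<Sum>F\<in>\<F>. real (card (?bad F)) / real (card (V i))) \<le> e i"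
            unfolding e_def D_def
            by (intro sum_mono good_of_deviation(1)[OF prob_space_axioms V _ r] int)
          finally show "1 - e i \<le> ?p i" by simp
          have "card ?good \<le> card (V i)" using V by (intro card_mono) auto
          then show "?p i \<le> 1" using n by simp
          show "?q i \<le> 1" by (rule prob_le_1)
          let ?GM = "good_models G X U (V i) (\<sigma> i)"
          have GM: "?GM \<in> sets (\<mu>s i)"
            unfolding ProbD(2)[OF P] by (rule good_models_measurable[OF X comp V s conjunct1[OF UU]])
          let ?mbad = "\<lambda>F. {x\<in>space (\<mu>s i). r \<le> \<bar>(\<Sum>v\<in>V i. F (pullback_name G (\<sigma> i) v x)) / real (card (V i)) - (\<integral>z. F z \<partial>\<mu>)\<bar>}"
          have mb: "?mbad F \<in> sets (\<mu>s i)" if "F \<in> \<F>" for F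
          proof -
            have "(\<lambda>x. (\<Sum>v\<in>V i. F (pullback_name G (\<sigma> i) v x)) / real (card (V i)) - (\<integral>z. F z \<partial>\<mu>)) \<in> borel_measurable (\<mu>s i)"
              using int[OF that] by auto
            then show ?thesis by measurable
          qed
          have "space (\<mu>s i) \<subseteq> ?GM \<union> (\<Union>F\<in>\<F>. ?mbad F)"
          proof
            fix x assume x': "x \<in> space (\<mu>s i)"
            then have x: "x \<in> space (config (V i) X)" using ProbD(3)[OF P] by simp
            note ep = empirical_in_Prob[OF V s x]
            have "x \<in> ?GM" if nb: "x \<notin> (\<Union>F\<in>\<F>. ?mbad F)"
            proof -
              have "empirical_distribution G X (V i) (\<sigma> i) x \<in> U"
              proof (rule U'[OF ep(1)])
                fix F assume F: "F \<in> \<F>"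
                show "\<bar>(\<integral>z. F z \<partial>empirical_distribution G X (V i) (\<sigma> i) x) - (\<integral>z. F z \<partial>\<mu>)\<bar> < r"
                  using nb x' F unfolding ep(2)[OF mF[OF F]] by auto
              qed
              then show ?thesis using x by (simp add: good_models_def)
            qed
            then show "x \<in> ?GM \<union> (\<Union>F\<in>\<F>. ?mbad F)" by blast
          qed
          then have "1 \<le> prob (?GM \<union> (\<Union>F\<in>\<F>. ?mbad F))"
            unfolding prob_space[symmetric] using GM mb \<F>(1) by (intro finite_measure_mono) auto
          also have "\<dots> \<le> prob ?GM + prob (\<Union>F\<in>\<F>. ?mbad F)"
            using GM mb \<F>(1) by (intro measure_Un_le) auto
          also have "prob (\<Union>F\<in>\<F>. ?mbad F) \<le> (\<Sum>F\<in>\<F>. prob (?mbad F))"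
            using mb \<F>(1) by (intro measure_UNION_le) auto
          also have "\<dots> \<le> e i"
            unfolding e_def D_def
            by (intro sum_mono good_of_deviation(2)[OF prob_space_axioms V _ r] int)
          finally show "1 - e i \<le> ?q i" by simp
        qed
        have "?p \<longlonglongrightarrow> 1"
          by (rule tendsto_sandwich[OF _ _ e tendsto_const]) (use p1 p2 in auto)
        moreover have "?q \<longlonglongrightarrow> 1"
          by (rule tendsto_sandwich[OF _ _ e tendsto_const]) (use q1 q2 in auto)
        ultimately show "?p \<longlonglongrightarrow> 1 \<and> ?q \<longlonglongrightarrow> 1" by blast
      qed
    qed
  }
qed

section \<open>Almost Lipschitz approximation of measurable maps\<close>

text \<open>
  The events in the \<open>L\<^sup>1\<close>-closure of the test functions. They form a \<open>\<sigma>\<close>-algebra that contains the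
  open cylinders, hence all measurable sets.
\<close>

definition approximable_event :: "'i set \<Rightarrow> 'x measure \<Rightarrow> ('x \<Rightarrow> 'x \<Rightarrow> real) \<Rightarrow> ('i \<Rightarrow> 'x) measure \<Rightarrow> ('i \<Rightarrow> 'x) set \<Rightarrow> bool" where
  "approximable_event I X d \<mu> A \<longleftrightarrow> A \<in> sets (config I X) \<and>
     (\<forall>\<eta>>0. \<exists>F. window_lipschitz I X d F \<and> (\<integral>x. \<bar>F x - indicator A x\<bar> \<partial>\<mu>) \<le> \<eta>)"

lemma approximable_event_Un:
  assumes X: "measurably_precompact X d" and \<mu>: "\<mu> \<in> Prob (config I X)"
    and A: "approximable_event I X d \<mu> A" and B: "approximable_event I X d \<mu> B"
  shows "approximable_event I X d \<mu> (A \<union> B)"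
  unfolding approximable_event_def
proof (intro conjI allI impI)
  interpret prob_space \<mu> by (rule ProbD(1)[OF \<mu>])
  have d: "Metric_space (space X) d" using X by (simp add: measurably_precompact_def)
  have AB: "A \<in> sets \<mu>" "B \<in> sets \<mu>" using A B ProbD(2)[OF \<mu>] by (auto simp: approximable_event_def)
  then show "A \<union> B \<in> sets (config I X)" using ProbD(2)[OF \<mu>] by auto
  fix \<eta> :: real assume \<eta>: "\<eta> > 0"
  obtain F where F: "window_lipschitz I X d F" "(\<integral>x. \<bar>F x - indicator A x\<bar> \<partial>\<mu>) \<le> \<eta> / 2"
    using A \<eta> unfolding approximable_event_def by (meson half_gt_zero)
  obtain G where G: "window_lipschitz I X d G" "(\<integral>x. \<bar>G x - indicator B x\<bar> \<partial>\<mu>) \<le> \<eta> / 2"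
    using B \<eta> unfolding approximable_event_def by (meson half_gt_zero)
  note int = window_lipschitz_integrable[OF X _ \<mu>]
  have FG: "window_lipschitz I X d (\<lambda>x. max (F x) (G x))" by (rule window_lipschitz_max[OF d F(1) G(1)])
  have "(\<integral>x. \<bar>max (F x) (G x) - indicator (A \<union> B) x\<bar> \<partial>\<mu>) \<le>
      (\<integral>x. \<bar>F x - indicator A x\<bar> + \<bar>G x - indicator B x\<bar> \<partial>\<mu>)"
  proof (rule integral_mono)
    show "integrable \<mu> (\<lambda>x. \<bar>max (F x) (G x) - indicator (A \<union> B) x\<bar>)"
      using int[OF FG] AB by (auto simp: emeasure_eq_measure)
    show "integrable \<mu> (\<lambda>x. \<bar>F x - indicator A x\<bar> + \<bar>G x - indicator B x\<bar>)"
      using int[OF F(1)] int[OF G(1)] AB by (auto simp: emeasure_eq_measure)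
    show "\<bar>max (F x) (G x) - indicator (A \<union> B) x\<bar> \<le> \<bar>F x - indicator A x\<bar> + \<bar>G x - indicator B x\<bar>" for x
      by (auto simp: indicator_def max_def)
  qed
  also have "\<dots> = (\<integral>x. \<bar>F x - indicator A x\<bar> \<partial>\<mu>) + (\<integral>x. \<bar>G x - indicator B x\<bar> \<partial>\<mu>)"
    using int[OF F(1)] int[OF G(1)] AB by (intro Bochner_Integration.integral_add) (auto simp: emeasure_eq_measure)
  also have "\<dots> \<le> \<eta>" using F(2) G(2) by simp
  finally show "\<exists>F. window_lipschitz I X d F \<and> (\<integral>x. \<bar>F x - indicator (A \<union> B) x\<bar> \<partial>\<mu>) \<le> \<eta>"
    using FG by blast
qed

text \<open>
  The triangle inequality in \<open>L\<^sup>1\<close> for nested events.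
\<close>

lemma integral_abs_indicator_diff:
  assumes \<mu>: "prob_space \<mu>" and F: "integrable \<mu> F" and AB: "A \<in> sets \<mu>" "B \<in> sets \<mu>" "A \<subseteq> B"
  shows "(\<integral>x. \<bar>F x - indicator B x\<bar> \<partial>\<mu>) \<le> (\<integral>x. \<bar>F x - indicator A x\<bar> \<partial>\<mu>) + (measure \<mu> B - measure \<mu> A)"
proof -
  interpret prob_space \<mu> by fact
  have "(\<integral>x. \<bar>F x - indicator B x\<bar> \<partial>\<mu>) \<le> (\<integral>x. \<bar>F x - indicator A x\<bar> + indicator (B - A) x \<partial>\<mu>)"
  proof (rule integral_mono)
    show "integrable \<mu> (\<lambda>x. \<bar>F x - indicator B x\<bar>)" using F AB by (auto simp: emeasure_eq_measure)
    show "integrable \<mu> (\<lambda>x. \<bar>F x - indicator A x\<bar> + indicator (B - A) x)" using F AB by (auto simp: emeasure_eq_measure)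
    show "\<bar>F x - indicator B x\<bar> \<le> \<bar>F x - indicator A x\<bar> + indicator (B - A) x" for x
      using AB(3) by (auto simp: indicator_def)
  qed
  also have "\<dots> = (\<integral>x. \<bar>F x - indicator A x\<bar> \<partial>\<mu>) + measure \<mu> (B - A)"
    using F AB by (subst Bochner_Integration.integral_add) (auto simp: emeasure_eq_measure)
  finally show ?thesis using AB by (simp add: finite_measure_Diff)
qed

text \<open>
  A countable union is approximated in measure by finite unions, which are covered by
  \<open>approximable_event_Un\<close>.
\<close>

lemma approximable_event_countable_UN:
  assumes X: "measurably_precompact X d" and \<mu>: "\<mu> \<in> Prob (config I X)"
    and A: "\<And>n :: nat. approximable_event I X d \<mu> (A n)"
  shows "approximable_event I X d \<mu> (\<Union>n. A n)"
  unfolding approximable_event_def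
proof (intro conjI allI impI)
  interpret prob_space \<mu> by (rule ProbD(1)[OF \<mu>])
  have AS: "A n \<in> sets \<mu>" for n using A[of n] ProbD(2)[OF \<mu>] by (auto simp: approximable_event_def)
  then show "(\<Union>n. A n) \<in> sets (config I X)" using ProbD(2)[OF \<mu>] by auto
  define B where "B n = (\<Union>i\<le>n. A i)" for n
  have BA: "approximable_event I X d \<mu> (B n)" for n
  proof (induction n)
    case 0 then show ?case using A[of 0] by (simp add: B_def)
  next
    case (Suc n)
    have "B (Suc n) = B n \<union> A (Suc n)" by (auto simp: B_def atMost_Suc)
    then show ?case using approximable_event_Un[OF X \<mu> Suc A] by simp
  qed
  have BS: "B n \<in> sets \<mu>" for n using BA[of n] ProbD(2)[OF \<mu>] by (auto simp: approximable_event_def)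
  have UB: "(\<Union>n. A n) = (\<Union>n. B n)" by (auto simp: B_def)
  have "(\<lambda>n. measure \<mu> (B n)) \<longlonglongrightarrow> measure \<mu> (\<Union>n. B n)"
    by (rule finite_Lim_measure_incseq) (use BS in \<open>auto simp: incseq_def B_def intro: order_trans\<close>)
  fix \<eta> :: real assume \<eta>: "\<eta> > 0"
  obtain n where n: "\<bar>measure \<mu> (B n) - measure \<mu> (\<Union>n. B n)\<bar> < \<eta> / 2"
    using LIMSEQ_D[OF \<open>(\<lambda>n. measure \<mu> (B n)) \<longlonglongrightarrow> _\<close>, of "\<eta> / 2"] \<eta> by auto
  obtain F where F: "window_lipschitz I X d F" "(\<integral>x. \<bar>F x - indicator (B n) x\<bar> \<partial>\<mu>) \<le> \<eta> / 2"
    using BA[of n] \<eta> unfolding approximable_event_def by (meson half_gt_zero)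
  have "(\<integral>x. \<bar>F x - indicator (\<Union>n. B n) x\<bar> \<partial>\<mu>) \<le> (\<integral>x. \<bar>F x - indicator (B n) x\<bar> \<partial>\<mu>) + (measure \<mu> (\<Union>n. B n) - measure \<mu> (B n))"
    using BS by (intro integral_abs_indicator_diff window_lipschitz_integrable[OF X F(1) \<mu>] prob_space_axioms) auto
  also have "\<dots> \<le> \<eta>" using F(2) n by linarith
  finally show "\<exists>F. window_lipschitz I X d F \<and> (\<integral>x. \<bar>F x - indicator (\<Union>n. A n) x\<bar> \<partial>\<mu>) \<le> \<eta>"
    using F(1) UB by auto
qed

lemma approximable_event_Compl:
  assumes X: "measurably_precompact X d" and \<mu>: "\<mu> \<in> Prob (config I X)"
    and A: "approximable_event I X d \<mu> A"
  shows "approximable_event I X d \<mu> (space (config I X) - A)"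
  unfolding approximable_event_def
proof (intro conjI allI impI)
  have d: "Metric_space (space X) d" using X by (simp add: measurably_precompact_def)
  show "space (config I X) - A \<in> sets (config I X)" using A by (auto simp: approximable_event_def)
  fix \<eta> :: real assume "\<eta> > 0"
  then obtain F where F: "window_lipschitz I X d F" "(\<integral>x. \<bar>F x - indicator A x\<bar> \<partial>\<mu>) \<le> \<eta>"
    using A unfolding approximable_event_def by meson
  have "(\<integral>x. \<bar>(1 + (- 1) * F x) - indicator (space (config I X) - A) x\<bar> \<partial>\<mu>) = (\<integral>x. \<bar>F x - indicator A x\<bar> \<partial>\<mu>)"
    by (rule Bochner_Integration.integral_cong) (auto simp: indicator_def ProbD(3)[OF \<mu>])
  moreover have "window_lipschitz I X d (\<lambda>x. 1 + (- 1) * F x)"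
    by (rule window_lipschitz_add[OF d window_lipschitz_const[OF d] window_lipschitz_cmult[OF d F(1)]])
  ultimately show "\<exists>F. window_lipschitz I X d F \<and> (\<integral>x. \<bar>F x - indicator (space (config I X) - A) x\<bar> \<partial>\<mu>) \<le> \<eta>"
    using F(2) by (intro exI[of _ "\<lambda>x. 1 + (- 1) * F x"]) simp
qed

lemma approximable_event_empty:
  assumes X: "measurably_precompact X d"
  shows "approximable_event I X d \<mu> {}"
  unfolding approximable_event_def
proof (intro conjI allI impI)
  have d: "Metric_space (space X) d" using X by (simp add: measurably_precompact_def)
  show "\<exists>F. window_lipschitz I X d F \<and> (\<integral>x. \<bar>F x - indicator {} x\<bar> \<partial>\<mu>) \<le> \<eta>" if "0 < \<eta>" for \<eta>
    using that by (intro exI[of _ "\<lambda>_. 0"] conjI window_lipschitz_const[OF d]) auto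
qed auto

text \<open>
  The indicator of an open set can drop from 1 to 0 over a distance below \<open>1/(n+1)\<close> only when it
  starts in the shell \<open>B n\<close> of points that close to the complement. So the envelope applies with the
  indicator of the shell as error, and the shells decrease to the empty set.
\<close>

lemma approximable_event_open_cylinder:
  assumes X: "measurably_precompact X d" and \<mu>: "\<mu> \<in> Prob (config I X)" and i: "i \<in> I"
    and U: "openin (Metric_space.mtopology (space X) d) U"
  shows "approximable_event I X d \<mu> {x \<in> space (config I X). x i \<in> U}"
proof -
  interpret Metric_space "space X" d using X by (simp add: measurably_precompact_def)
  interpret P: prob_space \<mu> by (rule ProbD(1)[OF \<mu>])
  have Usub: "U \<subseteq> space X" using openin_subset[OF U] by simp
  have op: "\<exists>r>0. \<forall>y\<in>space X. d x y < r \<longrightarrow> y \<in> U" if "x \<in> U" for x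
    using U that Usub unfolding openin_mtopology by (meson in_mball subset_iff)
  have US: "U \<in> sets X" using metric_open_measurable[OF X Usub op] .
  \<comment> \<open>the points of \<open>U\<close> within \<open>1/(n+1)\<close> of its complement\<close>
  define B where "B n = {x\<in>U. \<exists>y\<in>space X. d x y < 1 / Suc n \<and> y \<notin> U}" for n :: nat
  have BS: "B n \<in> sets X" for n
  proof -
    have "{x\<in>space X. \<exists>y\<in>space X. d x y < 1 / Suc n \<and> y \<notin> U} \<in> sets X"
    proof (rule metric_open_measurable[OF X])
      fix x assume "x \<in> {x\<in>space X. \<exists>y\<in>space X. d x y < 1 / Suc n \<and> y \<notin> U}"
      then obtain y where y: "x \<in> space X" "y \<in> space X" "d x y < 1 / Suc n" "y \<notin> U" by blast
      have "d x' y < 1 / Suc n" if "x' \<in> space X" "d x x' < 1 / Suc n - d x y" for x'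
        using triangle[of x' x y] y that commute[of x x'] by linarith
      then show "\<exists>r>0. \<forall>x'\<in>space X. d x x' < r \<longrightarrow> x' \<in> {x\<in>space X. \<exists>y\<in>space X. d x y < 1 / Suc n \<and> y \<notin> U}"
        using y by (intro exI[of _ "1 / Suc n - d x y"]) auto
    qed auto
    moreover have "B n = U \<inter> {x\<in>space X. \<exists>y\<in>space X. d x y < 1 / Suc n \<and> y \<notin> U}"
      using Usub by (auto simp: B_def)
    ultimately show ?thesis using US by auto
  qed
  let ?cyl = "\<lambda>A. {x \<in> space (config I X). x i \<in> A}"
  have cyl: "?cyl A \<in> sets (config I X)" if "A \<in> sets X" for A
    using measurable_sets[OF measurable_component_singleton[OF i, of "\<lambda>_. X"] that]
    by (simp add: vimage_def Int_def conj_commute)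
  have "(\<lambda>n. measure \<mu> (?cyl (B n))) \<longlonglongrightarrow> measure \<mu> (\<Inter>n. ?cyl (B n))"
  proof (rule P.finite_Lim_measure_decseq)
    show "range (\<lambda>n. ?cyl (B n)) \<subseteq> sets \<mu>" using cyl[OF BS] ProbD(2)[OF \<mu>] by auto
    show "decseq (\<lambda>n. ?cyl (B n))"
    proof (rule decseq_SucI)
      fix n
      have "1 / real (Suc (Suc n)) \<le> 1 / real (Suc n)" by (simp add: field_simps)
      then show "?cyl (B (Suc n)) \<subseteq> ?cyl (B n)" unfolding B_def by (auto intro: less_le_trans)
    qed
  qed
  moreover have "(\<Inter>n. ?cyl (B n)) = {}"
  proof (rule ccontr)
    assume "(\<Inter>n. ?cyl (B n)) \<noteq> {}"
    then obtain x where x: "\<And>n. x i \<in> B n" by auto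
    then obtain r where r: "r > 0" "\<forall>y\<in>space X. d (x i) y < r \<longrightarrow> y \<in> U" using op unfolding B_def by blast
    obtain n where n: "1 / Suc n < r" using r reals_Archimedean[of r] by (auto simp: inverse_eq_divide)
    then show False using x[of n] r unfolding B_def by (auto dest: less_trans)
  qed
  ultimately have lim: "(\<lambda>n. measure \<mu> (?cyl (B n))) \<longlonglongrightarrow> 0" by simp
  show ?thesis
    unfolding approximable_event_def
  proof (intro conjI cyl US allI impI)
    fix \<eta> :: real assume \<eta>: "\<eta> > 0"
    obtain n where n: "measure \<mu> (?cyl (B n)) < \<eta>"
      using LIMSEQ_D[OF lim \<eta>] by auto
    have h: "indicator (?cyl U) x - indicator (?cyl U) y \<le> indicator (?cyl (B n)) x + real (Suc n) * window_dist {i} d x y"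
      if xy: "x \<in> space (config I X)" "y \<in> space (config I X)" for x y
    proof (cases "x i \<in> U \<and> y i \<notin> U \<and> x i \<notin> B n")
      case True
      then have "1 / Suc n \<le> d (x i) (y i)" using config_component[OF xy(2) i] unfolding B_def by (simp add: not_less) (meson not_le)
      then have "1 \<le> real (Suc n) * d (x i) (y i)" by (simp add: field_simps)
      then show ?thesis using True xy by (simp add: window_dist_def indicator_def)
    next
      case False
      have "0 \<le> real (Suc n) * window_dist {i} d x y" by (simp add: window_dist_def)
      then show ?thesis using False xy by (auto simp: indicator_def)
    qed
    obtain F where F: "window_lipschitz I X d F"
      "\<And>x. x \<in> space (config I X) \<Longrightarrow> \<bar>indicator (?cyl U) x - F x\<bar> \<le> indicator (?cyl (B n)) x"
      using lipschitz_envelope[OF Metric_space_axioms, of "{i}" I "real (Suc n)" "indicator (?cyl U)" "indicator (?cyl (B n))"] h i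
      by auto
    have "(\<integral>x. \<bar>F x - indicator (?cyl U) x\<bar> \<partial>\<mu>) \<le> (\<integral>x. indicator (?cyl (B n)) x \<partial>\<mu>)"
    proof (rule integral_mono)
      show "integrable \<mu> (\<lambda>x. \<bar>F x - indicator (?cyl U) x\<bar>)"
        using window_lipschitz_integrable[OF X F(1) \<mu>] cyl[OF US] ProbD(2)[OF \<mu>] by (auto simp: P.emeasure_eq_measure)
      show "integrable \<mu> (indicator (?cyl (B n)) :: _ \<Rightarrow> real)" using cyl[OF BS] ProbD(2)[OF \<mu>] by (auto simp: P.emeasure_eq_measure)
      show "\<bar>F x - indicator (?cyl U) x\<bar> \<le> indicator (?cyl (B n)) x" if "x \<in> space \<mu>" for x
        using F(2)[of x] that ProbD(3)[OF \<mu>] by (simp add: abs_minus_commute)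
    qed
    also have "\<dots> = measure \<mu> (?cyl (B n))" using cyl[OF BS] ProbD(2)[OF \<mu>] by simp
    finally show "\<exists>F. window_lipschitz I X d F \<and> (\<integral>x. \<bar>F x - indicator (?cyl U) x\<bar> \<partial>\<mu>) \<le> \<eta>"
      using n F(1) by (intro exI[of _ F]) auto
  qed
qed

lemma approximable_event_measurable:
  assumes X: "measurably_precompact X d" and \<mu>: "\<mu> \<in> Prob (config I X)"
    and sets: "sets X = sigma_sets (space X) {U. openin (Metric_space.mtopology (space X) d) U}"
    and A: "A \<in> sets (config I X)"
  shows "approximable_event I X d \<mu> A"
proof -
  let ?S = "space (config I X)"
  have cyl: "approximable_event I X d \<mu> {x \<in> ?S. x i \<in> B}" if i: "i \<in> I" and "B \<in> sets X" for i B
  proof -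
    have "B \<in> sigma_sets (space X) {U. openin (Metric_space.mtopology (space X) d) U}" using that sets by simp
    then show ?thesis
    proof (induction rule: sigma_sets.induct)
      case (Basic U) then show ?case using approximable_event_open_cylinder[OF X \<mu> i] by simp
    next
      case Empty then show ?case using approximable_event_empty[OF X] by simp
    next
      case (Compl B)
      have "{x \<in> ?S. x i \<in> space X - B} = ?S - {x \<in> ?S. x i \<in> B}" using i by (auto dest: config_component)
      then show ?case using approximable_event_Compl[OF X \<mu> Compl.IH] by simp
    next
      case (Union B)
      have "{x \<in> ?S. x i \<in> (\<Union>n. B n)} = (\<Union>n. {x \<in> ?S. x i \<in> B n})" by auto
      then show ?case using approximable_event_countable_UN[OF X \<mu> Union.IH] by simp
    qed
  qed
  have "A \<in> sigma_sets (PiE I (\<lambda>_. space X)) {{f\<in>PiE I (\<lambda>_. space X). f i \<in> B} | i B. i \<in> I \<and> B \<in> sets X}"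
    using A by (simp add: sets_PiM_single)
  then show ?thesis
  proof (induction rule: sigma_sets.induct)
    case (Basic A) then show ?case using cyl by (auto simp: space_PiM)
  next
    case Empty show ?case by (rule approximable_event_empty[OF X])
  next
    case (Compl A) then show ?case using approximable_event_Compl[OF X \<mu> Compl.IH] by (simp add: space_PiM)
  next
    case (Union A) then show ?case using approximable_event_countable_UN[OF X \<mu>] by blast
  qed
qed

text \<open>
  A Lipschitz bound up to an error \<open>\<rho>\<close> that is charged to one endpoint, has mean at most \<open>\<eta>\<close> and is
  itself a test function. The last point matters: averages of \<open>\<rho>\<close> along a converging sequence of
  labellings are controlled by the convergence.
\<close>

definition almost_lipschitz :: "'i set \<Rightarrow> 'x measure \<Rightarrow> ('x \<Rightarrow> 'x \<Rightarrow> real) \<Rightarrow> ('y \<Rightarrow> 'y \<Rightarrow> real) \<Rightarrow> ('i \<Rightarrow> 'x) measure \<Rightarrow>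
    real \<Rightarrow> (('i \<Rightarrow> 'x) \<Rightarrow> 'y) \<Rightarrow> bool" where
  "almost_lipschitz I X d e \<mu> \<eta> \<phi> \<longleftrightarrow> (\<exists>\<rho> W L. window_lipschitz I X d \<rho> \<and> finite W \<and> W \<subseteq> I \<and> 0 \<le> L \<and>
     (\<integral>x. \<rho> x \<partial>\<mu>) \<le> \<eta> \<and>
     (\<forall>x\<in>space (config I X). \<forall>y\<in>space (config I X). e (\<phi> x) (\<phi> y) \<le> \<rho> x + L * window_dist W d x y))"

text \<open>
  If \<open>t\<close> is close to 0 or 1, then it is not near the threshold \<open>1/2\<close>; the tent function measures
  nearness to the threshold.
\<close>

lemma tent_le: "(u :: real) = 0 \<or> u = 1 \<Longrightarrow> max 0 (1 - 4 * \<bar>t - 1 / 2\<bar>) \<le> 4 * \<bar>t - u\<bar>"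
  by (auto simp: max_def abs_if split: if_splits)

text \<open>
  Round \<open>\<phi>\<close> to finitely many values \<open>a\<close> and approximate the indicators of the level sets \<open>E a\<close> in mean by
  test functions \<open>F a\<close>. Deciding by the threshold \<open>F a x > 1/2\<close> gives a map that agrees with the
  rounded \<open>\<phi>\<close> wherever all \<open>F a\<close> are within \<open>1/2\<close> of the indicators. Its value changes between \<open>x\<close> and
  \<open>y\<close> only if some \<open>F a\<close> crosses the threshold, and then either \<open>F a x\<close> is near \<open>1/2\<close>, which is rare,
  or \<open>F a x\<close> and \<open>F a y\<close> differ substantially, which the Lipschitz bound of \<open>F a\<close> pays for.
\<close>

lemma almost_lipschitz_approx:
  assumes X: "measurably_precompact X d" and \<mu>: "\<mu> \<in> Prob (config I X)"
    and sets: "sets X = sigma_sets (space X) {U. openin (Metric_space.mtopology (space X) d) U}"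
    and Y: "measurably_precompact Y e" and \<phi>: "\<phi> \<in> measurable (config I X) Y" and \<eta>: "0 < \<eta>"
  obtains \<phi>' where "\<phi>' \<in> measurable (config I X) Y" "almost_lipschitz I X d e \<mu> \<eta> \<phi>'"
    "(\<integral>x. e (\<phi>' x) (\<phi> x) \<partial>\<mu>) \<le> \<eta>"
proof -
  let ?S = "space (config I X)"
  interpret P: prob_space \<mu> by (rule ProbD(1)[OF \<mu>])
  interpret e: Metric_space "space Y" e using Y by (simp add: measurably_precompact_def)
  have d: "Metric_space (space X) d" using X by (simp add: measurably_precompact_def)
  obtain C where C: "C > 0" "\<And>x y. x \<in> space Y \<Longrightarrow> y \<in> space Y \<Longrightarrow> e x y \<le> C"
    using measurably_precompact_bounded[OF Y] by metis
  obtain A p where A: "finite A" "A \<subseteq> space Y" "p \<in> measurable Y (count_space A)"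
    "\<And>x. x \<in> space Y \<Longrightarrow> p x \<in> A" and pe: "\<And>x. x \<in> space Y \<Longrightarrow> e x (p x) < \<eta> / 2"
    using measurably_precompactE[OF Y half_gt_zero[OF \<eta>]] by metis
  have \<phi>S: "\<phi> x \<in> space Y" if "x \<in> ?S" for x using measurable_space[OF \<phi> that] .
  define a0 where "a0 = (SOME a. a \<in> A)"
  have "A \<noteq> {}" using A(4) Y by (auto simp: measurably_precompact_def)
  then have a0: "a0 \<in> A" unfolding a0_def by (simp add: some_in_eq)
  define E where "E a = {x \<in> ?S. p (\<phi> x) = a}" for a
  have ES: "E a \<in> sets (config I X)" if "a \<in> A" for a
  proof -
    have "(\<lambda>x. p (\<phi> x)) \<in> measurable (config I X) (count_space A)" using \<phi> A(3) by (rule measurable_compose)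
    from measurable_sets[OF this, of "{a}"] show ?thesis
      using that by (simp add: E_def vimage_def Int_def conj_commute)
  qed
  \<comment> \<open>\<open>\<eta>'\<close> is chosen so that the total error \<open>4 * C * card A * \<eta>'\<close> of all \<open>F a\<close> is within the budget \<open>\<eta>\<close>\<close>
  define D where "D = 4 * C * (real (card A) + 1)"
  have D: "D > 0" using C by (simp add: D_def add_nonneg_pos)
  define \<eta>' where "\<eta>' = \<eta> / D"
  have \<eta>': "\<eta>' > 0" using \<eta> D by (simp add: \<eta>'_def)
  have "\<exists>F. window_lipschitz I X d F \<and> (\<integral>x. \<bar>F x - indicator (E a) x\<bar> \<partial>\<mu>) \<le> \<eta>'" if "a \<in> A" for a
    using approximable_event_measurable[OF X \<mu> sets ES[OF that]] \<eta>' unfolding approximable_event_def by blast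
  then obtain F where F: "\<And>a. a \<in> A \<Longrightarrow> window_lipschitz I X d (F a)"
    and FE: "\<And>a. a \<in> A \<Longrightarrow> (\<integral>x. \<bar>F a x - indicator (E a) x\<bar> \<partial>\<mu>) \<le> \<eta>'" by metis
  have mF: "F a \<in> borel_measurable (config I X)" if "a \<in> A" for a by (rule window_lipschitz_measurable[OF X F[OF that]])
  have iF: "integrable \<mu> (F a)" if "a \<in> A" for a by (rule window_lipschitz_integrable[OF X F[OF that] \<mu>])
  have iFE: "integrable \<mu> (\<lambda>x. \<bar>F a x - indicator (E a) x\<bar>)" if "a \<in> A" for a
    using iF[OF that] ES[OF that] ProbD(2)[OF \<mu>] by (auto simp: P.emeasure_eq_measure)
  \<comment> \<open>decide the value at \<open>x\<close> from the set of those \<open>a\<close> with \<open>F a x > 1/2\<close>\<close>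
  define T where "T x = {a\<in>A. F a x > 1 / 2}" for x
  define g where "g B = (if B = {} then a0 else (SOME b. b \<in> B))" for B
  define \<phi>' where "\<phi>' x = g (T x)" for x
  have g: "g B \<in> A" if "B \<subseteq> A" for B
    using that a0 by (auto simp: g_def some_in_eq subset_iff)
  have mT: "T \<in> measurable (config I X) (count_space (Pow A))"
    unfolding measurable_count_space_eq2[OF finite_Pow_iff[THEN iffD2, OF A(1)]]
  proof (intro conjI ballI)
    show "T \<in> ?S \<rightarrow> Pow A" by (auto simp: T_def)
    fix B assume "B \<in> Pow A"
    then have "T x = B \<longleftrightarrow> (\<forall>a\<in>A. (F a x > 1 / 2) = (a \<in> B))" for x
      unfolding T_def by blast
    then have "T -` {B} \<inter> ?S = {x\<in>?S. \<forall>a\<in>A. (F a x > 1 / 2) = (a \<in> B)}" by blast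
    also have "\<dots> \<in> sets (config I X)"
    proof (rule sets.sets_Collect_finite_All[OF _ A(1)])
      fix a assume "a \<in> A"
      note [measurable] = mF[OF this]
      show "{x \<in> ?S. (1 / 2 < F a x) = (a \<in> B)} \<in> sets (config I X)" by measurable
    qed
    finally show "T -` {B} \<inter> ?S \<in> sets (config I X)" .
  qed
  have mg: "g \<in> measurable (count_space (Pow A)) Y" using g A(2) by auto
  have "\<phi>' = (\<lambda>x. g (T x))" by (simp add: \<phi>'_def fun_eq_iff)
  then have m\<phi>': "\<phi>' \<in> measurable (config I X) Y" using measurable_compose[OF mT mg] by simp
  have \<phi>'A: "\<phi>' x \<in> A" for x unfolding \<phi>'_def by (rule g) (auto simp: T_def)
  have ie: "integrable \<mu> (\<lambda>x. e (\<phi>' x) (\<phi> x))"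
  proof (rule integrable_bounded[OF P.prob_space_axioms])
    show "(\<lambda>x. e (\<phi>' x) (\<phi> x)) \<in> borel_measurable \<mu>"
      unfolding Prob_measurable[OF \<mu>] by (rule dist_compose_measurable[OF Y m\<phi>' \<phi>])
    show "\<bar>e (\<phi>' x) (\<phi> x)\<bar> \<le> C" if "x \<in> space \<mu>" for x
      using C(2)[of "\<phi>' x" "\<phi> x"] \<phi>'A A(2) \<phi>S that ProbD(3)[OF \<mu>] by auto
  qed
  have sumFE: "(\<Sum>a\<in>A. \<integral>x. \<bar>F a x - indicator (E a) x\<bar> \<partial>\<mu>) \<le> card A * \<eta>'"
    using sum_mono[of A, OF FE] by simp
  have "4 * C * (card A * \<eta>') \<le> D * \<eta>'"
    using C \<eta>' by (simp add: D_def algebra_simps)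
  also have "\<dots> = \<eta>" using D by (simp add: \<eta>'_def)
  finally have budget: "4 * C * (card A * \<eta>') \<le> \<eta>" .
  have close: "e (\<phi>' x) (\<phi> x) \<le> \<eta> / 2 + 2 * C * (\<Sum>a\<in>A. \<bar>F a x - indicator (E a) x\<bar>)" if x: "x \<in> ?S" for x
  proof (cases "\<forall>a\<in>A. \<bar>F a x - indicator (E a) x\<bar> < 1 / 2")
    case True
    have "a \<in> T x \<longleftrightarrow> a = p (\<phi> x)" if a: "a \<in> A" for a
    proof (cases "a = p (\<phi> x)")
      case True': True
      then have "\<bar>F a x - 1\<bar> < 1 / 2" using True a x by (force simp: E_def)
      then have "F a x > 1 / 2" by linarith
      then show ?thesis using True' a by (simp add: T_def)
    next
      case False
      then have "\<bar>F a x\<bar> < 1 / 2" using True a x by (force simp: E_def)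
      then have "\<not> F a x > 1 / 2" by linarith
      then show ?thesis using False by (simp add: T_def)
    qed
    then have "T x = {p (\<phi> x)}" using A(4)[OF \<phi>S[OF x]] by (auto simp: T_def)
    then have "\<phi>' x = p (\<phi> x)" by (simp add: \<phi>'_def g_def)
    then have "e (\<phi>' x) (\<phi> x) \<le> \<eta> / 2" using pe[OF \<phi>S[OF x]] e.commute by (metis less_imp_le)
    moreover have "0 \<le> 2 * C * (\<Sum>a\<in>A. \<bar>F a x - indicator (E a) x\<bar>)" using C by (simp add: sum_nonneg)
    ultimately show ?thesis by linarith
  next
    case False
    then obtain a where a: "a \<in> A" "1 / 2 \<le> \<bar>F a x - indicator (E a) x\<bar>" by (meson not_less)
    then have "1 / 2 \<le> (\<Sum>a\<in>A. \<bar>F a x - indicator (E a) x\<bar>)"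
      using member_le_sum[of a A "\<lambda>a. \<bar>F a x - indicator (E a) x\<bar>"] A(1) by auto
    then have "2 * C * (1 / 2) \<le> 2 * C * (\<Sum>a\<in>A. \<bar>F a x - indicator (E a) x\<bar>)" using C by (intro mult_left_mono) auto
    moreover have "e (\<phi>' x) (\<phi> x) \<le> C" using C(2) \<phi>'A A(2) \<phi>S[OF x] by blast
    ultimately show ?thesis using \<eta> by linarith
  qed
  have "(\<integral>x. e (\<phi>' x) (\<phi> x) \<partial>\<mu>) \<le> (\<integral>x. \<eta> / 2 + 2 * C * (\<Sum>a\<in>A. \<bar>F a x - indicator (E a) x\<bar>) \<partial>\<mu>)"
    using close iFE ProbD(3)[OF \<mu>] by (intro integral_mono ie) auto
  also have "\<dots> = \<eta> / 2 + 2 * C * (\<Sum>a\<in>A. \<integral>x. \<bar>F a x - indicator (E a) x\<bar> \<partial>\<mu>)"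
    using iFE by (simp add: P.prob_space)
  also have "\<dots> \<le> \<eta> / 2 + 2 * C * (card A * \<eta>')" using sumFE C by (intro add_left_mono mult_left_mono) auto
  also have "\<dots> \<le> \<eta>" using budget by simp
  finally have L1: "(\<integral>x. e (\<phi>' x) (\<phi> x) \<partial>\<mu>) \<le> \<eta>" .
  define \<tau> where "\<tau> a x = max 0 (1 - 4 * \<bar>F a x - 1 / 2\<bar>)" for a x
  have \<tau>L: "window_lipschitz I X d (\<tau> a)" if "a \<in> A" for a
    unfolding \<tau>_def
    by (rule window_lipschitz_compose[OF d F[OF that], where K=4 and \<phi>="\<lambda>t. max 0 (1 - 4 * \<bar>t - 1 / 2\<bar>)"])
      (auto simp: max_def abs_if split: if_splits)
  define \<rho> where "\<rho> x = C * (\<Sum>a\<in>A. \<tau> a x)" for x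
  have \<rho>L: "window_lipschitz I X d \<rho>"
    unfolding \<rho>_def by (intro window_lipschitz_cmult[OF d] window_lipschitz_sum[OF d] \<tau>L)
  have "(\<integral>x. \<rho> x \<partial>\<mu>) = C * (\<Sum>a\<in>A. \<integral>x. \<tau> a x \<partial>\<mu>)"
    unfolding \<rho>_def using window_lipschitz_integrable[OF X \<tau>L \<mu>] by simp
  also have "\<dots> \<le> C * (\<Sum>a\<in>A. 4 * (\<integral>x. \<bar>F a x - indicator (E a) x\<bar> \<partial>\<mu>))"
  proof (intro mult_left_mono sum_mono)
    fix a assume a: "a \<in> A"
    have "(\<integral>x. \<tau> a x \<partial>\<mu>) \<le> (\<integral>x. 4 * \<bar>F a x - indicator (E a) x\<bar> \<partial>\<mu>)"
    proof (rule integral_mono)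
      show "integrable \<mu> (\<tau> a)" by (rule window_lipschitz_integrable[OF X \<tau>L[OF a] \<mu>])
      show "integrable \<mu> (\<lambda>x. 4 * \<bar>F a x - indicator (E a) x\<bar>)" using iFE[OF a] by simp
      show "\<tau> a x \<le> 4 * \<bar>F a x - indicator (E a) x\<bar>" for x
        unfolding \<tau>_def by (rule tent_le) (simp add: indicator_def)
    qed
    then show "(\<integral>x. \<tau> a x \<partial>\<mu>) \<le> 4 * (\<integral>x. \<bar>F a x - indicator (E a) x\<bar> \<partial>\<mu>)" by simp
  qed (use C in auto)
  also have "\<dots> = 4 * C * (\<Sum>a\<in>A. \<integral>x. \<bar>F a x - indicator (E a) x\<bar> \<partial>\<mu>)" by (simp add: sum_distrib_left[symmetric])
  also have "\<dots> \<le> 4 * C * (card A * \<eta>')" using sumFE C by (intro mult_left_mono) auto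
  finally have \<rho>i: "(\<integral>x. \<rho> x \<partial>\<mu>) \<le> \<eta>" using budget by linarith
  have "\<exists>W L. finite W \<and> W \<subseteq> I \<and> 0 \<le> L \<and> (\<forall>x\<in>?S. \<forall>y\<in>?S. \<bar>F a x - F a y\<bar> \<le> L * window_dist W d x y)" if "a \<in> A" for a
    using F[OF that] unfolding window_lipschitz_def .
  then obtain W L where W: "\<And>a. a \<in> A \<Longrightarrow> finite (W a)" "\<And>a. a \<in> A \<Longrightarrow> W a \<subseteq> I" and L: "\<And>a. a \<in> A \<Longrightarrow> 0 \<le> L a"
    and FL: "\<And>a x y. a \<in> A \<Longrightarrow> x \<in> ?S \<Longrightarrow> y \<in> ?S \<Longrightarrow> \<bar>F a x - F a y\<bar> \<le> L a * window_dist (W a) d x y" by metis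
  define W' where "W' = (\<Union>a\<in>A. W a)"
  have W': "finite W'" "W' \<subseteq> I" using W A(1) by (auto simp: W'_def)
  have lip: "e (\<phi>' x) (\<phi>' y) \<le> \<rho> x + 4 * C * sum L A * window_dist W' d x y" if xy: "x \<in> ?S" "y \<in> ?S" for x y
  proof -
    have nn: "0 \<le> (\<tau> a x + 4 * \<bar>F a x - F a y\<bar>)" for a by (simp add: \<tau>_def)
    have "e (\<phi>' x) (\<phi>' y) \<le> C * (\<Sum>a\<in>A. \<tau> a x + 4 * \<bar>F a x - F a y\<bar>)"
    proof (cases "T x = T y")
      case True
      then have "e (\<phi>' x) (\<phi>' y) = 0" using \<phi>'A[of x] \<phi>'A[of y] A(2) by (auto simp: \<phi>'_def)
      then show ?thesis using C nn by (simp add: sum_nonneg)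
    next
      case False
      then obtain a where a: "a \<in> A" "(F a x > 1 / 2) \<noteq> (F a y > 1 / 2)" by (auto simp: T_def)
      then have "\<bar>F a x - 1 / 2\<bar> \<le> \<bar>F a x - F a y\<bar>" by auto
      then have "1 \<le> \<tau> a x + 4 * \<bar>F a x - F a y\<bar>" unfolding \<tau>_def by (simp add: max_def)
      also have "\<dots> \<le> (\<Sum>a\<in>A. \<tau> a x + 4 * \<bar>F a x - F a y\<bar>)"
        using a A(1) nn by (intro member_le_sum) auto
      finally have "C * 1 \<le> C * (\<Sum>a\<in>A. \<tau> a x + 4 * \<bar>F a x - F a y\<bar>)" using C by (intro mult_left_mono) auto
      moreover have "e (\<phi>' x) (\<phi>' y) \<le> C" using C(2) \<phi>'A A(2) by blast
      ultimately show ?thesis by simp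
    qed
    also have "\<dots> \<le> C * (\<Sum>a\<in>A. \<tau> a x + 4 * (L a * window_dist W' d x y))"
    proof (intro mult_left_mono sum_mono add_left_mono)
      fix a assume a: "a \<in> A"
      have "window_dist (W a) d x y \<le> window_dist W' d x y"
        using a W'(1) by (intro window_dist_mono[OF d]) (auto simp: W'_def)
      then show "\<bar>F a x - F a y\<bar> \<le> L a * window_dist W' d x y"
        using FL[OF a xy] L[OF a] by (meson mult_left_mono order_trans)
    qed (use C in auto)
    also have "\<dots> = \<rho> x + 4 * C * sum L A * window_dist W' d x y"
      by (simp add: \<rho>_def sum.distrib sum_distrib_left sum_distrib_right algebra_simps)
    finally show ?thesis .
  qed
  have "0 \<le> 4 * C * sum L A" using C L by (simp add: sum_nonneg)
  then have "almost_lipschitz I X d e \<mu> \<eta> \<phi>'"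
    unfolding almost_lipschitz_def using \<rho>L W' \<rho>i lip by blast
  then show ?thesis using that m\<phi>' L1 by blast
qed

section \<open>Diagonal sequences\<close>

text \<open>
  Letting \<open>\<kappa>\<close> grow slowly enough, the first \<open>n\<close> rows are below \<open>1/(n+1)\<close> once the \<open>n\<close>-th parameter is
  in use.
\<close>

lemma diagonal_sequence:
  fixes a :: "nat \<Rightarrow> nat \<Rightarrow> nat \<Rightarrow> real"
  assumes nn: "\<And>j k i. 0 \<le> a j k i"
    and ev: "\<And>j \<epsilon>. 0 < \<epsilon> \<Longrightarrow> \<forall>\<^sub>F k in sequentially. \<forall>\<^sub>F i in sequentially. a j k i < \<epsilon>"
  obtains \<kappa> where "\<And>j. (\<lambda>i. a j (\<kappa> i) i) \<longlonglongrightarrow> 0"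
proof -
  have "\<exists>k N. \<forall>i\<ge>N. \<forall>j\<le>n. a j k i < 1 / Suc n" for n
  proof -
    have "\<forall>\<^sub>F k in sequentially. \<forall>j\<in>{..n}. \<forall>\<^sub>F i in sequentially. a j k i < 1 / Suc n"
      by (rule eventually_ball_finite) (auto intro: ev)
    then obtain k where "\<forall>j\<in>{..n}. \<forall>\<^sub>F i in sequentially. a j k i < 1 / Suc n"
      using eventually_happens'[OF sequentially_bot] by blast
    then have "\<forall>\<^sub>F i in sequentially. \<forall>j\<in>{..n}. a j k i < 1 / Suc n"
      by (intro eventually_ball_finite) auto
    then show ?thesis unfolding eventually_sequentially by auto
  qed
  then obtain K N where KN: "\<And>n i j. N n \<le> i \<Longrightarrow> j \<le> n \<Longrightarrow> a j (K n) i < 1 / Suc n" by metis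
  define m where "m i = Max {n. n \<le> i \<and> N n \<le> i}" for i
  have "(\<lambda>i. a j (K (m i)) i) \<longlonglongrightarrow> 0" for j
  proof (rule order_tendstoI)
    show "\<forall>\<^sub>F i in sequentially. b < a j (K (m i)) i" if "b < 0" for b
      using that nn[of j] by (auto intro!: always_eventually intro: less_le_trans)
    fix \<epsilon> :: real assume "0 < \<epsilon>"
    then obtain n0 where n0: "1 / Suc n0 < \<epsilon>" using reals_Archimedean[of \<epsilon>] by (auto simp: inverse_eq_divide)
    define n where "n = max n0 j"
    have "a j (K (m i)) i < \<epsilon>" if i: "i \<ge> max n (N n)" for i
    proof -
      have fin: "finite {n. n \<le> i \<and> N n \<le> i}" by (rule finite_subset[of _ "{..i}"]) auto
      have "n \<in> {n. n \<le> i \<and> N n \<le> i}" using i by auto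
      then have "m i \<in> {n. n \<le> i \<and> N n \<le> i}" "n \<le> m i"
        unfolding m_def using Max_in[OF fin] Max_ge[OF fin] by blast+
      then have "a j (K (m i)) i < 1 / Suc (m i)" by (intro KN) (auto simp: n_def)
      also have "\<dots> \<le> 1 / Suc n0" using \<open>n \<le> m i\<close> by (intro divide_left_mono) (auto simp: n_def)
      finally show ?thesis using n0 by linarith
    qed
    then show "\<forall>\<^sub>F i in sequentially. a j (K (m i)) i < \<epsilon>" unfolding eventually_sequentially by blast
  qed
  then show ?thesis using that[of "\<lambda>i. K (m i)"] by blast
qed

section \<open>Pushing convergence through a factor map\<close>

definition zip_config :: "'i set \<Rightarrow> ('i \<Rightarrow> 'x) \<Rightarrow> ('i \<Rightarrow> 'y) \<Rightarrow> 'i \<Rightarrow> 'x \<times> 'y" where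
  "zip_config I x y = (\<lambda>i\<in>I. (x i, y i))"

text \<open>
  The map between labellings of finite sets that corresponds to the equivariant map \<open>orbit_map\<close> of
  configurations on the group: the code \<open>\<phi>\<close> is applied to the configuration seen from each point.
\<close>

definition code_map :: "('g, 'm) monoid_scheme \<Rightarrow> 'v set \<Rightarrow> ('g \<Rightarrow> 'v \<Rightarrow> 'v) \<Rightarrow> (('g \<Rightarrow> 'x) \<Rightarrow> 'y) \<Rightarrow> ('v \<Rightarrow> 'x) \<Rightarrow> 'v \<Rightarrow> 'y" where
  "code_map G V s \<phi> x = (\<lambda>v\<in>V. \<phi> (pullback_name G s v x))"

definition orbit_map :: "('g, 'm) monoid_scheme \<Rightarrow> (('g \<Rightarrow> 'x) \<Rightarrow> 'y) \<Rightarrow> ('g \<Rightarrow> 'x) \<Rightarrow> 'g \<Rightarrow> 'y" where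
  "orbit_map G \<phi> z = (\<lambda>g\<in>carrier G. \<phi> (right_shift G g z))"

lemma zip_config_measurable:
  assumes f: "f \<in> measurable M (config I X)" and h: "h \<in> measurable M (config I Y)"
  shows "(\<lambda>x. zip_config I (f x) (h x)) \<in> measurable M (config I (X \<Otimes>\<^sub>M Y))"
  unfolding zip_config_def
proof (rule measurable_restrict)
  fix i assume i: "i \<in> I"
  note [measurable] = measurable_compose[OF f measurable_component_singleton[OF i]]
    measurable_compose[OF h measurable_component_singleton[OF i]]
  show "(\<lambda>x. (f x i, h x i)) \<in> measurable M (X \<Otimes>\<^sub>M Y)" by measurable
qed

lemma zip_config_space:
  "x \<in> space (config I X) \<Longrightarrow> y \<in> space (config I Y) \<Longrightarrow> zip_config I x y \<in> space (config I (X \<Otimes>\<^sub>M Y))"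
  by (auto simp: zip_config_def space_PiM PiE_iff space_pair_measure)

lemma code_map_measurable:
  assumes s: "\<forall>g\<in>carrier G. s g permutes V" and \<phi>: "\<phi> \<in> measurable (config (carrier G) X) Y"
  shows "code_map G V s \<phi> \<in> measurable (config V X) (config V Y)"
  unfolding code_map_def
  by (rule measurable_restrict) (rule measurable_compose[OF pullback_measurable[OF s] \<phi>])

lemma right_shift_measurable:
  assumes "group G" "g \<in> carrier G"
  shows "right_shift G g \<in> measurable (config (carrier G) X) (config (carrier G) X)"
proof -
  interpret group G by fact
  show ?thesis unfolding right_shift_def using assms(2)
    by (intro measurable_restrict measurable_component_singleton) auto
qed

lemma right_shift_space:
  "group G \<Longrightarrow> g \<in> carrier G \<Longrightarrow> z \<in> space (config (carrier G) X) \<Longrightarrow> right_shift G g z \<in> space (config (carrier G) X)"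
  by (rule measurable_space[OF right_shift_measurable])

lemma orbit_map_measurable:
  assumes "group G" and \<phi>: "\<phi> \<in> measurable (config (carrier G) X) Y"
  shows "orbit_map G \<phi> \<in> measurable (config (carrier G) X) (config (carrier G) Y)"
  unfolding orbit_map_def
  by (rule measurable_restrict) (rule measurable_compose[OF right_shift_measurable[OF assms(1)] \<phi>])

lemma pullback_apply: "g \<in> carrier G \<Longrightarrow> pullback_name G s v x g = x (s g v)"
  by (simp add: pullback_name_def)

lemma pullback_zip_config:
  assumes "\<forall>g\<in>carrier G. s g permutes V" "v \<in> V"
  shows "pullback_name G s v (zip_config V x y) = zip_config (carrier G) (pullback_name G s v x) (pullback_name G s v y)"
  using assms by (auto simp: pullback_name_def zip_config_def fun_eq_iff permutes_in_image)

lemma window_lipschitz_zip_config: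
  assumes d: "Metric_space (space X) d" and e: "Metric_space (space Y) e"
    and F: "window_lipschitz I (X \<Otimes>\<^sub>M Y) (pair_dist d e) F"
  obtains W L where "finite W" "W \<subseteq> I" "0 \<le> L"
    "\<And>z w z' w'. z \<in> space (config I X) \<Longrightarrow> w \<in> space (config I Y) \<Longrightarrow> z' \<in> space (config I X) \<Longrightarrow> w' \<in> space (config I Y) \<Longrightarrow>
      \<bar>F (zip_config I z w) - F (zip_config I z' w')\<bar> \<le> L * (window_dist W d z z' + window_dist W e w w')"
proof -
  obtain W L where W: "finite W" "W \<subseteq> I" "0 \<le> L"
    and FW: "\<And>x y. x \<in> space (config I (X \<Otimes>\<^sub>M Y)) \<Longrightarrow> y \<in> space (config I (X \<Otimes>\<^sub>M Y)) \<Longrightarrow>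
       \<bar>F x - F y\<bar> \<le> L * window_dist W (pair_dist d e) x y"
    using window_lipschitzE[OF F] by metis
  have "\<bar>F (zip_config I z w) - F (zip_config I z' w')\<bar> \<le> L * (window_dist W d z z' + window_dist W e w w')"
    if "z \<in> space (config I X)" "w \<in> space (config I Y)" "z' \<in> space (config I X)" "w' \<in> space (config I Y)" for z w z' w'
  proof -
    have "window_dist W (pair_dist d e) (zip_config I z w) (zip_config I z' w') \<le> window_dist W d z z' + window_dist W e w w'"
      unfolding window_dist_def sum.distrib[symmetric]
    proof (rule sum_mono)
      fix i assume "i \<in> W"
      then have "i \<in> I" using W by auto
      moreover have "0 \<le> d (z i) (z' i)" "0 \<le> e (w i) (w' i)" using d e by (auto simp: Metric_space.nonneg)
      ultimately show "pair_dist d e (zip_config I z w i) (zip_config I z' w' i) \<le> d (z i) (z' i) + e (w i) (w' i)"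
        by (simp add: pair_dist_def zip_config_def)
    qed
    then have "L * window_dist W (pair_dist d e) (zip_config I z w) (zip_config I z' w') \<le> L * (window_dist W d z z' + window_dist W e w w')"
      using W by (intro mult_left_mono)
    then show ?thesis using FW[OF zip_config_space[OF that(1,2)] zip_config_space[OF that(3,4)]] by linarith
  qed
  then show ?thesis using that W by blast
qed

lemma orbit_observable_integrable:
  assumes G: "group G" and X: "measurably_precompact X d" and Y: "measurably_precompact Y e"
    and \<mu>: "\<mu> \<in> Prob (config (carrier G) X)" and \<phi>: "\<phi> \<in> measurable (config (carrier G) X) Y"
    and F: "window_lipschitz (carrier G) (X \<Otimes>\<^sub>M Y) (pair_dist d e) F"
  shows "integrable \<mu> (\<lambda>z. F (zip_config (carrier G) z (orbit_map G \<phi> z)))"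
proof -
  note XY = measurably_precompact_pair[OF X Y]
  obtain C where C: "\<And>z. z \<in> space (config (carrier G) (X \<Otimes>\<^sub>M Y)) \<Longrightarrow> \<bar>F z\<bar> \<le> C"
    using window_lipschitz_bounded[OF XY F] by metis
  have m: "(\<lambda>z. zip_config (carrier G) z (orbit_map G \<phi> z)) \<in> measurable (config (carrier G) X) (config (carrier G) (X \<Otimes>\<^sub>M Y))"
    by (rule zip_config_measurable[OF measurable_ident_sets[OF refl] orbit_map_measurable[OF G \<phi>]])
  show ?thesis
  proof (rule integrable_bounded[OF ProbD(1)[OF \<mu>]])
    show "(\<lambda>z. F (zip_config (carrier G) z (orbit_map G \<phi> z))) \<in> borel_measurable \<mu>"
      unfolding Prob_measurable[OF \<mu>] by (rule measurable_compose[OF m window_lipschitz_measurable[OF XY F]])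
    show "\<bar>F (zip_config (carrier G) z (orbit_map G \<phi> z))\<bar> \<le> C" if "z \<in> space \<mu>" for z
      using C measurable_space[OF m] that ProbD(3)[OF \<mu>] by simp
  qed
qed

lemma joint_observable_measurable:
  assumes s: "\<forall>g\<in>carrier G. s g permutes V" and v: "v \<in> V"
    and T: "T \<in> measurable (config V X) (config V Y)"
  shows "(\<lambda>x. pullback_name G s v (zip_config V x (T x))) \<in> measurable (config V X) (config (carrier G) (X \<Otimes>\<^sub>M Y))"
  by (rule measurable_compose[OF zip_config_measurable[OF measurable_ident_sets[OF refl] T] pullback_measurable[OF s v]])

lemma joint_observable_integrable:
  assumes X: "measurably_precompact X d" and Y: "measurably_precompact Y e"
    and M: "M \<in> Prob (config V X)" and s: "\<forall>g\<in>carrier G. s g permutes V" and v: "v \<in> V"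
    and T: "T \<in> measurable (config V X) (config V Y)"
    and F: "window_lipschitz (carrier G) (X \<Otimes>\<^sub>M Y) (pair_dist d e) F"
  shows "integrable M (\<lambda>x. F (pullback_name G s v (zip_config V x (T x))))"
proof -
  note XY = measurably_precompact_pair[OF X Y]
  obtain C where C: "\<And>z. z \<in> space (config (carrier G) (X \<Otimes>\<^sub>M Y)) \<Longrightarrow> \<bar>F z\<bar> \<le> C"
    using window_lipschitz_bounded[OF XY F] by metis
  note m = joint_observable_measurable[OF s v T]
  show ?thesis
  proof (rule integrable_bounded[OF ProbD(1)[OF M]])
    show "(\<lambda>x. F (pullback_name G s v (zip_config V x (T x)))) \<in> borel_measurable M"
      unfolding Prob_measurable[OF M] by (rule measurable_compose[OF m window_lipschitz_measurable[OF XY F]])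
    show "\<bar>F (pullback_name G s v (zip_config V x (T x)))\<bar> \<le> C" if "x \<in> space M" for x
      using C[OF measurable_space[OF m]] that ProbD(3)[OF M] by simp
  qed
qed

text \<open>
  A sofic approximation along a subsequence. Its asymptotic multiplicativity is stated through the
  proportion of failures, because these proportions add up over the pairs of group elements from
  finite windows.
\<close>

locale approximate_action =
  fixes G :: "('g, 'm) monoid_scheme" and V :: "nat \<Rightarrow> 'v set" and \<sigma> :: "nat \<Rightarrow> 'g \<Rightarrow> 'v \<Rightarrow> 'v"
  assumes grp: "group G" and countable_G: "countable (carrier G)"
    and fin: "\<And>i. finite (V i)" and ne: "\<And>i. V i \<noteq> {}"
    and perm: "\<And>i. \<forall>g\<in>carrier G. \<sigma> i g permutes V i"
    and mult: "\<And>g h. g \<in> carrier G \<Longrightarrow> h \<in> carrier G \<Longrightarrow>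
      (\<lambda>i. real (card {v\<in>V i. \<sigma> i g (\<sigma> i h v) \<noteq> \<sigma> i (g \<otimes>\<^bsub>G\<^esub> h) v}) / real (card (V i))) \<longlonglongrightarrow> 0"

lemma sofic_subsequence:
  assumes G: "group G" "countable (carrier G)" and s: "sofic_approximation G V \<sigma>" and n: "strict_mono n"
  shows "approximate_action G (V \<circ> n) (\<sigma> \<circ> n)"
proof (rule approximate_action.intro)
  show "group G" "countable (carrier G)" by fact+
  have V: "finite (V i)" "V i \<noteq> {}" for i using s by (auto simp: sofic_approximation_def)
  then show "finite ((V \<circ> n) i)" "(V \<circ> n) i \<noteq> {}" for i by auto
  show "\<forall>g\<in>carrier G. (\<sigma> \<circ> n) i g permutes (V \<circ> n) i" for i using s by (auto simp: sofic_approximation_def)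
  fix g h assume gh: "g \<in> carrier G" "h \<in> carrier G"
  let ?p = "\<lambda>i. real (card {v \<in> V i. \<sigma> i g (\<sigma> i h v) = \<sigma> i (g \<otimes>\<^bsub>G\<^esub> h) v}) / real (card (V i))"
  let ?q = "\<lambda>i. real (card {v \<in> V i. \<sigma> i g (\<sigma> i h v) \<noteq> \<sigma> i (g \<otimes>\<^bsub>G\<^esub> h) v}) / real (card (V i))"
  have "?q i = 1 - ?p i" for i
  proof -
    have pos: "real (card (V i)) > 0" using V by (simp add: card_gt_0_iff)
    have "card (V i) = card ({v \<in> V i. \<sigma> i g (\<sigma> i h v) = \<sigma> i (g \<otimes>\<^bsub>G\<^esub> h) v} \<union> {v \<in> V i. \<sigma> i g (\<sigma> i h v) \<noteq> \<sigma> i (g \<otimes>\<^bsub>G\<^esub> h) v})"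
      by (rule arg_cong[of _ _ card]) auto
    also have "\<dots> = card {v \<in> V i. \<sigma> i g (\<sigma> i h v) = \<sigma> i (g \<otimes>\<^bsub>G\<^esub> h) v} + card {v \<in> V i. \<sigma> i g (\<sigma> i h v) \<noteq> \<sigma> i (g \<otimes>\<^bsub>G\<^esub> h) v}"
      using V by (intro card_Un_disjoint) auto
    finally show ?thesis using pos by (simp add: field_simps)
  qed
  moreover have "?p \<longlonglongrightarrow> 1" using s gh by (simp add: sofic_approximation_def)
  then have "(\<lambda>i. 1 - ?p i) \<longlonglongrightarrow> 1 - 1" by (intro tendsto_diff tendsto_const)
  ultimately have "?q \<longlonglongrightarrow> 0" by simp
  from LIMSEQ_subseq_LIMSEQ[OF this n]
  show "(\<lambda>i. real (card {v \<in> (V \<circ> n) i. (\<sigma> \<circ> n) i g ((\<sigma> \<circ> n) i h v) \<noteq> (\<sigma> \<circ> n) i (g \<otimes>\<^bsub>G\<^esub> h) v}) / real (card ((V \<circ> n) i))) \<longlonglongrightarrow> 0"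
    by (simp add: comp_def)
qed

context approximate_action
begin

text \<open>
  Let \<open>\<phi>'\<close> approximate \<open>\<phi>\<close>, and compare the joint labelling \<open>(x, code_map x)\<close> seen from a site with the
  joint configuration \<open>(z, orbit_map z)\<close>, where \<open>z\<close> is what is seen of \<open>x\<close>. They differ because \<open>V i\<close>
  carries only an approximate action. As \<open>\<phi>'\<close> is almost Lipschitz, this costs the mean of \<open>\<rho>\<close> and a
  term that vanishes with the proportion of sites where multiplicativity fails. What remains is a
  function of \<open>z\<close> that is itself almost Lipschitz, hence close to a test function \<open>f\<close>, to which the
  assumed convergence applies. Finally \<open>\<phi>'\<close> is replaced by \<open>\<phi>\<close> in the limit. In the limit
  these errors add up to at most a multiple of \<open>\<eta>\<close>, with a factor that depends on the test function \<open>F\<close>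
  alone.
\<close>

lemma joint_deviation_bound:
  assumes X: "measurably_precompact X d" and Y: "measurably_precompact Y e"
    and \<mu>: "\<mu> \<in> Prob (config (carrier G) X)"
    and inv: "\<forall>g\<in>carrier G. distr \<mu> (config (carrier G) X) (right_shift G g) = \<mu>"
    and \<phi>: "\<phi> \<in> measurable (config (carrier G) X) Y"
    and P: "\<And>i. \<mu>s i \<in> Prob (config (V i) X)" and oc: "observables_converge G X d \<mu> V \<sigma> \<mu>s"
    and F: "window_lipschitz (carrier G) (X \<Otimes>\<^sub>M Y) (pair_dist d e) F"
  shows "\<exists>K\<ge>0. \<forall>\<eta> \<phi>' \<epsilon>. \<phi>' \<in> measurable (config (carrier G) X) Y \<longrightarrow>
      almost_lipschitz (carrier G) X d e \<mu> \<eta> \<phi>' \<longrightarrow> (\<integral>x. e (\<phi>' x) (\<phi> x) \<partial>\<mu>) \<le> \<eta> \<longrightarrow> 0 < \<epsilon> \<longrightarrow>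
      (\<forall>\<^sub>F i in sequentially. deviation (V i) (\<mu>s i)
         (\<lambda>v x. F (pullback_name G (\<sigma> i) v (zip_config (V i) x (code_map G (V i) (\<sigma> i) \<phi>' x))))
         (\<integral>z. F (zip_config (carrier G) z (orbit_map G \<phi> z)) \<partial>\<mu>) < K * \<eta> + \<epsilon>)"
proof -
  let ?\<Gamma> = "carrier G" and ?S = "space (config (carrier G) X)"
  interpret group G by (rule grp)
  interpret \<mu>: prob_space \<mu> by (rule ProbD(1)[OF \<mu>])
  have d: "Metric_space (space X) d" using X by (simp add: measurably_precompact_def)
  have e: "Metric_space (space Y) e" using Y by (simp add: measurably_precompact_def)
  interpret d: Metric_space "space X" d by (rule d)
  interpret e: Metric_space "space Y" e by (rule e)
  note XY = measurably_precompact_pair[OF X Y]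
  obtain W L where W: "finite W" "W \<subseteq> ?\<Gamma>" "0 \<le> L"
    and FW: "\<And>z w z' w'. z \<in> ?S \<Longrightarrow> w \<in> space (config ?\<Gamma> Y) \<Longrightarrow> z' \<in> ?S \<Longrightarrow> w' \<in> space (config ?\<Gamma> Y) \<Longrightarrow>
      \<bar>F (zip_config ?\<Gamma> z w) - F (zip_config ?\<Gamma> z' w')\<bar> \<le> L * (window_dist W d z z' + window_dist W e w w')"
    using window_lipschitz_zip_config[OF d e F] by metis
  obtain Cd where Cd: "Cd > 0" "\<And>x y. x \<in> space X \<Longrightarrow> y \<in> space X \<Longrightarrow> d x y \<le> Cd"
    using measurably_precompact_bounded[OF X] by metis
  obtain Ce where Ce: "Ce > 0" "\<And>x y. x \<in> space Y \<Longrightarrow> y \<in> space Y \<Longrightarrow> e x y \<le> Ce"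
    using measurably_precompact_bounded[OF Y] by metis
  define c where "c = (\<integral>z. F (zip_config ?\<Gamma> z (orbit_map G \<phi> z)) \<partial>\<mu>)"
  have integral_shift: "(\<integral>z. k (right_shift G g z) \<partial>\<mu>) = (\<integral>z. k z \<partial>\<mu>)"
    if "k \<in> borel_measurable (config ?\<Gamma> X)" "g \<in> ?\<Gamma>" for k :: "_ \<Rightarrow> real" and g
  proof -
    have "right_shift G g \<in> measurable \<mu> (config ?\<Gamma> X)"
      unfolding Prob_measurable[OF \<mu>] by (rule right_shift_measurable[OF grp that(2)])
    then show ?thesis using integral_distr[of "right_shift G g" \<mu> "config ?\<Gamma> X" k] that inv by simp
  qed
  note orbit_int = orbit_observable_integrable[OF grp X Y \<mu> _ F]
  show ?thesis
  proof (intro exI[of _ "8 * L * real (card W)"] conjI allI impI)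
    show "0 \<le> 8 * L * real (card W)" using W by simp
    fix \<eta> \<epsilon> :: real and \<phi>' :: "('g \<Rightarrow> 'a) \<Rightarrow> 'b"
    assume m\<phi>': "\<phi>' \<in> measurable (config ?\<Gamma> X) Y" and al: "almost_lipschitz ?\<Gamma> X d e \<mu> \<eta> \<phi>'"
      and L1: "(\<integral>x. e (\<phi>' x) (\<phi> x) \<partial>\<mu>) \<le> \<eta>" and \<epsilon>: "0 < \<epsilon>"
    obtain \<rho> U M where \<rho>: "window_lipschitz ?\<Gamma> X d \<rho>" and U: "finite U" "U \<subseteq> ?\<Gamma>" "0 \<le> M"
      and \<rho>\<eta>: "(\<integral>x. \<rho> x \<partial>\<mu>) \<le> \<eta>"
      and al': "\<And>x y. x \<in> ?S \<Longrightarrow> y \<in> ?S \<Longrightarrow> e (\<phi>' x) (\<phi>' y) \<le> \<rho> x + M * window_dist U d x y"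
      using al unfolding almost_lipschitz_def by metis
    have shS: "right_shift G g z \<in> ?S" if "g \<in> ?\<Gamma>" "z \<in> ?S" for g z by (rule right_shift_space[OF grp that])
    have sh: "right_shift G g z h = z (h \<otimes>\<^bsub>G\<^esub> g)" if "h \<in> ?\<Gamma>" for g h and z :: "'g \<Rightarrow> 'a"
      using that by (simp add: right_shift_def)
    \<comment> \<open>the orbit of \<open>\<phi>'\<close> is almost Lipschitz, with error function \<open>\<rho>'\<close>\<close>
    define \<rho>' where "\<rho>' z = L * (\<Sum>g\<in>W. \<rho> (right_shift G g z))" for z
    have \<rho>g: "window_lipschitz ?\<Gamma> X d (\<lambda>z. \<rho> (right_shift G g z))" if g: "g \<in> ?\<Gamma>" for g
      by (rule window_lipschitz_reindex[OF d d \<rho>, where K=1 and r="\<lambda>h. h \<otimes>\<^bsub>G\<^esub> g"]) (use g shS sh in auto)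
    have \<rho>': "window_lipschitz ?\<Gamma> X d \<rho>'"
      unfolding \<rho>'_def using W by (intro window_lipschitz_cmult[OF d] window_lipschitz_sum[OF d] \<rho>g) auto
    have "(\<integral>z. \<rho>' z \<partial>\<mu>) = L * (\<Sum>g\<in>W. \<integral>z. \<rho> (right_shift G g z) \<partial>\<mu>)"
      unfolding \<rho>'_def using W window_lipschitz_integrable[OF X \<rho>g \<mu>] by (simp add: subset_iff)
    also have "(\<Sum>g\<in>W. \<integral>z. \<rho> (right_shift G g z) \<partial>\<mu>) = (\<Sum>g\<in>W. \<integral>z. \<rho> z \<partial>\<mu>)"
      using W by (intro sum.cong refl integral_shift window_lipschitz_measurable[OF X \<rho>]) auto
    also have "L * \<dots> \<le> L * (card W * \<eta>)" using W \<rho>\<eta> by (auto intro!: mult_left_mono)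
    finally have \<rho>'i: "(\<integral>z. \<rho>' z \<partial>\<mu>) \<le> L * card W * \<eta>" by simp
    define h where "h z = F (zip_config ?\<Gamma> z (orbit_map G \<phi>' z))" for z
    have orbS: "orbit_map G \<phi>' z \<in> space (config ?\<Gamma> Y)" if "z \<in> ?S" for z
      by (rule measurable_space[OF orbit_map_measurable[OF grp m\<phi>'] that])
    define U' where "U' = W \<union> (\<lambda>(k, g). k \<otimes>\<^bsub>G\<^esub> g) ` (U \<times> W)"
    have U': "finite U'" "U' \<subseteq> ?\<Gamma>" using U W by (auto simp: U'_def)
    define M' where "M' = L * (card W * (M * card U) + 1)"
    have M': "0 \<le> M'" using W U by (simp add: M'_def)
    have hL: "h z - h z' \<le> \<rho>' z + M' * window_dist U' d z z'" if z: "z \<in> ?S" "z' \<in> ?S" for z z'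
    proof -
      have "window_dist W e (orbit_map G \<phi>' z) (orbit_map G \<phi>' z') \<le>
          (\<Sum>g\<in>W. \<rho> (right_shift G g z) + M * (card U * window_dist U' d z z'))"
        unfolding window_dist_def[of W e]
      proof (rule sum_mono)
        fix g assume gW: "g \<in> W"
        then have g: "g \<in> ?\<Gamma>" using W by auto
        have "e (orbit_map G \<phi>' z g) (orbit_map G \<phi>' z' g) \<le> \<rho> (right_shift G g z) + M * window_dist U d (right_shift G g z) (right_shift G g z')"
          using al'[OF shS[OF g z(1)] shS[OF g z(2)]] g by (simp add: orbit_map_def)
        also have "window_dist U d (right_shift G g z) (right_shift G g z') \<le> (\<Sum>k\<in>U. window_dist U' d z z')"
          unfolding window_dist_def[of U]
        proof (rule sum_mono)
          fix k assume k: "k \<in> U"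
          then have "right_shift G g z k = z (k \<otimes>\<^bsub>G\<^esub> g)" "right_shift G g z' k = z' (k \<otimes>\<^bsub>G\<^esub> g)" using U sh by auto
          moreover have "k \<otimes>\<^bsub>G\<^esub> g \<in> U'" using k gW by (auto simp: U'_def)
          ultimately show "d (right_shift G g z k) (right_shift G g z' k) \<le> window_dist U' d z z'"
            unfolding window_dist_def using U'(1) member_le_sum[of "k \<otimes>\<^bsub>G\<^esub> g" U' "\<lambda>i. d (z i) (z' i)"] by simp
        qed
        finally show "e (orbit_map G \<phi>' z g) (orbit_map G \<phi>' z' g) \<le> \<rho> (right_shift G g z) + M * (card U * window_dist U' d z z')"
          using U(3) by (simp add: mult_left_mono)
      qed
      also have "\<dots> = (\<Sum>g\<in>W. \<rho> (right_shift G g z)) + card W * (M * card U) * window_dist U' d z z'"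
        by (simp add: sum.distrib)
      finally have 1: "window_dist W e (orbit_map G \<phi>' z) (orbit_map G \<phi>' z') \<le> \<dots>" .
      have 2: "window_dist W d z z' \<le> window_dist U' d z z'" using U' by (intro window_dist_mono[OF d]) (auto simp: U'_def)
      have "h z - h z' \<le> L * (window_dist W d z z' + window_dist W e (orbit_map G \<phi>' z) (orbit_map G \<phi>' z'))"
        using FW[OF z(1) orbS[OF z(1)] z(2) orbS[OF z(2)]] unfolding h_def by linarith
      also have "\<dots> \<le> L * (window_dist U' d z z' + ((\<Sum>g\<in>W. \<rho> (right_shift G g z)) + card W * (M * card U) * window_dist U' d z z'))"
        using 1 2 W by (intro mult_left_mono add_mono) auto
      also have "\<dots> = \<rho>' z + M' * window_dist U' d z z'" by (simp add: \<rho>'_def M'_def algebra_simps)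
      finally show ?thesis .
    qed
    obtain f where f: "window_lipschitz ?\<Gamma> X d f" and fh: "\<And>z. z \<in> ?S \<Longrightarrow> \<bar>h z - f z\<bar> \<le> \<rho>' z"
      using lipschitz_envelope[OF d U' M' hL] by metis
    have hi: "integrable \<mu> h" unfolding h_def by (rule orbit_int[OF m\<phi>'])
    have fi: "integrable \<mu> f" by (rule window_lipschitz_integrable[OF X f \<mu>])
    have \<rho>'int: "integrable \<mu> \<rho>'" by (rule window_lipschitz_integrable[OF X \<rho>' \<mu>])
    have "\<bar>(\<integral>z. h z \<partial>\<mu>) - (\<integral>z. f z \<partial>\<mu>)\<bar> = \<bar>\<integral>z. h z - f z \<partial>\<mu>\<bar>" using hi fi by simp
    also have "\<dots> \<le> (\<integral>z. \<bar>h z - f z\<bar> \<partial>\<mu>)" by (rule integral_abs_bound)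
    also have "\<dots> \<le> (\<integral>z. \<rho>' z \<partial>\<mu>)" using hi fi \<rho>'int fh ProbD(3)[OF \<mu>] by (intro integral_mono) auto
    finally have cf: "\<bar>(\<integral>z. h z \<partial>\<mu>) - (\<integral>z. f z \<partial>\<mu>)\<bar> \<le> L * card W * \<eta>" using \<rho>'i by linarith
    have ei: "integrable \<mu> (\<lambda>z. e (\<phi>' (right_shift G g z)) (\<phi> (right_shift G g z)))" if g: "g \<in> ?\<Gamma>" for g
    proof (rule integrable_bounded[OF \<mu>.prob_space_axioms])
      show "(\<lambda>z. e (\<phi>' (right_shift G g z)) (\<phi> (right_shift G g z))) \<in> borel_measurable \<mu>"
        unfolding Prob_measurable[OF \<mu>]
        by (intro dist_compose_measurable[OF Y] measurable_compose[OF right_shift_measurable[OF grp g]] m\<phi>' \<phi>)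
      show "\<bar>e (\<phi>' (right_shift G g z)) (\<phi> (right_shift G g z))\<bar> \<le> Ce" if "z \<in> space \<mu>" for z
        using Ce(2) measurable_space[OF m\<phi>'] measurable_space[OF \<phi>] shS[OF g] that ProbD(3)[OF \<mu>] by simp
    qed
    have "\<bar>(\<integral>z. h z \<partial>\<mu>) - c\<bar> = \<bar>\<integral>z. h z - F (zip_config ?\<Gamma> z (orbit_map G \<phi> z)) \<partial>\<mu>\<bar>"
      unfolding c_def using hi orbit_int[OF \<phi>] by simp
    also have "\<dots> \<le> (\<integral>z. \<bar>h z - F (zip_config ?\<Gamma> z (orbit_map G \<phi> z))\<bar> \<partial>\<mu>)" by (rule integral_abs_bound)
    also have "\<dots> \<le> (\<integral>z. L * (\<Sum>g\<in>W. e (\<phi>' (right_shift G g z)) (\<phi> (right_shift G g z))) \<partial>\<mu>)"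
    proof (rule integral_mono)
      show "integrable \<mu> (\<lambda>z. \<bar>h z - F (zip_config ?\<Gamma> z (orbit_map G \<phi> z))\<bar>)" using hi orbit_int[OF \<phi>] by simp
      show "integrable \<mu> (\<lambda>z. L * (\<Sum>g\<in>W. e (\<phi>' (right_shift G g z)) (\<phi> (right_shift G g z))))"
        using ei W by (intro integrable_mult_right Bochner_Integration.integrable_sum) auto
      fix z assume "z \<in> space \<mu>"
      then have z: "z \<in> ?S" using ProbD(3)[OF \<mu>] by simp
      have "window_dist W d z z = 0" unfolding window_dist_def
        using z W by (intro sum.neutral) (auto simp: config_component subset_iff)
      moreover have "window_dist W e (orbit_map G \<phi>' z) (orbit_map G \<phi> z) = (\<Sum>g\<in>W. e (\<phi>' (right_shift G g z)) (\<phi> (right_shift G g z)))"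
        unfolding window_dist_def orbit_map_def using W by (intro sum.cong) auto
      ultimately show "\<bar>h z - F (zip_config ?\<Gamma> z (orbit_map G \<phi> z))\<bar> \<le> L * (\<Sum>g\<in>W. e (\<phi>' (right_shift G g z)) (\<phi> (right_shift G g z)))"
        using FW[OF z orbS[OF z] z measurable_space[OF orbit_map_measurable[OF grp \<phi>] z]] unfolding h_def by simp
    qed
    also have "\<dots> = L * (\<Sum>g\<in>W. \<integral>z. e (\<phi>' (right_shift G g z)) (\<phi> (right_shift G g z)) \<partial>\<mu>)"
      using ei W by (simp add: subset_iff)
    also have "(\<Sum>g\<in>W. \<integral>z. e (\<phi>' (right_shift G g z)) (\<phi> (right_shift G g z)) \<partial>\<mu>) = (\<Sum>g\<in>W. \<integral>z. e (\<phi>' z) (\<phi> z) \<partial>\<mu>)"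
      using W by (intro sum.cong refl integral_shift[of "\<lambda>z. e (\<phi>' z) (\<phi> z)"] dist_compose_measurable[OF Y m\<phi>' \<phi>]) auto
    also have "L * \<dots> \<le> L * (card W * \<eta>)" using W L1 by (auto intro!: mult_left_mono)
    finally have ch: "\<bar>(\<integral>z. h z \<partial>\<mu>) - c\<bar> \<le> L * card W * \<eta>" by simp
    \<comment> \<open>sites at which the approximate action fails to be multiplicative on the relevant windows\<close>
    define bad where "bad i k g v = (if \<sigma> i k (\<sigma> i g v) \<noteq> \<sigma> i (k \<otimes>\<^bsub>G\<^esub> g) v then 1 else 0 :: real)" for i k g v
    define \<beta> where "\<beta> i v = L * M * Cd * (\<Sum>g\<in>W. \<Sum>k\<in>U. bad i k g v)" for i v
    define H where "H i v x = F (pullback_name G (\<sigma> i) v (zip_config (V i) x (code_map G (V i) (\<sigma> i) \<phi>' x)))" for i v x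
    have Hf: "\<bar>H i v x - f (pullback_name G (\<sigma> i) v x)\<bar> \<le> 2 * \<rho>' (pullback_name G (\<sigma> i) v x) + \<beta> i v"
      if v: "v \<in> V i" and x: "x \<in> space (config (V i) X)" for i v x
    proof -
      let ?z = "pullback_name G (\<sigma> i) v x"
      have sv: "\<sigma> i g v \<in> V i" if "g \<in> ?\<Gamma>" for g using perm[of i] v that by (simp add: permutes_in_image)
      have z: "?z \<in> ?S" by (rule pullback_space[OF perm v x])
      let ?w = "pullback_name G (\<sigma> i) v (code_map G (V i) (\<sigma> i) \<phi>' x)"
      have w: "?w \<in> space (config ?\<Gamma> Y)"
        by (rule pullback_space[OF perm v measurable_space[OF code_map_measurable[OF perm m\<phi>'] x]])
      have "window_dist W e (orbit_map G \<phi>' ?z) ?w \<le> (\<Sum>g\<in>W. \<rho> (right_shift G g ?z) + M * (Cd * (\<Sum>k\<in>U. bad i k g v)))"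
        unfolding window_dist_def
      proof (rule sum_mono)
        fix g assume "g \<in> W"
        then have g: "g \<in> ?\<Gamma>" using W by auto
        have zg: "pullback_name G (\<sigma> i) (\<sigma> i g v) x \<in> ?S" by (rule pullback_space[OF perm sv[OF g] x])
        have "e (orbit_map G \<phi>' ?z g) (?w g) = e (\<phi>' (right_shift G g ?z)) (\<phi>' (pullback_name G (\<sigma> i) (\<sigma> i g v) x))"
          using g sv[OF g] by (simp add: orbit_map_def pullback_apply code_map_def)
        also have "\<dots> \<le> \<rho> (right_shift G g ?z) + M * window_dist U d (right_shift G g ?z) (pullback_name G (\<sigma> i) (\<sigma> i g v) x)"
          by (rule al'[OF shS[OF g z] zg])
        also have "window_dist U d (right_shift G g ?z) (pullback_name G (\<sigma> i) (\<sigma> i g v) x) \<le> (\<Sum>k\<in>U. Cd * bad i k g v)"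
          unfolding window_dist_def
        proof (rule sum_mono)
          fix k assume "k \<in> U"
          then have k: "k \<in> ?\<Gamma>" using U by auto
          have eq: "right_shift G g ?z k = x (\<sigma> i (k \<otimes>\<^bsub>G\<^esub> g) v)" "pullback_name G (\<sigma> i) (\<sigma> i g v) x k = x (\<sigma> i k (\<sigma> i g v))"
            using k g by (simp_all add: sh pullback_name_def)
          have mem: "x (\<sigma> i (k \<otimes>\<^bsub>G\<^esub> g) v) \<in> space X" "x (\<sigma> i k (\<sigma> i g v)) \<in> space X"
            using config_component[OF shS[OF g z] k] config_component[OF zg k] eq by auto
          show "d (right_shift G g ?z k) (pullback_name G (\<sigma> i) (\<sigma> i g v) x k) \<le> Cd * bad i k g v"
            using Cd(2)[OF mem] mem unfolding eq bad_def by auto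
        qed
        finally show "e (orbit_map G \<phi>' ?z g) (?w g) \<le> \<rho> (right_shift G g ?z) + M * (Cd * (\<Sum>k\<in>U. bad i k g v))"
          using U(3) by (simp add: mult_left_mono sum_distrib_left)
      qed
      moreover have "window_dist W d ?z ?z = 0" unfolding window_dist_def
        using z W by (intro sum.neutral) (auto simp: config_component subset_iff)
      moreover have "H i v x = F (zip_config ?\<Gamma> ?z ?w)" unfolding H_def pullback_zip_config[OF perm v] ..
      ultimately have "\<bar>h ?z - H i v x\<bar> \<le> L * (\<Sum>g\<in>W. \<rho> (right_shift G g ?z) + M * (Cd * (\<Sum>k\<in>U. bad i k g v)))"
        using FW[OF z orbS[OF z] z w] mult_left_mono[OF _ W(3)] unfolding h_def by (smt (verit, best))
      also have "\<dots> = \<rho>' ?z + \<beta> i v"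
        by (simp add: \<rho>'_def \<beta>_def sum.distrib sum_distrib_left[symmetric] algebra_simps)
      finally show ?thesis using fh[OF z] by linarith
    qed
    have H_int: "integrable (\<mu>s i) (H i v)" if v: "v \<in> V i" for i v
      unfolding H_def by (rule joint_observable_integrable[OF X Y P perm v code_map_measurable[OF perm m\<phi>'] F])
    have ob_int: "integrable (\<mu>s i) (\<lambda>x. k (pullback_name G (\<sigma> i) v x))"
      if "v \<in> V i" "window_lipschitz ?\<Gamma> X d k" for i v k
      by (rule observable_integrable[OF X that(2) perm that(1) P])
    let ?Df = "\<lambda>i. deviation (V i) (\<mu>s i) (\<lambda>v x. f (pullback_name G (\<sigma> i) v x)) (\<integral>z. f z \<partial>\<mu>)"
    let ?D\<rho> = "\<lambda>i. deviation (V i) (\<mu>s i) (\<lambda>v x. \<rho>' (pullback_name G (\<sigma> i) v x)) (\<integral>z. \<rho>' z \<partial>\<mu>)"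
    define b where "b i = (\<Sum>v\<in>V i. \<beta> i v) / card (V i)" for i
    have le: "deviation (V i) (\<mu>s i) (H i) c \<le> ?Df i + 4 * ?D\<rho> i + 2 * b i + 8 * L * card W * \<eta>" for i
    proof -
      interpret mi: prob_space "\<mu>s i" by (rule ProbD(1)[OF P])
      let ?K = "\<lambda>v x. 2 * \<rho>' (pullback_name G (\<sigma> i) v x) + \<beta> i v"
      have "deviation (V i) (\<mu>s i) (H i) c \<le> ?Df i + 2 * average (V i) (\<mu>s i) ?K + 2 * \<bar>c - (\<integral>z. f z \<partial>\<mu>)\<bar>"
      proof (rule deviation_le[OF mi.prob_space_axioms fin ne H_int])
        show "integrable (\<mu>s i) (?K v)" if "v \<in> V i" for v using ob_int[OF that \<rho>'] by simp
        show "\<bar>H i v x - f (pullback_name G (\<sigma> i) v x)\<bar> \<le> ?K v x" if "v \<in> V i" "x \<in> space (\<mu>s i)" for v x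
          using Hf that ProbD(3)[OF P] by simp
      qed (use ob_int f in auto)
      moreover have "average (V i) (\<mu>s i) ?K = 2 * average (V i) (\<mu>s i) (\<lambda>v x. \<rho>' (pullback_name G (\<sigma> i) v x)) + b i"
        unfolding average_def b_def using ob_int[OF _ \<rho>']
        by (simp add: mi.prob_space sum.distrib sum_distrib_left[symmetric] add_divide_distrib)
      moreover have "average (V i) (\<mu>s i) (\<lambda>v x. \<rho>' (pullback_name G (\<sigma> i) v x)) \<le> ?D\<rho> i + L * card W * \<eta>"
        using average_deviation[OF fin ne, of i "\<mu>s i" "\<lambda>v x. \<rho>' (pullback_name G (\<sigma> i) v x)" "\<integral>z. \<rho>' z \<partial>\<mu>"] \<rho>'i by linarith
      moreover have "\<bar>c - (\<integral>z. f z \<partial>\<mu>)\<bar> \<le> 2 * (L * card W * \<eta>)" using cf ch by linarith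
      ultimately show ?thesis by (simp add: algebra_simps)
    qed
    have lim: "(\<lambda>i. L * M * Cd * (\<Sum>g\<in>W. \<Sum>k\<in>U. real (card {v\<in>V i. \<sigma> i k (\<sigma> i g v) \<noteq> \<sigma> i (k \<otimes>\<^bsub>G\<^esub> g) v}) / real (card (V i))))
        \<longlonglongrightarrow> L * M * Cd * (\<Sum>g\<in>W. \<Sum>k\<in>U. 0)"
      using U W by (intro tendsto_mult tendsto_const tendsto_sum mult) auto
    have beq: "b i = L * M * Cd * (\<Sum>g\<in>W. \<Sum>k\<in>U. real (card {v\<in>V i. \<sigma> i k (\<sigma> i g v) \<noteq> \<sigma> i (k \<otimes>\<^bsub>G\<^esub> g) v}) / real (card (V i)))" for i
    proof -
      have "(\<Sum>v\<in>V i. \<beta> i v) = L * M * Cd * (\<Sum>g\<in>W. \<Sum>k\<in>U. \<Sum>v\<in>V i. bad i k g v)"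
        unfolding \<beta>_def sum_distrib_left[symmetric]
        by (subst sum.swap, rule arg_cong[where f="\<lambda>t. L * M * Cd * t"], rule sum.cong[OF refl], rule sum.swap)
      moreover have "(\<Sum>v\<in>V i. bad i k g v) = real (card {v\<in>V i. \<sigma> i k (\<sigma> i g v) \<noteq> \<sigma> i (k \<otimes>\<^bsub>G\<^esub> g) v})" for k g
        unfolding bad_def using fin[of i] by (simp add: sum.If_cases Int_def)
      ultimately show ?thesis unfolding b_def by (simp add: sum_divide_distrib[symmetric])
    qed
    have b0: "b \<longlonglongrightarrow> 0" using lim unfolding beq[symmetric] by simp
    have D0: "?Df \<longlonglongrightarrow> 0" "?D\<rho> \<longlonglongrightarrow> 0" using oc f \<rho>' unfolding observables_converge_def by blast+
    have "(\<lambda>i. ?Df i + 4 * ?D\<rho> i + 2 * b i + 8 * L * card W * \<eta>) \<longlonglongrightarrow> 0 + 4 * 0 + 2 * 0 + 8 * L * card W * \<eta>"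
      by (intro tendsto_intros D0 b0)
    then have "\<forall>\<^sub>F i in sequentially. ?Df i + 4 * ?D\<rho> i + 2 * b i + 8 * L * card W * \<eta> < 8 * L * card W * \<eta> + \<epsilon>"
      by (rule order_tendstoD(2)) (use \<epsilon> in simp)
    then have "\<forall>\<^sub>F i in sequentially. deviation (V i) (\<mu>s i) (H i) c < 8 * L * card W * \<eta> + \<epsilon>"
      by (rule eventually_mono) (use le le_less_trans in blast)
    then show "\<forall>\<^sub>F i in sequentially. deviation (V i) (\<mu>s i)
         (\<lambda>v x. F (pullback_name G (\<sigma> i) v (zip_config (V i) x (code_map G (V i) (\<sigma> i) \<phi>' x))))
         (\<integral>z. F (zip_config (carrier G) z (orbit_map G \<phi> z)) \<partial>\<mu>) < 8 * L * real (card W) * \<eta> + \<epsilon>"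
      unfolding H_def c_def .
  qed
qed

text \<open>
  Countably many test functions suffice by density, so a diagonal sequence of accuracies makes all
  deviations vanish at once.
\<close>

lemma joint_lift:
  assumes X: "measurably_precompact X d" and Y: "measurably_precompact Y e"
    and \<mu>: "\<mu> \<in> Prob (config (carrier G) X)"
    and inv: "\<forall>g\<in>carrier G. distr \<mu> (config (carrier G) X) (right_shift G g) = \<mu>"
    and \<phi>: "\<phi> \<in> measurable (config (carrier G) X) Y"
    and P: "\<And>i. \<mu>s i \<in> Prob (config (V i) X)" and oc: "observables_converge G X d \<mu> V \<sigma> \<mu>s"
    and m: "\<And>k. \<phi>' k \<in> measurable (config (carrier G) X) Y"
    and al: "\<And>k. almost_lipschitz (carrier G) X d e \<mu> (1 / Suc k) (\<phi>' k)"
    and L1: "\<And>k. (\<integral>x. e (\<phi>' k x) (\<phi> x) \<partial>\<mu>) \<le> 1 / Suc k"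
  obtains \<kappa> where "\<And>F. window_lipschitz (carrier G) (X \<Otimes>\<^sub>M Y) (pair_dist d e) F \<Longrightarrow>
     (\<lambda>i. deviation (V i) (\<mu>s i)
         (\<lambda>v x. F (pullback_name G (\<sigma> i) v (zip_config (V i) x (code_map G (V i) (\<sigma> i) (\<phi>' (\<kappa> i)) x))))
         (\<integral>z. F (zip_config (carrier G) z (orbit_map G \<phi> z)) \<partial>\<mu>)) \<longlonglongrightarrow> 0"
proof -
  let ?\<Gamma> = "carrier G"
  note XY = measurably_precompact_pair[OF X Y]
  obtain \<F> :: "nat \<Rightarrow> _" where \<F>: "\<And>n. window_lipschitz ?\<Gamma> (X \<Otimes>\<^sub>M Y) (pair_dist d e) (\<F> n)"
    and dense: "\<And>F r. window_lipschitz ?\<Gamma> (X \<Otimes>\<^sub>M Y) (pair_dist d e) F \<Longrightarrow> 0 < r \<Longrightarrow>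
       \<exists>n. \<forall>z\<in>space (config ?\<Gamma> (X \<Otimes>\<^sub>M Y)). \<bar>F z - \<F> n z\<bar> \<le> r"
    by (rule countable_dense_window_lipschitz[OF XY countable_G]) (rule that, blast+)
  define H where "H F k i v x = F (pullback_name G (\<sigma> i) v (zip_config (V i) x (code_map G (V i) (\<sigma> i) (\<phi>' k) x)))"
    for F :: "('g \<Rightarrow> 'a \<times> 'b) \<Rightarrow> real" and k i v x
  define c where "c F = (\<integral>z. F (zip_config ?\<Gamma> z (orbit_map G \<phi> z)) \<partial>\<mu>)" for F :: "('g \<Rightarrow> 'a \<times> 'b) \<Rightarrow> real"
  define a where "a j k i = deviation (V i) (\<mu>s i) (H (\<F> j) k i) (c (\<F> j))" for j k i
  have "\<forall>\<^sub>F k in sequentially. \<forall>\<^sub>F i in sequentially. a j k i < \<epsilon>" if \<epsilon>: "0 < \<epsilon>" for j \<epsilon>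
  proof -
    obtain K where K: "\<forall>\<eta> f \<epsilon>. f \<in> measurable (config ?\<Gamma> X) Y \<longrightarrow>
      almost_lipschitz ?\<Gamma> X d e \<mu> \<eta> f \<longrightarrow> (\<integral>x. e (f x) (\<phi> x) \<partial>\<mu>) \<le> \<eta> \<longrightarrow> 0 < \<epsilon> \<longrightarrow>
      (\<forall>\<^sub>F i in sequentially. deviation (V i) (\<mu>s i)
         (\<lambda>v x. \<F> j (pullback_name G (\<sigma> i) v (zip_config (V i) x (code_map G (V i) (\<sigma> i) f x)))) (c (\<F> j)) < K * \<eta> + \<epsilon>)"
      unfolding c_def using joint_deviation_bound[OF X Y \<mu> inv \<phi> P oc \<F>[of j]] by (elim exE conjE)
    have "(\<lambda>k. K * (1 / real (Suc k))) \<longlonglongrightarrow> K * 0"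
      using LIMSEQ_inverse_real_of_nat by (intro tendsto_mult tendsto_const) (simp add: inverse_eq_divide)
    then have "\<forall>\<^sub>F k in sequentially. K * (1 / real (Suc k)) < \<epsilon> / 2"
      by (rule order_tendstoD(2)) (use \<epsilon> in simp)
    then show ?thesis
    proof (rule eventually_mono)
      fix k assume k: "K * (1 / real (Suc k)) < \<epsilon> / 2"
      have "\<forall>\<^sub>F i in sequentially. a j k i < K * (1 / real (Suc k)) + \<epsilon> / 2"
        unfolding a_def H_def using K[rule_format, OF m al L1, of "\<epsilon> / 2" k] \<epsilon> by simp
      then show "\<forall>\<^sub>F i in sequentially. a j k i < \<epsilon>"
        by (rule eventually_mono) (use k in linarith)
    qed
  qed
  note small = this
  have nn: "0 \<le> a j k i" for j k i unfolding a_def by (rule deviation_nonneg)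
  have "\<exists>\<kappa>. \<forall>j. (\<lambda>i. a j (\<kappa> i) i) \<longlonglongrightarrow> 0"
    by (rule diagonal_sequence[of a]) (use nn small in blast)+
  then obtain \<kappa> where \<kappa>: "\<And>j. (\<lambda>i. a j (\<kappa> i) i) \<longlonglongrightarrow> 0" by blast
  have "(\<lambda>i. deviation (V i) (\<mu>s i) (H F (\<kappa> i) i) (c F)) \<longlonglongrightarrow> 0"
    if F: "window_lipschitz ?\<Gamma> (X \<Otimes>\<^sub>M Y) (pair_dist d e) F" for F
  proof (rule order_tendstoI)
    show "\<forall>\<^sub>F i in sequentially. b < deviation (V i) (\<mu>s i) (H F (\<kappa> i) i) (c F)" if "b < 0" for b
      using that deviation_nonneg by (intro always_eventually allI) (rule less_le_trans)
    fix \<epsilon> :: real assume \<epsilon>: "0 < \<epsilon>"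
    \<comment> \<open>the distance to \<open>\<F> j\<close> enters the deviation four times\<close>
    obtain j where j: "\<And>z. z \<in> space (config ?\<Gamma> (X \<Otimes>\<^sub>M Y)) \<Longrightarrow> \<bar>F z - \<F> j z\<bar> \<le> \<epsilon> / 8"
      using dense[OF F, of "\<epsilon> / 8"] \<epsilon> by auto
    have le: "deviation (V i) (\<mu>s i) (H F (\<kappa> i) i) (c F) \<le> a j (\<kappa> i) i + \<epsilon> / 2" for i
    proof -
      interpret mi: prob_space "\<mu>s i" by (rule ProbD(1)[OF P])
      interpret \<mu>: prob_space \<mu> by (rule ProbD(1)[OF \<mu>])
      have "deviation (V i) (\<mu>s i) (H F (\<kappa> i) i) (c F) \<le> deviation (V i) (\<mu>s i) (H (\<F> j) (\<kappa> i) i) (c (\<F> j))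
          + 2 * average (V i) (\<mu>s i) (\<lambda>_ _. \<epsilon> / 8) + 2 * \<bar>c F - c (\<F> j)\<bar>"
      proof (rule deviation_le[OF mi.prob_space_axioms fin ne])
        fix v assume v: "v \<in> V i"
        note cm = code_map_measurable[OF perm m]
        show "integrable (\<mu>s i) (H F (\<kappa> i) i v)" "integrable (\<mu>s i) (H (\<F> j) (\<kappa> i) i v)"
          unfolding H_def by (rule joint_observable_integrable[OF X Y P perm v cm], fact F, rule joint_observable_integrable[OF X Y P perm v cm], fact \<F>)
        show "\<bar>H F (\<kappa> i) i v x - H (\<F> j) (\<kappa> i) i v x\<bar> \<le> \<epsilon> / 8" if "x \<in> space (\<mu>s i)" for x
          unfolding H_def using j measurable_space[OF joint_observable_measurable[OF perm v cm]] that ProbD(3)[OF P] by simp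
      qed auto
      moreover have "average (V i) (\<mu>s i) (\<lambda>_ _. \<epsilon> / 8) = \<epsilon> / 8"
        using fin[of i] ne[of i] by (simp add: average_def mi.prob_space)
      moreover have "\<bar>c F - c (\<F> j)\<bar> \<le> \<epsilon> / 8"
      proof -
        note int = orbit_observable_integrable[OF grp X Y \<mu> \<phi>]
        have "\<bar>c F - c (\<F> j)\<bar> = \<bar>\<integral>z. F (zip_config ?\<Gamma> z (orbit_map G \<phi> z)) - \<F> j (zip_config ?\<Gamma> z (orbit_map G \<phi> z)) \<partial>\<mu>\<bar>"
          unfolding c_def using int[OF F] int[OF \<F>] by simp
        also have "\<dots> \<le> (\<integral>z. \<bar>F (zip_config ?\<Gamma> z (orbit_map G \<phi> z)) - \<F> j (zip_config ?\<Gamma> z (orbit_map G \<phi> z))\<bar> \<partial>\<mu>)"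
          by (rule integral_abs_bound)
        also have "\<dots> \<le> (\<integral>z. \<epsilon> / 8 \<partial>\<mu>)"
        proof (rule integral_mono)
          fix z assume "z \<in> space \<mu>"
          then have z: "z \<in> space (config ?\<Gamma> X)" using ProbD(3)[OF \<mu>] by simp
          show "\<bar>F (zip_config ?\<Gamma> z (orbit_map G \<phi> z)) - \<F> j (zip_config ?\<Gamma> z (orbit_map G \<phi> z))\<bar> \<le> \<epsilon> / 8"
            by (rule j[OF zip_config_space[OF z measurable_space[OF orbit_map_measurable[OF grp \<phi>] z]]])
        qed (use int[OF F] int[OF \<F>] in auto)
        finally show ?thesis by (simp add: \<mu>.prob_space)
      qed
      moreover have "x \<le> y + \<epsilon> / 2" if "x \<le> y + 2 * p + 2 * q" "p = \<epsilon> / 8" "q \<le> \<epsilon> / 8" for x y p q :: real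
        using that by linarith
      ultimately show ?thesis unfolding a_def by blast
    qed
    have "\<forall>\<^sub>F i in sequentially. a j (\<kappa> i) i < \<epsilon> / 2" by (rule order_tendstoD(2)[OF \<kappa>]) (use \<epsilon> in simp)
    then show "\<forall>\<^sub>F i in sequentially. deviation (V i) (\<mu>s i) (H F (\<kappa> i) i) (c F) < \<epsilon>"
    proof (rule eventually_mono)
      fix i assume "a j (\<kappa> i) i < \<epsilon> / 2"
      then show "deviation (V i) (\<mu>s i) (H F (\<kappa> i) i) (c F) < \<epsilon>" using le[of i] by linarith
    qed
  qed
  then show ?thesis using that[of \<kappa>] unfolding H_def c_def by blast
qed

end

section \<open>Covering numbers under a factor map with an inverse\<close>

lemma hamming_avg_window_dist: "hamming_avg V d x y = window_dist V d x y / real (card V)"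
  by (simp add: hamming_avg_def window_dist_def)

lemma hamming_neighbourhood_measurable:
  assumes X: "measurably_precompact X d" and N: "N \<in> Prob (config V X)" and V: "finite V"
    and F: "finite F" "F \<subseteq> space (config V X)"
  shows "{y \<in> space N. \<exists>x\<in>F. hamming_avg V d x y < \<delta>} \<in> sets N"
proof (rule sets.sets_Collect_finite_Ex[OF _ F(1)])
  fix x assume "x \<in> F"
  then have x: "x \<in> space (config V X)" using F by auto
  have "(\<lambda>y. hamming_avg V d x y) \<in> borel_measurable (config V X)"
    unfolding hamming_avg_def
    using x by (intro borel_measurable_divide borel_measurable_sum borel_measurable_const
      dist_compose_measurable[OF X] measurable_const measurable_component_singleton) (auto dest: config_component)
  then have [measurable]: "(\<lambda>y. hamming_avg V d x y) \<in> borel_measurable N" unfolding Prob_measurable[OF N] .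
  show "{y \<in> space N. hamming_avg V d x y < \<delta>} \<in> sets N" by measurable
qed

text \<open>
  Finite covers of all labellings exist, so the least size in the definition of \<open>cov\<close> is attained.
\<close>

lemma cov_attained:
  assumes X: "measurably_precompact X d" and N: "N \<in> Prob (config V X)" and V: "finite V" "V \<noteq> {}"
    and \<epsilon>: "0 < \<epsilon>" and \<delta>: "0 < \<delta>"
  obtains F where "finite F" "F \<subseteq> space (config V X)" "card F = cov \<epsilon> \<delta> N (hamming_avg V d)"
    "measure N {y \<in> space N. \<exists>x\<in>F. hamming_avg V d x y < \<delta>} > 1 - \<epsilon>"
proof -
  interpret prob_space N by (rule ProbD(1)[OF N])
  have n: "real (card V) > 0" using V by (simp add: card_gt_0_iff)
  interpret W: Metric_space "space (config V X)" "window_dist V d"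
    using measurably_precompact_config[OF X V(1)] by (simp add: measurably_precompact_def)
  have "0 < \<delta> * card V" using \<delta> n by simp
  then obtain A p where A: "finite A" "A \<subseteq> space (config V X)" "p \<in> measurable (config V X) (count_space A)"
    "\<And>x. x \<in> space (config V X) \<Longrightarrow> p x \<in> A" "\<And>x. x \<in> space (config V X) \<Longrightarrow> window_dist V d x (p x) < \<delta> * card V"
    using measurably_precompactE[OF measurably_precompact_config[OF X V(1)]] by metis
  have "{y \<in> space N. \<exists>x\<in>A. hamming_avg V d x y < \<delta>} = space N"
  proof (intro equalityI subsetI)
    fix y assume y: "y \<in> space N"
    then have y': "y \<in> space (config V X)" using ProbD(3)[OF N] by simp
    have "hamming_avg V d (p y) y < \<delta>"
      unfolding hamming_avg_window_dist using A(5)[OF y'] n W.commute[of y "p y"] by (simp add: divide_less_eq)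
    then show "y \<in> {y \<in> space N. \<exists>x\<in>A. hamming_avg V d x y < \<delta>}" using A(4)[OF y'] y by blast
  qed auto
  then have "measure N {y \<in> space N. \<exists>x\<in>A. hamming_avg V d x y < \<delta>} > 1 - \<epsilon>" using \<epsilon> by (simp add: prob_space)
  then have "\<exists>F. finite F \<and> F \<subseteq> space N \<and> card F = card A \<and> measure N {y \<in> space N. \<exists>x\<in>F. hamming_avg V d x y < \<delta>} > 1 - \<epsilon>"
    using A(1,2) unfolding ProbD(3)[OF N] by blast
  then have "\<exists>F. finite F \<and> F \<subseteq> space N \<and> card F = cov \<epsilon> \<delta> N (hamming_avg V d) \<and> measure N {y \<in> space N. \<exists>x\<in>F. hamming_avg V d x y < \<delta>} > 1 - \<epsilon>"
    unfolding cov_def by (rule LeastI)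
  then show ?thesis using that ProbD(3)[OF N] by auto
qed

lemma cov_le:
  assumes "finite F" "F \<subseteq> space N" "measure N {y \<in> space N. \<exists>x\<in>F. d x y < \<delta>} > 1 - \<epsilon>"
  shows "cov \<epsilon> \<delta> N d \<le> card F"
  unfolding cov_def using assms by (intro Least_le) blast

lemma ext_log_mono: "m \<le> n \<Longrightarrow> ext_log m \<le> ext_log n"
  by (auto simp: ext_log_def)

context approximate_action
begin

text \<open>
  Let \<open>\<psi>'\<close> be an almost Lipschitz approximation of the code \<open>\<psi>\<close> of the inverse, with error \<open>\<rho>\<close>. If \<open>y\<close> lies
  within \<open>\<delta>'\<close> of \<open>T i x\<close>, then decoding \<open>y\<close> with \<open>\<psi>'\<close> gives a labelling whose distance to \<open>x\<close> is at most
  the sum of three site averages: the decoding error at \<open>T i x\<close>, the error \<open>\<rho>\<close> at \<open>T i x\<close>, and a multiple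
  of \<open>\<delta>'\<close>. The first two have small mean by the joint convergence, so they are small outside an
  event of probability at most \<open>\<epsilon>/2\<close>. Since \<open>\<rho>\<close> is charged only to \<open>T i x\<close>, the centre \<open>y\<close> of the
  ball can be arbitrary.
\<close>

lemma covering_rate_le:
  assumes X: "measurably_precompact X d" and Y: "measurably_precompact Y e"
    and setsY: "sets Y = sigma_sets (space Y) {U. openin (Metric_space.mtopology (space Y) e) U}"
    and \<mu>: "\<mu> \<in> Prob (config (carrier G) X)" and \<nu>: "\<nu> \<in> Prob (config (carrier G) Y)"
    and \<phi>: "\<phi> \<in> measurable (config (carrier G) X) Y" and \<psi>: "\<psi> \<in> measurable (config (carrier G) Y) X"
    and factor: "distr \<mu> (config (carrier G) Y) (orbit_map G \<phi>) = \<nu>"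
    and inverse: "AE z in \<mu>. \<psi> (orbit_map G \<phi> z) = z \<one>\<^bsub>G\<^esub>"
    and P: "\<And>i. \<mu>s i \<in> Prob (config (V i) X)"
    and T: "\<And>i. T i \<in> measurable (config (V i) X) (config (V i) Y)"
    and lim: "\<And>F. window_lipschitz (carrier G) (X \<Otimes>\<^sub>M Y) (pair_dist d e) F \<Longrightarrow>
      (\<lambda>i. average (V i) (\<mu>s i) (\<lambda>v x. F (pullback_name G (\<sigma> i) v (zip_config (V i) x (T i x)))))
         \<longlonglongrightarrow> (\<integral>z. F (zip_config (carrier G) z (orbit_map G \<phi> z)) \<partial>\<mu>)"
  shows "covering_rate V d \<mu>s \<le> covering_rate V e (\<lambda>i. distr (\<mu>s i) (config (V i) Y) (T i))"
proof -
  let ?\<Gamma> = "carrier G"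
  let ?\<nu>s = "\<lambda>i. distr (\<mu>s i) (config (V i) Y) (T i)"
  interpret group G by (rule grp)
  interpret \<mu>: prob_space \<mu> by (rule ProbD(1)[OF \<mu>])
  interpret \<nu>: prob_space \<nu> by (rule ProbD(1)[OF \<nu>])
  have d: "Metric_space (space X) d" using X by (simp add: measurably_precompact_def)
  have e: "Metric_space (space Y) e" using Y by (simp add: measurably_precompact_def)
  interpret d: Metric_space "space X" d by (rule d)
  interpret e: Metric_space "space Y" e by (rule e)
  note XY = measurably_precompact_pair[OF X Y]
  have xy: "Metric_space (space (X \<Otimes>\<^sub>M Y)) (pair_dist d e)" using XY by (simp add: measurably_precompact_def)
  have Tm: "T i \<in> measurable (\<mu>s i) (config (V i) Y)" for i unfolding Prob_measurable[OF P] by (rule T)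
  have \<nu>s: "?\<nu>s i \<in> Prob (config (V i) Y)" for i
    using prob_space.prob_space_distr[OF ProbD(1)[OF P] Tm] by (simp add: Prob_def)
  have key: "\<exists>\<delta>'>0. \<exists>\<epsilon>'>0. \<forall>\<^sub>F i in sequentially.
      cov \<epsilon> \<delta> (\<mu>s i) (hamming_avg (V i) d) \<le> cov \<epsilon>' \<delta>' (?\<nu>s i) (hamming_avg (V i) e)" if \<delta>: "0 < \<delta>" and \<epsilon>: "0 < \<epsilon>" for \<delta> \<epsilon>
  proof -
    \<comment> \<open>Markov's inequality below: a mean below \<open>5 * \<eta>\<close> exceeds \<open>\<delta>/2\<close> with probability below \<open>\<epsilon>/2\<close>\<close>
    define \<eta> where "\<eta> = \<epsilon> * \<delta> / 20"
    have \<eta>: "0 < \<eta>" using \<delta> \<epsilon> by (simp add: \<eta>_def)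
    obtain \<psi>' where m\<psi>': "\<psi>' \<in> measurable (config ?\<Gamma> Y) X" and al: "almost_lipschitz ?\<Gamma> Y e d \<nu> \<eta> \<psi>'"
      and L1: "(\<integral>w. d (\<psi>' w) (\<psi> w) \<partial>\<nu>) \<le> \<eta>"
      using almost_lipschitz_approx[OF Y \<nu> setsY X \<psi> \<eta>] by metis
    obtain \<rho> W L where \<rho>: "window_lipschitz ?\<Gamma> Y e \<rho>" and W: "finite W" "W \<subseteq> ?\<Gamma>" "0 \<le> L"
      and \<rho>\<eta>: "(\<integral>w. \<rho> w \<partial>\<nu>) \<le> \<eta>"
      and al': "\<And>x y. x \<in> space (config ?\<Gamma> Y) \<Longrightarrow> y \<in> space (config ?\<Gamma> Y) \<Longrightarrow> d (\<psi>' x) (\<psi>' y) \<le> \<rho> x + L * window_dist W e x y"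
      using al unfolding almost_lipschitz_def by metis
    let ?J = "space (config ?\<Gamma> (X \<Otimes>\<^sub>M Y))"
    define w where "w p = (\<lambda>g\<in>?\<Gamma>. snd (p g))" for p :: "'g \<Rightarrow> 'a \<times> 'b"
    define h where "h p = d (\<psi>' (w p)) (fst (p \<one>\<^bsub>G\<^esub>))" for p
    have wS: "w p \<in> space (config ?\<Gamma> Y)" if "p \<in> ?J" for p
      using config_component[OF that] by (auto simp: w_def space_PiM PiE_iff space_pair_measure mem_Times_iff)
    have p1: "fst (p \<one>\<^bsub>G\<^esub>) \<in> space X" if "p \<in> ?J" for p
      using config_component[OF that one_closed] by (auto simp: space_pair_measure)
    have comp: "d (fst a) (fst b) \<le> 2 * pair_dist d e a b" "e (snd a) (snd b) \<le> 2 * pair_dist d e a b" for a b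
      by (simp_all add: pair_dist_def)
    have \<rho>w: "window_lipschitz ?\<Gamma> (X \<Otimes>\<^sub>M Y) (pair_dist d e) (\<lambda>p. \<rho> (w p))"
      by (rule window_lipschitz_reindex[OF xy e \<rho>, where K=2 and r="\<lambda>g. g"]) (use wS comp in \<open>auto simp: w_def\<close>)
    have \<rho>nn: "0 \<le> \<rho> y" if y: "y \<in> space (config ?\<Gamma> Y)" for y
    proof -
      have "window_dist W e y y = 0" unfolding window_dist_def
        using y W by (intro sum.neutral) (auto simp: config_component subset_iff)
      then show ?thesis using al'[OF y y] measurable_space[OF m\<psi>' y] by simp
    qed
    let ?W = "insert \<one>\<^bsub>G\<^esub> W"
    have hL: "h p - h q \<le> \<rho> (w p) + (2 * L + 2) * window_dist ?W (pair_dist d e) p q" if p: "p \<in> ?J" and q: "q \<in> ?J" for p q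
    proof -
      have \<psi>S: "\<psi>' (w p) \<in> space X" "\<psi>' (w q) \<in> space X" using measurable_space[OF m\<psi>'] wS p q by auto
      have "h p \<le> d (\<psi>' (w p)) (\<psi>' (w q)) + (d (\<psi>' (w q)) (fst (q \<one>\<^bsub>G\<^esub>)) + d (fst (p \<one>\<^bsub>G\<^esub>)) (fst (q \<one>\<^bsub>G\<^esub>)))"
        unfolding h_def using d.triangle[OF \<psi>S p1[OF p]] d.triangle[OF \<psi>S(2) p1[OF q] p1[OF p]] d.commute[of "fst (p \<one>\<^bsub>G\<^esub>)" "fst (q \<one>\<^bsub>G\<^esub>)"] by linarith
      moreover have "d (\<psi>' (w p)) (\<psi>' (w q)) \<le> \<rho> (w p) + L * window_dist W e (w p) (w q)" by (rule al'[OF wS[OF p] wS[OF q]])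
      moreover have "L * window_dist W e (w p) (w q) \<le> L * (2 * window_dist ?W (pair_dist d e) p q)"
      proof (rule mult_left_mono[OF _ W(3)])
        have "window_dist W e (w p) (w q) \<le> (\<Sum>g\<in>W. 2 * pair_dist d e (p g) (q g))"
          unfolding window_dist_def using W comp(2) by (intro sum_mono) (auto simp: w_def)
        also have "\<dots> = 2 * window_dist W (pair_dist d e) p q" by (simp add: window_dist_def sum_distrib_left)
        also have "\<dots> \<le> 2 * window_dist ?W (pair_dist d e) p q" using W by (intro mult_left_mono window_dist_mono[OF xy]) auto
        finally show "window_dist W e (w p) (w q) \<le> 2 * window_dist ?W (pair_dist d e) p q" .
      qed
      moreover have "d (fst (p \<one>\<^bsub>G\<^esub>)) (fst (q \<one>\<^bsub>G\<^esub>)) \<le> 2 * window_dist ?W (pair_dist d e) p q"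
      proof -
        have "pair_dist d e (p \<one>\<^bsub>G\<^esub>) (q \<one>\<^bsub>G\<^esub>) \<le> window_dist ?W (pair_dist d e) p q"
          unfolding window_dist_def using W xy by (intro member_le_sum) (auto simp: Metric_space.nonneg)
        then show ?thesis using comp(1)[of "p \<one>\<^bsub>G\<^esub>" "q \<one>\<^bsub>G\<^esub>"] by linarith
      qed
      ultimately show ?thesis unfolding h_def[of q] by (simp add: algebra_simps)
    qed
    have "finite ?W" "?W \<subseteq> ?\<Gamma>" "0 \<le> 2 * L + 2" using W by auto
    from lipschitz_envelope[OF xy this hL] obtain f where f: "window_lipschitz ?\<Gamma> (X \<Otimes>\<^sub>M Y) (pair_dist d e) f"
      and fh: "\<And>p. p \<in> ?J \<Longrightarrow> \<bar>h p - f p\<bar> \<le> \<rho> (w p)" by metis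
    \<comment> \<open>a test function that dominates both the decoding error and the modulus of the decoder\<close>
    define F where "F p = f p + 2 * \<rho> (w p)" for p
    have F: "window_lipschitz ?\<Gamma> (X \<Otimes>\<^sub>M Y) (pair_dist d e) F"
      unfolding F_def by (intro window_lipschitz_add[OF xy f] window_lipschitz_cmult[OF xy \<rho>w])
    have Fge: "h p + \<rho> (w p) \<le> F p" and Fle: "F p \<le> h p + 3 * \<rho> (w p)" if "p \<in> ?J" for p
      using fh[OF that] by (auto simp: F_def abs_le_iff)
    have Fnn: "0 \<le> F p" if "p \<in> ?J" for p
      using Fge[OF that] \<rho>nn[OF wS[OF that]] d.nonneg[of "\<psi>' (w p)" "fst (p \<one>\<^bsub>G\<^esub>)"] unfolding h_def by linarith
    let ?Z = "\<lambda>z. zip_config ?\<Gamma> z (orbit_map G \<phi> z)"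
    have mO: "orbit_map G \<phi> \<in> measurable \<mu> (config ?\<Gamma> Y)"
      unfolding Prob_measurable[OF \<mu>] by (rule orbit_map_measurable[OF grp \<phi>])
    have wZ: "w (?Z z) = orbit_map G \<phi> z" and ZJ: "?Z z \<in> ?J" if z: "z \<in> space \<mu>" for z
    proof -
      show "w (?Z z) = orbit_map G \<phi> z" by (auto simp: w_def zip_config_def orbit_map_def fun_eq_iff)
      show "?Z z \<in> ?J" using z measurable_space[OF mO z] ProbD(3)[OF \<mu>] by (intro zip_config_space) auto
    qed
    have transfer: "(\<integral>z. k (orbit_map G \<phi> z) \<partial>\<mu>) = (\<integral>y. k y \<partial>\<nu>)"
      if "k \<in> borel_measurable (config ?\<Gamma> Y)" for k :: "_ \<Rightarrow> real"
      using integral_distr[OF mO that] factor by simp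
    obtain C where C: "\<And>x y. x \<in> space X \<Longrightarrow> y \<in> space X \<Longrightarrow> d x y \<le> C" using measurably_precompact_bounded[OF X] by metis
    have md: "(\<lambda>y. d (\<psi>' y) (\<psi> y)) \<in> borel_measurable (config ?\<Gamma> Y)" by (rule dist_compose_measurable[OF X m\<psi>' \<psi>])
    have di: "integrable \<mu> (\<lambda>z. d (\<psi>' (orbit_map G \<phi> z)) (\<psi> (orbit_map G \<phi> z)))"
    proof (rule integrable_bounded[OF \<mu>.prob_space_axioms measurable_compose[OF mO md]])
      show "\<bar>d (\<psi>' (orbit_map G \<phi> z)) (\<psi> (orbit_map G \<phi> z))\<bar> \<le> C" if "z \<in> space \<mu>" for z
        using C measurable_space[OF m\<psi>' measurable_space[OF mO that]] measurable_space[OF \<psi> measurable_space[OF mO that]] by simp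
    qed
    have \<rho>i: "integrable \<mu> (\<lambda>z. \<rho> (orbit_map G \<phi> z))"
    proof -
      have "integrable \<nu> \<rho>" by (rule window_lipschitz_integrable[OF Y \<rho> \<nu>])
      then show ?thesis unfolding factor[symmetric] by (rule integrable_distr[OF mO])
    qed
    have "(\<integral>z. F (?Z z) \<partial>\<mu>) \<le> (\<integral>z. d (\<psi>' (orbit_map G \<phi> z)) (\<psi> (orbit_map G \<phi> z)) + 3 * \<rho> (orbit_map G \<phi> z) \<partial>\<mu>)"
    proof (rule integral_mono_AE)
      show "integrable \<mu> (\<lambda>z. F (?Z z))" by (rule orbit_observable_integrable[OF grp X Y \<mu> \<phi> F])
      show "integrable \<mu> (\<lambda>z. d (\<psi>' (orbit_map G \<phi> z)) (\<psi> (orbit_map G \<phi> z)) + 3 * \<rho> (orbit_map G \<phi> z))" using di \<rho>i by simp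
      show "AE z in \<mu>. F (?Z z) \<le> d (\<psi>' (orbit_map G \<phi> z)) (\<psi> (orbit_map G \<phi> z)) + 3 * \<rho> (orbit_map G \<phi> z)"
        using inverse AE_space
      proof eventually_elim
        case (elim z)
        have "h (?Z z) = d (\<psi>' (orbit_map G \<phi> z)) (\<psi> (orbit_map G \<phi> z))"
          unfolding h_def wZ[OF elim(2)] elim(1) by (simp add: zip_config_def)
        then show ?case using Fle[OF ZJ[OF elim(2)]] wZ[OF elim(2)] by simp
      qed
    qed
    also have "\<dots> = (\<integral>y. d (\<psi>' y) (\<psi> y) \<partial>\<nu>) + 3 * (\<integral>y. \<rho> y \<partial>\<nu>)"
      using di \<rho>i transfer[OF md] transfer[OF window_lipschitz_measurable[OF Y \<rho>]] by simp
    also have "\<dots> < 5 * \<eta>" using L1 \<rho>\<eta> \<eta> by linarith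
    finally have small: "\<forall>\<^sub>F i in sequentially. average (V i) (\<mu>s i) (\<lambda>v x. F (pullback_name G (\<sigma> i) v (zip_config (V i) x (T i x)))) < 5 * \<eta>"
      using order_tendstoD(2)[OF lim[OF F]] by blast
    \<comment> \<open>\<open>\<delta>'\<close> is chosen so that the Lipschitz part of the decoder moves points by at most \<open>\<delta>/2\<close>\<close>
    define Q where "Q = L * card W + 1"
    have Q: "0 < Q" using W by (simp add: Q_def add_nonneg_pos)
    define \<delta>' where "\<delta>' = \<delta> / (2 * Q)"
    have \<delta>': "0 < \<delta>'" using \<delta> Q by (simp add: \<delta>'_def)
    have "L * card W * \<delta>' \<le> Q * \<delta>'" using \<delta>' unfolding Q_def by (intro mult_right_mono) auto
    also have "\<dots> = \<delta> / 2" using Q by (simp add: \<delta>'_def)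
    finally have L\<delta>': "L * card W * \<delta>' \<le> \<delta> / 2" .
    have "cov \<epsilon> \<delta> (\<mu>s i) (hamming_avg (V i) d) \<le> cov (\<epsilon> / 2) \<delta>' (?\<nu>s i) (hamming_avg (V i) e)"
      if sm: "average (V i) (\<mu>s i) (\<lambda>v x. F (pullback_name G (\<sigma> i) v (zip_config (V i) x (T i x)))) < 5 * \<eta>" for i
    proof -
      interpret mi: prob_space "\<mu>s i" by (rule ProbD(1)[OF P])
      have n: "real (card (V i)) > 0" using fin ne by (simp add: card_gt_0_iff)
      have sp: "space (\<mu>s i) = space (config (V i) X)" by (rule ProbD(3)[OF P])
      obtain A where A: "finite A" "A \<subseteq> space (config (V i) Y)" "card A = cov (\<epsilon> / 2) \<delta>' (?\<nu>s i) (hamming_avg (V i) e)"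
        and A1: "measure (?\<nu>s i) {y \<in> space (?\<nu>s i). \<exists>x\<in>A. hamming_avg (V i) e x y < \<delta>'} > 1 - \<epsilon> / 2"
        by (rule cov_attained[OF Y \<nu>s[of i] fin ne half_gt_zero[OF \<epsilon>] \<delta>'])
      let ?s = "\<sigma> i \<one>\<^bsub>G\<^esub>"
      have s1: "?s permutes V i" using perm[of i] by simp
      \<comment> \<open>the identity of the group acts on \<open>V i\<close> by some permutation \<open>?s\<close>, so the identity coordinate seen
        from the site \<open>u\<close> is the label at \<open>?s u\<close>; hence the inverse of \<open>?s\<close> in the decoder\<close>
      define D where "D y = (\<lambda>v\<in>V i. \<psi>' (pullback_name G (\<sigma> i) (inv_into UNIV ?s v) y))" for y
      have invV: "inv_into UNIV ?s v \<in> V i" if "v \<in> V i" for v using permutes_inv[OF s1] that by (simp add: permutes_in_image)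
      have DS: "D y \<in> space (config (V i) X)" if "y \<in> space (config (V i) Y)" for y
        using measurable_space[OF m\<psi>' pullback_space[OF perm invV that]] by (auto simp: D_def space_PiM)
      define K where "K x = (\<Sum>v\<in>V i. F (pullback_name G (\<sigma> i) v (zip_config (V i) x (T i x)))) / real (card (V i))" for x
      have Fint: "integrable (\<mu>s i) (\<lambda>x. F (pullback_name G (\<sigma> i) v (zip_config (V i) x (T i x))))" if "v \<in> V i" for v
        by (rule joint_observable_integrable[OF X Y P perm that T F])
      have Kint: "integrable (\<mu>s i) K" unfolding K_def using Fint by simp
      have TS: "T i x \<in> space (config (V i) Y)" if "x \<in> space (\<mu>s i)" for x using measurable_space[OF Tm that] .
      have pJ: "pullback_name G (\<sigma> i) v (zip_config (V i) x (T i x)) \<in> ?J" if "v \<in> V i" "x \<in> space (\<mu>s i)" for v x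
        using measurable_space[OF joint_observable_measurable[OF perm that(1) T]] that(2) sp by simp
      have Knn: "0 \<le> K x" if "x \<in> space (\<mu>s i)" for x
        unfolding K_def using Fnn pJ that by (intro divide_nonneg_nonneg sum_nonneg) auto
      have "measure (\<mu>s i) {x\<in>space (\<mu>s i). \<delta> / 2 \<le> K x} \<le> (\<integral>x. K x \<partial>\<mu>s i) / (\<delta> / 2)"
        using Kint Knn \<delta> by (intro integral_Markov_inequality_measure[where A="{}"]) auto
      also have "(\<integral>x. K x \<partial>\<mu>s i) = average (V i) (\<mu>s i) (\<lambda>v x. F (pullback_name G (\<sigma> i) v (zip_config (V i) x (T i x))))"
        unfolding K_def using Fint by (intro average_eq_integral[symmetric]) auto
      also have "\<dots> / (\<delta> / 2) < 5 * \<eta> / (\<delta> / 2)" using sm \<delta> by (intro divide_strict_right_mono) auto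
      also have "\<dots> = \<epsilon> / 2" using \<delta> by (simp add: \<eta>_def)
      finally have bad: "measure (\<mu>s i) {x\<in>space (\<mu>s i). \<delta> / 2 \<le> K x} < \<epsilon> / 2" .
      have decode: "hamming_avg (V i) d (D y) x < \<delta>"
        if x: "x \<in> space (\<mu>s i)" and y: "y \<in> space (config (V i) Y)" and Kx: "K x < \<delta> / 2" and near: "hamming_avg (V i) e y (T i x) < \<delta>'" for x y
      proof -
        have x': "x \<in> space (config (V i) X)" using x sp by simp
        have "(\<Sum>v\<in>V i. d (D y v) (x v)) = (\<Sum>u\<in>V i. d (D y (?s u)) (x (?s u)))"
          using sum.reindex_bij_betw[OF permutes_imp_bij[OF s1], of "\<lambda>v. d (D y v) (x v)"] by simp
        also have "\<dots> \<le> (\<Sum>u\<in>V i. F (pullback_name G (\<sigma> i) u (zip_config (V i) x (T i x)))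
            + L * window_dist W e (pullback_name G (\<sigma> i) u (T i x)) (pullback_name G (\<sigma> i) u y))"
        proof (rule sum_mono)
          fix u assume u: "u \<in> V i"
          let ?p = "pullback_name G (\<sigma> i) u (zip_config (V i) x (T i x))"
          have pT: "pullback_name G (\<sigma> i) u (T i x) \<in> space (config ?\<Gamma> Y)" and py: "pullback_name G (\<sigma> i) u y \<in> space (config ?\<Gamma> Y)"
            by (rule pullback_space[OF perm u TS[OF x]], rule pullback_space[OF perm u y])
          have su: "?s u \<in> V i" using s1 u by (simp add: permutes_in_image)
          have Du: "D y (?s u) = \<psi>' (pullback_name G (\<sigma> i) u y)" using su permutes_inverses(2)[OF s1] by (simp add: D_def)
          have wp: "w ?p = pullback_name G (\<sigma> i) u (T i x)" and fp: "fst (?p \<one>\<^bsub>G\<^esub>) = x (?s u)"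
            unfolding pullback_zip_config[OF perm u] by (auto simp: w_def zip_config_def pullback_name_def fun_eq_iff)
          have \<psi>S: "\<psi>' (pullback_name G (\<sigma> i) u y) \<in> space X" "\<psi>' (pullback_name G (\<sigma> i) u (T i x)) \<in> space X"
            using measurable_space[OF m\<psi>'] pT py by auto
          have xs: "x (?s u) \<in> space X" by (rule config_component[OF x' su])
          have "d (D y (?s u)) (x (?s u)) \<le> d (\<psi>' (pullback_name G (\<sigma> i) u (T i x))) (\<psi>' (pullback_name G (\<sigma> i) u y)) + h ?p"
            using d.triangle[OF \<psi>S xs] d.commute[of "\<psi>' (pullback_name G (\<sigma> i) u y)" "\<psi>' (pullback_name G (\<sigma> i) u (T i x))"]
            unfolding h_def wp fp Du by linarith
          also have "d (\<psi>' (pullback_name G (\<sigma> i) u (T i x))) (\<psi>' (pullback_name G (\<sigma> i) u y)) \<le> \<rho> (w ?p) + L * window_dist W e (pullback_name G (\<sigma> i) u (T i x)) (pullback_name G (\<sigma> i) u y)"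
            unfolding wp by (rule al'[OF pT py])
          finally show "d (D y (?s u)) (x (?s u)) \<le> F ?p + L * window_dist W e (pullback_name G (\<sigma> i) u (T i x)) (pullback_name G (\<sigma> i) u y)"
            using Fge[OF pJ[OF u x]] by linarith
        qed
        also have "\<dots> = card (V i) * K x + L * (card W * window_dist (V i) e (T i x) y)"
          unfolding sum.distrib sum_distrib_left[symmetric] sum_window_dist_pullback[OF perm W(2)] K_def using n by simp
        also have "window_dist (V i) e (T i x) y = card (V i) * hamming_avg (V i) e y (T i x)"
          using n e.commute by (simp add: hamming_avg_def window_dist_def)
        finally have "(\<Sum>v\<in>V i. d (D y v) (x v)) \<le> card (V i) * (K x + L * card W * hamming_avg (V i) e y (T i x))"
          by (simp add: algebra_simps)
        then have "hamming_avg (V i) d (D y) x \<le> K x + L * card W * hamming_avg (V i) e y (T i x)"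
          unfolding hamming_avg_def using n by (simp add: divide_le_eq mult.commute)
        also have "L * card W * hamming_avg (V i) e y (T i x) \<le> L * card W * \<delta>'"
          using near W by (intro mult_left_mono) auto
        finally show ?thesis using Kx L\<delta>' by linarith
      qed
      let ?C = "{y \<in> space (?\<nu>s i). \<exists>x\<in>A. hamming_avg (V i) e x y < \<delta>'}"
      let ?B = "{x\<in>space (\<mu>s i). \<delta> / 2 \<le> K x}"
      let ?N = "{x \<in> space (\<mu>s i). \<exists>y\<in>D ` A. hamming_avg (V i) d y x < \<delta>}"
      have Cs: "?C \<in> sets (?\<nu>s i)" by (rule hamming_neighbourhood_measurable[OF Y \<nu>s fin A(1,2)])
      have DA: "finite (D ` A)" "D ` A \<subseteq> space (config (V i) X)" using A DS by auto
      have Ns: "?N \<in> sets (\<mu>s i)" by (rule hamming_neighbourhood_measurable[OF X P fin DA])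
      have Bs: "?B \<in> sets (\<mu>s i)" using borel_measurable_integrable[OF Kint] by measurable
      have TC: "T i -` ?C \<inter> space (\<mu>s i) \<in> sets (\<mu>s i)" by (rule measurable_sets[OF Tm]) (use Cs in simp)
      have "T i -` ?C \<inter> space (\<mu>s i) \<subseteq> ?N \<union> ?B"
      proof
        fix x assume "x \<in> T i -` ?C \<inter> space (\<mu>s i)"
        then obtain y where x: "x \<in> space (\<mu>s i)" and y: "y \<in> A" "hamming_avg (V i) e y (T i x) < \<delta>'" by auto
        show "x \<in> ?N \<union> ?B"
        proof (cases "K x < \<delta> / 2")
          case True
          have "hamming_avg (V i) d (D y) x < \<delta>" using decode[OF x _ True y(2)] y(1) A(2) by auto
          then show ?thesis using x y(1) by blast
        next
          case False then show ?thesis using x by simp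
        qed
      qed
      then have "mi.prob (T i -` ?C \<inter> space (\<mu>s i)) \<le> mi.prob (?N \<union> ?B)"
        using Ns Bs by (intro mi.finite_measure_mono) auto
      also have "\<dots> \<le> mi.prob ?N + mi.prob ?B" using Ns Bs by (intro measure_Un_le) auto
      finally have "1 - \<epsilon> / 2 < mi.prob ?N + mi.prob ?B"
        using A1 measure_distr[OF Tm, of ?C] Cs by simp
      then have "1 - \<epsilon> < mi.prob ?N" using bad by linarith
      then have "cov \<epsilon> \<delta> (\<mu>s i) (hamming_avg (V i) d) \<le> card (D ` A)"
        using DA sp by (intro cov_le) auto
      also have "\<dots> \<le> card A" by (rule card_image_le[OF A(1)])
      finally show ?thesis using A(3) by simp
    qed
    then have "\<forall>\<^sub>F i in sequentially. cov \<epsilon> \<delta> (\<mu>s i) (hamming_avg (V i) d) \<le> cov (\<epsilon> / 2) \<delta>' (?\<nu>s i) (hamming_avg (V i) e)"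
      using small by (rule eventually_mono[rotated])
    then show ?thesis using \<delta>' half_gt_zero[OF \<epsilon>] by blast
  qed
  show ?thesis
    unfolding covering_rate_def
  proof (rule SUP_least)
    fix q :: "real \<times> real" assume "q \<in> {0<..} \<times> {0<..}"
    then obtain \<delta> \<epsilon> where q: "q = (\<delta>, \<epsilon>)" and pos: "0 < \<delta>" "0 < \<epsilon>" by auto
    then obtain \<delta>' \<epsilon>' where p: "\<delta>' > 0" "\<epsilon>' > 0" and ev: "\<forall>\<^sub>F i in sequentially.
      cov \<epsilon> \<delta> (\<mu>s i) (hamming_avg (V i) d) \<le> cov \<epsilon>' \<delta>' (?\<nu>s i) (hamming_avg (V i) e)"
      using key[OF pos] by blast
    have "limsup (\<lambda>i. ext_log (cov \<epsilon> \<delta> (\<mu>s i) (hamming_avg (V i) d)) / ereal (real (card (V i))))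
       \<le> limsup (\<lambda>i. ext_log (cov \<epsilon>' \<delta>' (?\<nu>s i) (hamming_avg (V i) e)) / ereal (real (card (V i))))"
    proof (rule Limsup_mono, rule eventually_mono[OF ev])
      fix i assume "cov \<epsilon> \<delta> (\<mu>s i) (hamming_avg (V i) d) \<le> cov \<epsilon>' \<delta>' (?\<nu>s i) (hamming_avg (V i) e)"
      then show "ext_log (cov \<epsilon> \<delta> (\<mu>s i) (hamming_avg (V i) d)) / ereal (real (card (V i)))
         \<le> ext_log (cov \<epsilon>' \<delta>' (?\<nu>s i) (hamming_avg (V i) e)) / ereal (real (card (V i)))"
        using fin[of i] ne[of i] by (intro ereal_divide_right_mono ext_log_mono) (auto simp: card_gt_0_iff)
    qed
    also have "\<dots> \<le> (SUP (\<delta>, \<epsilon>)\<in>{0<..} \<times> {0<..}. limsup (\<lambda>i. ext_log (cov \<epsilon> \<delta> (?\<nu>s i) (hamming_avg (V i) e)) / ereal (real (card (V i)))))"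
      using p by (intro SUP_upper2[of "(\<delta>', \<epsilon>')"]) auto
    finally show "(case q of (\<delta>, \<epsilon>) \<Rightarrow> limsup (\<lambda>i. ext_log (cov \<epsilon> \<delta> (\<mu>s i) (hamming_avg (V i) d)) / ereal (real (card (V i)))))
       \<le> (SUP (\<delta>, \<epsilon>)\<in>{0<..} \<times> {0<..}. limsup (\<lambda>i. ext_log (cov \<epsilon> \<delta> (?\<nu>s i) (hamming_avg (V i) e)) / ereal (real (card (V i)))))"
      unfolding q by simp
  qed
qed

end

section \<open>Products of a measure with itself\<close>

definition fst_config :: "'i set \<Rightarrow> ('i \<Rightarrow> 'x \<times> 'y) \<Rightarrow> 'i \<Rightarrow> 'x" where
  "fst_config I z = (\<lambda>i\<in>I. fst (z i))"

definition snd_config :: "'i set \<Rightarrow> ('i \<Rightarrow> 'x \<times> 'y) \<Rightarrow> 'i \<Rightarrow> 'y" where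
  "snd_config I z = (\<lambda>i\<in>I. snd (z i))"

lemma fst_config_measurable: "fst_config I \<in> measurable (config I (X \<Otimes>\<^sub>M Y)) (config I X)"
  unfolding fst_config_def
proof (rule measurable_restrict)
  fix i assume "i \<in> I"
  note [measurable] = measurable_component_singleton[OF this, of "\<lambda>_. X \<Otimes>\<^sub>M Y"]
  show "(\<lambda>z. fst (z i)) \<in> measurable (config I (X \<Otimes>\<^sub>M Y)) X" by measurable
qed

lemma snd_config_measurable: "snd_config I \<in> measurable (config I (X \<Otimes>\<^sub>M Y)) (config I Y)"
  unfolding snd_config_def
proof (rule measurable_restrict)
  fix i assume "i \<in> I"
  note [measurable] = measurable_component_singleton[OF this, of "\<lambda>_. X \<Otimes>\<^sub>M Y"]
  show "(\<lambda>z. snd (z i)) \<in> measurable (config I (X \<Otimes>\<^sub>M Y)) Y" by measurable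
qed

lemma restrict_config: "x \<in> space (config I X) \<Longrightarrow> (\<lambda>i\<in>I. x i) = x"
  by (auto simp: space_PiM PiE_iff extensional_restrict)

lemma fst_zip_config:
  assumes "x \<in> space (config I X)" shows "fst_config I (zip_config I x y) = x"
proof -
  have "fst_config I (zip_config I x y) = (\<lambda>i\<in>I. x i)"
    unfolding fst_config_def zip_config_def by (rule restrict_ext) simp
  then show ?thesis using restrict_config[OF assms] by simp
qed

lemma snd_zip_config:
  assumes "y \<in> space (config I Y)" shows "snd_config I (zip_config I x y) = y"
proof -
  have "snd_config I (zip_config I x y) = (\<lambda>i\<in>I. y i)"
    unfolding snd_config_def zip_config_def by (rule restrict_ext) simp
  then show ?thesis using restrict_config[OF assms] by simp
qed

lemma zip_fst_snd_config:
  assumes "z \<in> space (config I (X \<Otimes>\<^sub>M Y))"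
  shows "zip_config I (fst_config I z) (snd_config I z) = z"
proof -
  have "zip_config I (fst_config I z) (snd_config I z) = (\<lambda>i\<in>I. z i)"
    unfolding zip_config_def fst_config_def snd_config_def by (rule restrict_ext) simp
  then show ?thesis using restrict_config[OF assms] by simp
qed

lemma distr_in_Prob:
  assumes "M \<in> Prob A" "T \<in> measurable A B"
  shows "distr M B T \<in> Prob B"
  using prob_space.prob_space_distr[OF ProbD(1)[OF assms(1)], of T B] assms(2) Prob_measurable[OF assms(1), of B]
  by (simp add: Prob_def)

lemma pair_zip_measurable:
  "(\<lambda>(x, y). zip_config I x y) \<in> measurable (config I X \<Otimes>\<^sub>M config I Y) (config I (X \<Otimes>\<^sub>M Y))"
  unfolding case_prod_beta by (rule zip_config_measurable[OF measurable_fst measurable_snd])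

lemma paired_eq: "paired I X M N = distr (M \<Otimes>\<^sub>M N) (config I (X \<Otimes>\<^sub>M X)) (\<lambda>(x, y). zip_config I x y)"
  by (simp add: paired_def zip_config_def)

lemma pair_sets:
  assumes "M \<in> Prob (config I X)" "N \<in> Prob (config I X)"
  shows "measurable (M \<Otimes>\<^sub>M N) = measurable (config I X \<Otimes>\<^sub>M config I X)"
  using assms by (intro ext measurable_cong_sets sets_pair_measure_cong) (auto simp: Prob_def)

lemma paired_in_Prob:
  assumes M: "M \<in> Prob (config I X)" and N: "N \<in> Prob (config I X)"
  shows "paired I X M N \<in> Prob (config I (X \<Otimes>\<^sub>M X))"
proof -
  interpret M: prob_space M by (rule ProbD(1)[OF M])
  interpret N: prob_space N by (rule ProbD(1)[OF N])
  interpret MN: pair_prob_space M N ..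
  have "(\<lambda>(x, y). zip_config I x y) \<in> measurable (M \<Otimes>\<^sub>M N) (config I (X \<Otimes>\<^sub>M X))"
    unfolding pair_sets[OF M N] by (rule pair_zip_measurable)
  then show ?thesis unfolding paired_eq Prob_def using MN.P.prob_space_distr by auto
qed

lemma distr_paired:
  assumes M: "M \<in> Prob (config I X)" and N: "N \<in> Prob (config I X)"
    and T2: "T2 \<in> measurable (config I (X \<Otimes>\<^sub>M X)) B"
  shows "distr (paired I X M N) B T2 = distr (M \<Otimes>\<^sub>M N) B (\<lambda>(x, y). T2 (zip_config I x y))"
proof -
  have m: "(\<lambda>(x, y). zip_config I x y) \<in> measurable (M \<Otimes>\<^sub>M N) (config I (X \<Otimes>\<^sub>M X))"
    unfolding pair_sets[OF M N] by (rule pair_zip_measurable)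
  show ?thesis unfolding paired_eq distr_distr[OF T2 m] by (simp add: comp_def case_prod_unfold)
qed

lemma paired_marginals:
  assumes M: "M \<in> Prob (config I X)" and N: "N \<in> Prob (config I X)"
  shows "distr (paired I X M N) (config I X) (fst_config I) = M"
    and "distr (paired I X M N) (config I X) (snd_config I) = N"
proof -
  interpret M: prob_space M by (rule ProbD(1)[OF M])
  interpret N: prob_space N by (rule ProbD(1)[OF N])
  interpret MN: pair_prob_space M N ..
  have sp: "space M = space (config I X)" "space N = space (config I X)" using ProbD(3) M N by auto
  have "distr (paired I X M N) (config I X) (fst_config I) = distr (M \<Otimes>\<^sub>M N) M fst"
    unfolding distr_paired[OF M N fst_config_measurable]
    using ProbD(2)[OF M] sp by (intro distr_cong) (auto simp: space_pair_measure fst_zip_config)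
  then show "distr (paired I X M N) (config I X) (fst_config I) = M" by (simp add: N.distr_pair_fst)
  have "distr (paired I X M N) (config I X) (snd_config I) = distr (M \<Otimes>\<^sub>M N) N snd"
    unfolding distr_paired[OF M N snd_config_measurable]
    using ProbD(2)[OF N] sp by (intro distr_cong) (auto simp: space_pair_measure snd_zip_config)
  also have "\<dots> = N"
  proof (rule measure_eqI)
    fix A assume "A \<in> sets (distr (M \<Otimes>\<^sub>M N) N snd)"
    then have A: "A \<in> sets N" by simp
    have "emeasure (distr (M \<Otimes>\<^sub>M N) N snd) A = emeasure (M \<Otimes>\<^sub>M N) (space M \<times> A)"
      using A sets.sets_into_space[OF A]
      by (subst emeasure_distr) (auto intro!: arg_cong[where f="emeasure (M \<Otimes>\<^sub>M N)"] simp: space_pair_measure)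
    also have "\<dots> = emeasure N A" using A by (simp add: N.emeasure_pair_measure_Times M.emeasure_space_1)
    finally show "emeasure (distr (M \<Otimes>\<^sub>M N) N snd) A = emeasure N A" .
  qed simp
  finally show "distr (paired I X M N) (config I X) (snd_config I) = N" .
qed

text \<open>
  Pairing is functorial. With \<open>T\<close> a shift, an orbit map or a code map this gives invariance and the
  images of the product process.
\<close>

lemma paired_image:
  assumes M: "M \<in> Prob (config I X)" and N: "N \<in> Prob (config I X)"
    and T: "T \<in> measurable (config I X) (config J Y)"
    and T2: "T2 \<in> measurable (config I (X \<Otimes>\<^sub>M X)) (config J (Y \<Otimes>\<^sub>M Y))"
    and eq: "\<And>x y. x \<in> space (config I X) \<Longrightarrow> y \<in> space (config I X) \<Longrightarrow> T2 (zip_config I x y) = zip_config J (T x) (T y)"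
  shows "distr (paired I X M N) (config J (Y \<Otimes>\<^sub>M Y)) T2 = paired J Y (distr M (config J Y) T) (distr N (config J Y) T)"
proof -
  interpret M: prob_space M by (rule ProbD(1)[OF M])
  interpret N: prob_space N by (rule ProbD(1)[OF N])
  have TM: "T \<in> measurable M (config J Y)" and TN: "T \<in> measurable N (config J Y)"
    unfolding Prob_measurable[OF M] Prob_measurable[OF N] by (rule T)+
  interpret TN: prob_space "distr N (config J Y) T" by (rule N.prob_space_distr[OF TN])
  have mT: "(\<lambda>(x, y). (T x, T y)) \<in> measurable (M \<Otimes>\<^sub>M N) (config J Y \<Otimes>\<^sub>M config J Y)"
    using TM TN by measurable
  have sp: "space M = space (config I X)" "space N = space (config I X)" using ProbD(3) M N by auto
  have "paired J Y (distr M (config J Y) T) (distr N (config J Y) T) =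
     distr (distr (M \<Otimes>\<^sub>M N) (config J Y \<Otimes>\<^sub>M config J Y) (\<lambda>(x, y). (T x, T y))) (config J (Y \<Otimes>\<^sub>M Y)) (\<lambda>(x, y). zip_config J x y)"
    unfolding paired_eq pair_measure_distr[OF TM TN TN.sigma_finite_measure_axioms] ..
  also have "\<dots> = distr (M \<Otimes>\<^sub>M N) (config J (Y \<Otimes>\<^sub>M Y)) (\<lambda>(x, y). zip_config J (T x) (T y))"
    unfolding distr_distr[OF pair_zip_measurable mT] by (simp add: comp_def case_prod_unfold)
  also have "\<dots> = distr (paired I X M N) (config J (Y \<Otimes>\<^sub>M Y)) T2"
    unfolding distr_paired[OF M N T2] using sp eq by (intro distr_cong) (auto simp: space_pair_measure)
  finally show ?thesis ..
qed

section \<open>Isomorphisms of processes\<close>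

text \<open>
  A probability space is nonempty, and so is the space of labels, because configurations have a
  coordinate at the identity.
\<close>

lemma metric_processD:
  assumes G: "group G" and mp: "metric_process G X d \<mu>"
  shows "measurably_precompact X d" "compact_space (Metric_space.mtopology (space X) d)"
    "sets X = sigma_sets (space X) {U. openin (Metric_space.mtopology (space X) d) U}"
    "\<mu> \<in> Prob (config (carrier G) X)"
    "\<forall>g\<in>carrier G. distr \<mu> (config (carrier G) X) (right_shift G g) = \<mu>"
proof -
  interpret group G by fact
  note * = mp[unfolded metric_process_def]
  show \<mu>: "\<mu> \<in> Prob (config (carrier G) X)" using * by blast
  have "space (config (carrier G) X) \<noteq> {}"
    using prob_space.not_empty[OF ProbD(1)[OF \<mu>]] ProbD(3)[OF \<mu>] by simp
  then have "space X \<noteq> {}" using config_component[OF _ one_closed] by blast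
  then show "measurably_precompact X d" using * by (intro compact_borel_imp_measurably_precompact) auto
  show "compact_space (Metric_space.mtopology (space X) d)"
    "sets X = sigma_sets (space X) {U. openin (Metric_space.mtopology (space X) d) U}"
    "\<forall>g\<in>carrier G. distr \<mu> (config (carrier G) X) (right_shift G g) = \<mu>" using * by blast+
qed

text \<open>
  An isomorphism as used below: \<open>\<phi>\<close> and \<open>\<psi>\<close> are its identity coordinate and that of its inverse.
\<close>

definition coded_factor :: "('g, 'm) monoid_scheme \<Rightarrow> 'x measure \<Rightarrow> ('g \<Rightarrow> 'x) measure \<Rightarrow> 'y measure \<Rightarrow> ('g \<Rightarrow> 'y) measure \<Rightarrow>
    (('g \<Rightarrow> 'x) \<Rightarrow> 'y) \<Rightarrow> (('g \<Rightarrow> 'y) \<Rightarrow> 'x) \<Rightarrow> bool" where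
  "coded_factor G X \<mu> Y \<nu> \<phi> \<psi> \<longleftrightarrow>
     \<phi> \<in> measurable (config (carrier G) X) Y \<and> \<psi> \<in> measurable (config (carrier G) Y) X \<and>
     distr \<mu> (config (carrier G) Y) (orbit_map G \<phi>) = \<nu> \<and>
     (AE z in \<mu>. \<psi> (orbit_map G \<phi> z) = z \<one>\<^bsub>G\<^esub>)"

text \<open>
  By equivariance the coordinate at \<open>g\<close> of the image of \<open>z\<close> is the identity coordinate of the image of
  the shifted \<open>z\<close>, for all \<open>g\<close> in the countable group simultaneously, almost everywhere.
\<close>

lemma isomorphic_systems_coded_factor:
  assumes G: "group G" "countable (carrier G)"
    and \<mu>: "\<mu> \<in> Prob (config (carrier G) X)" and \<nu>: "\<nu> \<in> Prob (config (carrier G) Y)"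
    and iso: "isomorphic_systems G \<mu> (right_shift G) \<nu> (right_shift G)"
  obtains \<phi> \<psi> where "coded_factor G X \<mu> Y \<nu> \<phi> \<psi>"
proof -
  interpret group G by fact
  let ?\<Gamma> = "carrier G"
  obtain f k where fm: "f \<in> measurable \<mu> \<nu>" and km: "k \<in> measurable \<nu> \<mu>" and df: "distr \<mu> \<nu> f = \<nu>"
    and kf: "AE x in \<mu>. k (f x) = x" and eqv: "\<forall>g\<in>?\<Gamma>. AE x in \<mu>. f (right_shift G g x) = right_shift G g (f x)"
    using iso unfolding isomorphic_systems_def by blast
  have msets: "measurable \<mu> \<nu> = measurable (config ?\<Gamma> X) (config ?\<Gamma> Y)" "measurable \<nu> \<mu> = measurable (config ?\<Gamma> Y) (config ?\<Gamma> X)"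
    by (rule measurable_cong_sets[OF ProbD(2)[OF \<mu>] ProbD(2)[OF \<nu>]], rule measurable_cong_sets[OF ProbD(2)[OF \<nu>] ProbD(2)[OF \<mu>]])
  define \<phi> where "\<phi> z = f z \<one>\<^bsub>G\<^esub>" for z
  define \<psi> where "\<psi> w = k w \<one>\<^bsub>G\<^esub>" for w
  have \<phi>: "\<phi> \<in> measurable (config ?\<Gamma> X) Y" unfolding \<phi>_def
    by (rule measurable_compose[OF fm[unfolded msets] measurable_component_singleton[OF one_closed]])
  have \<psi>: "\<psi> \<in> measurable (config ?\<Gamma> Y) X" unfolding \<psi>_def
    by (rule measurable_compose[OF km[unfolded msets] measurable_component_singleton[OF one_closed]])
  have "AE x in \<mu>. \<forall>g\<in>?\<Gamma>. f (right_shift G g x) = right_shift G g (f x)"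
    using eqv by (simp add: AE_ball_countable[OF G(2)])
  then have orb: "AE x in \<mu>. orbit_map G \<phi> x = f x"
    using AE_space
  proof eventually_elim
    case (elim x)
    have fx: "f x \<in> space (config ?\<Gamma> Y)" using measurable_space[OF fm elim(2)] ProbD(3)[OF \<nu>] by simp
    have "orbit_map G \<phi> x = (\<lambda>g\<in>?\<Gamma>. f x g)"
      unfolding orbit_map_def using elim(1) by (intro restrict_ext) (simp add: \<phi>_def right_shift_def)
    then show ?case using restrict_config[OF fx] by simp
  qed
  have om: "orbit_map G \<phi> \<in> measurable \<mu> (config ?\<Gamma> Y)"
    unfolding Prob_measurable[OF \<mu>] by (rule orbit_map_measurable[OF G(1) \<phi>])
  have fm': "f \<in> measurable \<mu> (config ?\<Gamma> Y)" unfolding Prob_measurable[OF \<mu>] using fm[unfolded msets] .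
  have "distr \<mu> (config ?\<Gamma> Y) (orbit_map G \<phi>) = distr \<mu> (config ?\<Gamma> Y) f"
    by (rule distr_cong_AE[OF refl refl orb om fm'])
  also have "\<dots> = distr \<mu> \<nu> f" using ProbD(2)[OF \<nu>] by (intro distr_cong) auto
  finally have "distr \<mu> (config ?\<Gamma> Y) (orbit_map G \<phi>) = \<nu>" using df by simp
  moreover have "AE z in \<mu>. \<psi> (orbit_map G \<phi> z) = z \<one>\<^bsub>G\<^esub>"
    using orb kf by eventually_elim (simp add: \<psi>_def)
  ultimately have "coded_factor G X \<mu> Y \<nu> \<phi> \<psi>" using \<phi> \<psi> unfolding coded_factor_def by blast
  then show ?thesis using that by blast
qed

text \<open>
  Equivariance of the inverse follows by writing almost every point as an image and using that
  both the action and the isomorphism preserve null sets.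
\<close>

lemma isomorphic_systems_sym:
  assumes pres: "\<And>g. g \<in> carrier G \<Longrightarrow> T g \<in> measurable M M \<and> distr M M (T g) = M"
    and iso: "isomorphic_systems G M T N R"
  shows "isomorphic_systems G N R M T"
proof -
  obtain f k where fm: "f \<in> measurable M N" and km: "k \<in> measurable N M" and df: "distr M N f = N" and dk: "distr N M k = M"
    and kf: "AE x in M. k (f x) = x" and fk: "AE y in N. f (k y) = y"
    and eqv: "\<forall>g\<in>carrier G. AE x in M. f (T g x) = R g (f x)"
    using iso unfolding isomorphic_systems_def by blast
  have pull: "AE y in N. Q (k y)" if "AE x in M. Q x" for Q
    using AE_distrD[OF km, of Q, unfolded dk] that by blast
  have "AE y in N. k (R g y) = T g (k y)" if g: "g \<in> carrier G" for g
  proof -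
    have "AE x in M. k (f (T g x)) = T g x"
      using AE_distrD[OF conjunct1[OF pres[OF g]], of "\<lambda>x. k (f x) = x", unfolded conjunct2[OF pres[OF g]]] kf by blast
    from pull[OF this] pull[OF bspec[OF eqv g]] fk show ?thesis
      by eventually_elim simp
  qed
  then show ?thesis unfolding isomorphic_systems_def using fm km df dk kf fk by blast
qed

section \<open>Lifting quenched and doubly-quenched sequences\<close>

lemma deviation_distr:
  assumes T: "T \<in> measurable M N" and H: "\<And>v. v \<in> V \<Longrightarrow> H v \<in> borel_measurable N"
  shows "deviation V (distr M N T) H c = deviation V M (\<lambda>v x. H v (T x)) c"
proof -
  have "(\<integral>x. \<bar>(\<Sum>v\<in>V. H v x) / real (card V) - c\<bar> \<partial>distr M N T) = (\<integral>x. \<bar>(\<Sum>v\<in>V. H v (T x)) / real (card V) - c\<bar> \<partial>M)"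
    using H by (intro integral_distr[OF T]) auto
  moreover have "(\<Sum>v\<in>V. \<bar>(\<integral>x. H v x \<partial>distr M N T) - c\<bar>) = (\<Sum>v\<in>V. \<bar>(\<integral>x. H v (T x) \<partial>M) - c\<bar>)"
    using H by (intro sum.cong refl) (simp add: integral_distr[OF T])
  ultimately show ?thesis by (simp add: deviation_def)
qed

text \<open>
  The code \<open>\<phi> \<times> \<phi>\<close> of the product of a factor map with itself.
\<close>

definition product_code :: "'i set \<Rightarrow> (('i \<Rightarrow> 'x) \<Rightarrow> 'y) \<Rightarrow> ('i \<Rightarrow> 'x \<times> 'x) \<Rightarrow> 'y \<times> 'y" where
  "product_code I \<phi> z = (\<phi> (fst_config I z), \<phi> (snd_config I z))"

lemma product_code_measurable:
  assumes "\<phi> \<in> measurable (config I X) Y"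
  shows "product_code I \<phi> \<in> measurable (config I (X \<Otimes>\<^sub>M X)) (Y \<Otimes>\<^sub>M Y)"
  unfolding product_code_def
  by (rule measurable_Pair[OF measurable_compose[OF fst_config_measurable assms] measurable_compose[OF snd_config_measurable assms]])

lemma right_shift_zip_config:
  assumes "group G" "g \<in> carrier G"
  shows "right_shift G g (zip_config (carrier G) x y) = zip_config (carrier G) (right_shift G g x) (right_shift G g y)"
proof -
  interpret group G by fact
  show ?thesis using assms(2) by (auto simp: right_shift_def zip_config_def fun_eq_iff)
qed

lemma orbit_map_product_code:
  assumes G: "group G" and x: "x \<in> space (config (carrier G) X)" and y: "y \<in> space (config (carrier G) X)"
  shows "orbit_map G (product_code (carrier G) \<phi>) (zip_config (carrier G) x y) = zip_config (carrier G) (orbit_map G \<phi> x) (orbit_map G \<phi> y)"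
proof -
  have "product_code (carrier G) \<phi> (right_shift G g (zip_config (carrier G) x y)) = (\<phi> (right_shift G g x), \<phi> (right_shift G g y))"
    if g: "g \<in> carrier G" for g
    unfolding product_code_def right_shift_zip_config[OF G g]
    by (simp add: fst_zip_config[OF right_shift_space[OF G g x]] snd_zip_config[OF right_shift_space[OF G g y]])
  then show ?thesis by (auto simp: orbit_map_def zip_config_def fun_eq_iff)
qed

lemma code_map_product_code:
  assumes s: "\<forall>g\<in>carrier G. s g permutes V" and x: "x \<in> space (config V X)" and y: "y \<in> space (config V X)"
  shows "code_map G V s (product_code (carrier G) \<phi>) (zip_config V x y) = zip_config V (code_map G V s \<phi> x) (code_map G V s \<phi> y)"
proof -
  have "product_code (carrier G) \<phi> (pullback_name G s v (zip_config V x y)) = (\<phi> (pullback_name G s v x), \<phi> (pullback_name G s v y))"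
    if v: "v \<in> V" for v
    unfolding product_code_def pullback_zip_config[OF s v]
    by (simp add: fst_zip_config[OF pullback_space[OF s v x]] snd_zip_config[OF pullback_space[OF s v y]])
  then show ?thesis by (auto simp: code_map_def zip_config_def fun_eq_iff)
qed

lemma integral_paired_marginals:
  fixes k :: "_ \<Rightarrow> real"
  assumes M: "M \<in> Prob (config I X)" and N: "N \<in> Prob (config I X)" and k: "k \<in> borel_measurable (config I X)"
  shows "(\<integral>z. k (fst_config I z) \<partial>paired I X M N) = (\<integral>x. k x \<partial>M)"
    and "(\<integral>z. k (snd_config I z) \<partial>paired I X M N) = (\<integral>x. k x \<partial>N)"
proof -
  note PMN = Prob_measurable[OF paired_in_Prob[OF M N]]
  show "(\<integral>z. k (fst_config I z) \<partial>paired I X M N) = (\<integral>x. k x \<partial>M)"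
    using integral_distr[OF _ k, of "fst_config I" "paired I X M N"] paired_marginals(1)[OF M N]
    unfolding PMN by (simp add: fst_config_measurable)
  show "(\<integral>z. k (snd_config I z) \<partial>paired I X M N) = (\<integral>x. k x \<partial>N)"
    using integral_distr[OF _ k, of "snd_config I" "paired I X M N"] paired_marginals(2)[OF M N]
    unfolding PMN by (simp add: snd_config_measurable)
qed

lemma integral_paired_mean:
  fixes k :: "_ \<Rightarrow> real"
  assumes M: "M \<in> Prob (config I X)" and k: "k \<in> borel_measurable (config I X)"
    and C: "\<And>x. x \<in> space (config I X) \<Longrightarrow> \<bar>k x\<bar> \<le> C"
  shows "(\<integral>z. (k (fst_config I z) + k (snd_config I z)) / 2 \<partial>paired I X M M) = (\<integral>x. k x \<partial>M)"
proof -
  note P = paired_in_Prob[OF M M]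
  have int: "integrable (paired I X M M) (\<lambda>z. k (T z))" if T: "T \<in> measurable (config I (X \<Otimes>\<^sub>M X)) (config I X)" for T
  proof (rule integrable_bounded[OF ProbD(1)[OF P]])
    show "(\<lambda>z. k (T z)) \<in> borel_measurable (paired I X M M)"
      unfolding Prob_measurable[OF P] by (rule measurable_compose[OF T k])
    show "\<bar>k (T z)\<bar> \<le> C" if "z \<in> space (paired I X M M)" for z
      using C measurable_space[OF T] that ProbD(3)[OF P] by simp
  qed
  have "(\<integral>z. (k (fst_config I z) + k (snd_config I z)) / 2 \<partial>paired I X M M) =
    ((\<integral>z. k (fst_config I z) \<partial>paired I X M M) + (\<integral>z. k (snd_config I z) \<partial>paired I X M M)) / 2"
    using int[OF fst_config_measurable] int[OF snd_config_measurable] by simp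
  then show ?thesis unfolding integral_paired_marginals[OF M M k] by simp
qed

text \<open>
  Both copies are distributed as \<open>M\<close>, so the mean of the two errors has the same integral as \<open>\<rho>\<close>.
\<close>

lemma almost_lipschitz_product_code:
  assumes X: "measurably_precompact X d" and M: "M \<in> Prob (config I X)"
    and al: "almost_lipschitz I X d e M \<eta> \<phi>"
  shows "almost_lipschitz I (X \<Otimes>\<^sub>M X) (pair_dist d d) (pair_dist e e) (paired I X M M) \<eta> (product_code I \<phi>)"
proof -
  have d: "Metric_space (space X) d" using X by (simp add: measurably_precompact_def)
  interpret d: Metric_space "space X" d by (rule d)
  have xx: "Metric_space (space (X \<Otimes>\<^sub>M X)) (pair_dist d d)"
    using measurably_precompact_pair[OF X X] by (simp add: measurably_precompact_def)
  obtain \<rho> W L where \<rho>: "window_lipschitz I X d \<rho>" and W: "finite W" "W \<subseteq> I" "0 \<le> L" and i: "(\<integral>x. \<rho> x \<partial>M) \<le> \<eta>"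
    and le: "\<And>x y. x \<in> space (config I X) \<Longrightarrow> y \<in> space (config I X) \<Longrightarrow> e (\<phi> x) (\<phi> y) \<le> \<rho> x + L * window_dist W d x y"
    using al unfolding almost_lipschitz_def by metis
  obtain C where C: "\<And>x. x \<in> space (config I X) \<Longrightarrow> \<bar>\<rho> x\<bar> \<le> C" using window_lipschitz_bounded[OF X \<rho>] by metis
  let ?\<rho> = "\<lambda>z. (\<rho> (fst_config I z) + \<rho> (snd_config I z)) / 2"
  have m: "fst_config I z \<in> space (config I X)" "snd_config I z \<in> space (config I X)" if "z \<in> space (config I (X \<Otimes>\<^sub>M X))" for z
    using measurable_space[OF fst_config_measurable that] measurable_space[OF snd_config_measurable that] by auto
  have "window_lipschitz I (X \<Otimes>\<^sub>M X) (pair_dist d d) (\<lambda>z. \<rho> (fst_config I z))"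
    by (rule window_lipschitz_reindex[OF xx d \<rho>, where K=2 and r="\<lambda>g. g"]) (use m in \<open>auto simp: fst_config_def pair_dist_def\<close>)
  moreover have "window_lipschitz I (X \<Otimes>\<^sub>M X) (pair_dist d d) (\<lambda>z. \<rho> (snd_config I z))"
    by (rule window_lipschitz_reindex[OF xx d \<rho>, where K=2 and r="\<lambda>g. g"]) (use m in \<open>auto simp: snd_config_def pair_dist_def\<close>)
  ultimately have "window_lipschitz I (X \<Otimes>\<^sub>M X) (pair_dist d d) (\<lambda>z. (1 / 2) * (\<rho> (fst_config I z) + \<rho> (snd_config I z)))"
    by (intro window_lipschitz_cmult[OF xx] window_lipschitz_add[OF xx])
  then have 1: "window_lipschitz I (X \<Otimes>\<^sub>M X) (pair_dist d d) ?\<rho>" by simp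
  have 2: "(\<integral>z. ?\<rho> z \<partial>paired I X M M) \<le> \<eta>"
    using i by (subst integral_paired_mean[OF M window_lipschitz_measurable[OF X \<rho>] C]) auto
  have "pair_dist e e (product_code I \<phi> x) (product_code I \<phi> y) \<le> ?\<rho> x + L * window_dist W (pair_dist d d) x y"
    if x: "x \<in> space (config I (X \<Otimes>\<^sub>M X))" and y: "y \<in> space (config I (X \<Otimes>\<^sub>M X))" for x y
  proof -
    have "window_dist W (pair_dist d d) x y = (window_dist W d (fst_config I x) (fst_config I y) + window_dist W d (snd_config I x) (snd_config I y)) / 2"
      unfolding window_dist_def sum.distrib[symmetric] sum_divide_distrib
      using W by (intro sum.cong) (auto simp: pair_dist_def fst_config_def snd_config_def subset_iff)
    then show ?thesis
      using le[OF m(1)[OF x] m(1)[OF y]] le[OF m(2)[OF x] m(2)[OF y]] by (simp add: pair_dist_def product_code_def field_simps)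
  qed
  then show ?thesis unfolding almost_lipschitz_def using 1 2 W by blast
qed

context approximate_action
begin

text \<open>
  Functions of the second label only are test functions for the joint labelling.
\<close>

lemma observables_converge_image:
  assumes X: "measurably_precompact X d" and Y: "measurably_precompact Y e"
    and \<mu>: "\<mu> \<in> Prob (config (carrier G) X)" and \<phi>: "\<phi> \<in> measurable (config (carrier G) X) Y"
    and P: "\<And>i. \<mu>s i \<in> Prob (config (V i) X)"
    and T: "\<And>i. T i \<in> measurable (config (V i) X) (config (V i) Y)"
    and lim: "\<And>F. window_lipschitz (carrier G) (X \<Otimes>\<^sub>M Y) (pair_dist d e) F \<Longrightarrow>
     (\<lambda>i. deviation (V i) (\<mu>s i) (\<lambda>v x. F (pullback_name G (\<sigma> i) v (zip_config (V i) x (T i x))))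
         (\<integral>z. F (zip_config (carrier G) z (orbit_map G \<phi> z)) \<partial>\<mu>)) \<longlonglongrightarrow> 0"
  shows "observables_converge G Y e (distr \<mu> (config (carrier G) Y) (orbit_map G \<phi>)) V \<sigma> (\<lambda>i. distr (\<mu>s i) (config (V i) Y) (T i))"
  unfolding observables_converge_def
proof (intro allI impI)
  let ?\<Gamma> = "carrier G"
  fix F assume F: "window_lipschitz ?\<Gamma> Y e F"
  have d: "Metric_space (space X) d" and e: "Metric_space (space Y) e" using X Y by (auto simp: measurably_precompact_def)
  interpret d: Metric_space "space X" d by (rule d)
  note XY = measurably_precompact_pair[OF X Y]
  have mF: "F \<in> borel_measurable (config ?\<Gamma> Y)" by (rule window_lipschitz_measurable[OF Y F])
  have FL: "window_lipschitz ?\<Gamma> (X \<Otimes>\<^sub>M Y) (pair_dist d e) (\<lambda>p. F (snd_config ?\<Gamma> p))"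
  proof (rule window_lipschitz_reindex[OF _ e F, where K=2 and r="\<lambda>g. g"])
    show "Metric_space (space (X \<Otimes>\<^sub>M Y)) (pair_dist d e)" using XY by (simp add: measurably_precompact_def)
    show "snd_config ?\<Gamma> p \<in> space (config ?\<Gamma> Y)" if "p \<in> space (config ?\<Gamma> (X \<Otimes>\<^sub>M Y))" for p
      by (rule measurable_space[OF snd_config_measurable that])
    show "e (snd_config ?\<Gamma> p g) (snd_config ?\<Gamma> q g) \<le> 2 * pair_dist d e (p g) (q g)" if "g \<in> ?\<Gamma>" for p q g
      using that by (simp add: snd_config_def pair_dist_def)
  qed auto
  have om: "orbit_map G \<phi> \<in> measurable \<mu> (config ?\<Gamma> Y)"
    unfolding Prob_measurable[OF \<mu>] by (rule orbit_map_measurable[OF grp \<phi>])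
  have "(\<integral>z. F (snd_config ?\<Gamma> (zip_config ?\<Gamma> z (orbit_map G \<phi> z))) \<partial>\<mu>) = (\<integral>z. F (orbit_map G \<phi> z) \<partial>\<mu>)"
    by (intro Bochner_Integration.integral_cong refl) (simp add: snd_zip_config[OF measurable_space[OF om]])
  also have "\<dots> = (\<integral>y. F y \<partial>distr \<mu> (config ?\<Gamma> Y) (orbit_map G \<phi>))" by (rule integral_distr[OF om mF, symmetric])
  finally have c: "(\<integral>z. F (snd_config ?\<Gamma> (zip_config ?\<Gamma> z (orbit_map G \<phi> z))) \<partial>\<mu>) = \<dots>" .
  have dev: "deviation (V i) (distr (\<mu>s i) (config (V i) Y) (T i)) (\<lambda>v y. F (pullback_name G (\<sigma> i) v y)) t =
      deviation (V i) (\<mu>s i) (\<lambda>v x. F (snd_config ?\<Gamma> (pullback_name G (\<sigma> i) v (zip_config (V i) x (T i x))))) t" for i t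
  proof -
    have Tm: "T i \<in> measurable (\<mu>s i) (config (V i) Y)" unfolding Prob_measurable[OF P] by (rule T)
    have "deviation (V i) (distr (\<mu>s i) (config (V i) Y) (T i)) (\<lambda>v y. F (pullback_name G (\<sigma> i) v y)) t =
       deviation (V i) (\<mu>s i) (\<lambda>v x. F (pullback_name G (\<sigma> i) v (T i x))) t"
      by (rule deviation_distr[OF Tm]) (rule measurable_compose[OF pullback_measurable[OF perm] mF])
    moreover have "snd_config ?\<Gamma> (pullback_name G (\<sigma> i) v (zip_config (V i) x (T i x))) = pullback_name G (\<sigma> i) v (T i x)"
      if "v \<in> V i" for v x
      unfolding pullback_zip_config[OF perm that] by (auto simp: snd_config_def zip_config_def pullback_name_def fun_eq_iff)
    ultimately show ?thesis by (simp add: deviation_def cong: sum.cong)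
  qed
  show "(\<lambda>i. deviation (V i) (distr (\<mu>s i) (config (V i) Y) (T i)) (\<lambda>v y. F (pullback_name G (\<sigma> i) v y))
      (\<integral>y. F y \<partial>distr \<mu> (config ?\<Gamma> Y) (orbit_map G \<phi>))) \<longlonglongrightarrow> 0"
    unfolding dev c[symmetric] by (rule lim[OF FL])
qed

lemma average_tendsto_of_deviation:
  assumes "(\<lambda>i. deviation (V i) (M i) (H i) c) \<longlonglongrightarrow> 0"
  shows "(\<lambda>i. average (V i) (M i) (H i)) \<longlonglongrightarrow> c"
proof -
  have "(\<lambda>i. average (V i) (M i) (H i) - c) \<longlonglongrightarrow> 0"
    by (rule Lim_null_comparison[OF _ assms]) (auto intro!: always_eventually average_deviation fin ne)
  from tendsto_add[OF this tendsto_const[of c]] show ?thesis by simp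
qed

lemma quenched_lift:
  assumes mX: "metric_process G X d \<mu>" and mY: "metric_process G Y e \<nu>" and cf: "coded_factor G X \<mu> Y \<nu> \<phi> \<psi>"
    and q: "quenched_converges G X d \<mu> V \<sigma> \<mu>s"
  obtains \<nu>s where "quenched_converges G Y e \<nu> V \<sigma> \<nu>s" "covering_rate V d \<mu>s \<le> covering_rate V e \<nu>s"
proof -
  let ?\<Gamma> = "carrier G"
  note X = metric_processD[OF grp mX] and Y = metric_processD[OF grp mY]
  have \<phi>: "\<phi> \<in> measurable (config ?\<Gamma> X) Y" and \<psi>: "\<psi> \<in> measurable (config ?\<Gamma> Y) X"
    and fac: "distr \<mu> (config ?\<Gamma> Y) (orbit_map G \<phi>) = \<nu>" and invs: "AE z in \<mu>. \<psi> (orbit_map G \<phi> z) = z \<one>\<^bsub>G\<^esub>"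
    using cf unfolding coded_factor_def by auto
  have P: "\<And>i. \<mu>s i \<in> Prob (config (V i) X)" and oc: "observables_converge G X d \<mu> V \<sigma> \<mu>s"
    using q quenched_converges_iff_observables[where V=V and \<sigma>=\<sigma>, OF X(1,2) fin ne perm X(4)] by auto
  have "\<exists>f. f \<in> measurable (config ?\<Gamma> X) Y \<and> almost_lipschitz ?\<Gamma> X d e \<mu> (1 / Suc k) f \<and> (\<integral>x. e (f x) (\<phi> x) \<partial>\<mu>) \<le> 1 / Suc k" for k
    by (rule almost_lipschitz_approx[OF X(1,4,3) Y(1) \<phi>, of "1 / Suc k"]) auto
  then obtain f where f: "\<And>k. f k \<in> measurable (config ?\<Gamma> X) Y" "\<And>k. almost_lipschitz ?\<Gamma> X d e \<mu> (1 / Suc k) (f k)"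
    "\<And>k. (\<integral>x. e (f k x) (\<phi> x) \<partial>\<mu>) \<le> 1 / Suc k" by metis
  show ?thesis
  proof (rule joint_lift[OF X(1) Y(1) X(4,5) \<phi> P oc f])
    fix \<kappa> assume lim: "\<And>F. window_lipschitz ?\<Gamma> (X \<Otimes>\<^sub>M Y) (pair_dist d e) F \<Longrightarrow>
     (\<lambda>i. deviation (V i) (\<mu>s i) (\<lambda>v x. F (pullback_name G (\<sigma> i) v (zip_config (V i) x (code_map G (V i) (\<sigma> i) (f (\<kappa> i)) x))))
         (\<integral>z. F (zip_config ?\<Gamma> z (orbit_map G \<phi> z)) \<partial>\<mu>)) \<longlonglongrightarrow> 0"
    let ?T = "\<lambda>i. code_map G (V i) (\<sigma> i) (f (\<kappa> i))"
    let ?\<nu>s = "\<lambda>i. distr (\<mu>s i) (config (V i) Y) (?T i)"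
    have T: "?T i \<in> measurable (config (V i) X) (config (V i) Y)" for i by (rule code_map_measurable[OF perm f(1)])
    have \<nu>s: "?\<nu>s i \<in> Prob (config (V i) Y)" for i
      by (rule distr_in_Prob[OF P T])
    have "observables_converge G Y e \<nu> V \<sigma> ?\<nu>s"
      unfolding fac[symmetric] by (rule observables_converge_image[where T="?T", OF X(1) Y(1) X(4) \<phi> P T lim])
    then have "quenched_converges G Y e \<nu> V \<sigma> ?\<nu>s"
      using quenched_converges_iff_observables[where V=V and \<sigma>=\<sigma>, OF Y(1,2) fin ne perm Y(4)] \<nu>s by blast
    moreover have "covering_rate V d \<mu>s \<le> covering_rate V e ?\<nu>s"
      by (rule covering_rate_le[where T="?T", OF X(1) Y(1,3) X(4) Y(4) \<phi> \<psi> fac invs P T average_tendsto_of_deviation[OF lim]])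
    ultimately show ?thesis by (rule that)
  qed
qed

text \<open>
  The joint construction is applied to the product process, with the codes \<open>f k \<times> f k\<close>. Because
  these act on each copy separately, the images of the squares of \<open>\<mu>s i\<close> are squares again, namely of the
  images of \<open>\<mu>s i\<close> under \<open>f k\<close>. The covering estimate needs only one copy.
\<close>

lemma doubly_quenched_lift:
  assumes mX: "metric_process G X d \<mu>" and mY: "metric_process G Y e \<nu>" and cf: "coded_factor G X \<mu> Y \<nu> \<phi> \<psi>"
    and q: "doubly_quenched_converges G X d \<mu> V \<sigma> \<mu>s"
  obtains \<nu>s where "doubly_quenched_converges G Y e \<nu> V \<sigma> \<nu>s" "covering_rate V d \<mu>s \<le> covering_rate V e \<nu>s"
proof -
  let ?\<Gamma> = "carrier G"
  note X = metric_processD[OF grp mX] and Y = metric_processD[OF grp mY]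
  have d: "Metric_space (space X) d" and e: "Metric_space (space Y) e" using X(1) Y(1) by (auto simp: measurably_precompact_def)
  interpret d: Metric_space "space X" d by (rule d)
  interpret e: Metric_space "space Y" e by (rule e)
  have \<phi>: "\<phi> \<in> measurable (config ?\<Gamma> X) Y" and \<psi>: "\<psi> \<in> measurable (config ?\<Gamma> Y) X"
    and fac: "distr \<mu> (config ?\<Gamma> Y) (orbit_map G \<phi>) = \<nu>" and invs: "AE z in \<mu>. \<psi> (orbit_map G \<phi> z) = z \<one>\<^bsub>G\<^esub>"
    using cf unfolding coded_factor_def by auto
  let ?X2 = "X \<Otimes>\<^sub>M X" and ?Y2 = "Y \<Otimes>\<^sub>M Y" and ?d2 = "pair_dist d d" and ?e2 = "pair_dist e e"
  let ?\<mu>2 = "paired ?\<Gamma> X \<mu> \<mu>" and ?\<phi>2 = "product_code ?\<Gamma> \<phi>" and ?\<mu>s2 = "\<lambda>i. paired (V i) X (\<mu>s i) (\<mu>s i)"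
  have X2: "measurably_precompact ?X2 ?d2" and Y2: "measurably_precompact ?Y2 ?e2"
    using measurably_precompact_pair X(1) Y(1) by auto
  have cX2: "compact_space (Metric_space.mtopology (space ?X2) ?d2)" and cY2: "compact_space (Metric_space.mtopology (space ?Y2) ?e2)"
    unfolding space_pair_measure using compact_space_pair_dist[OF d d X(2,2)] compact_space_pair_dist[OF e e Y(2,2)] by auto
  have P: "\<And>i. \<mu>s i \<in> Prob (config (V i) X)" and q2: "quenched_converges G ?X2 ?d2 ?\<mu>2 V \<sigma> ?\<mu>s2"
    using q unfolding doubly_quenched_converges_def avg_dist_eq_pair_dist by auto
  have \<mu>2: "?\<mu>2 \<in> Prob (config ?\<Gamma> ?X2)" by (rule paired_in_Prob[OF X(4) X(4)])
  have P2: "\<And>i. ?\<mu>s2 i \<in> Prob (config (V i) ?X2)" by (rule paired_in_Prob[OF P P])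
  have oc2: "observables_converge G ?X2 ?d2 ?\<mu>2 V \<sigma> ?\<mu>s2"
    using q2 quenched_converges_iff_observables[where V=V and \<sigma>=\<sigma>, OF X2 cX2 fin ne perm \<mu>2] by blast
  have inv2: "\<forall>g\<in>?\<Gamma>. distr ?\<mu>2 (config ?\<Gamma> ?X2) (right_shift G g) = ?\<mu>2"
  proof
    fix g assume g: "g \<in> ?\<Gamma>"
    have "distr ?\<mu>2 (config ?\<Gamma> ?X2) (right_shift G g) =
        paired ?\<Gamma> X (distr \<mu> (config ?\<Gamma> X) (right_shift G g)) (distr \<mu> (config ?\<Gamma> X) (right_shift G g))"
      by (rule paired_image[OF X(4) X(4) right_shift_measurable[OF grp g] right_shift_measurable[OF grp g] right_shift_zip_config[OF grp g]])
    then show "distr ?\<mu>2 (config ?\<Gamma> ?X2) (right_shift G g) = ?\<mu>2" using X(5) g by simp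
  qed
  note \<phi>2 = product_code_measurable[OF \<phi>]
  have "\<exists>f. f \<in> measurable (config ?\<Gamma> X) Y \<and> almost_lipschitz ?\<Gamma> X d e \<mu> (1 / Suc k) f \<and> (\<integral>x. e (f x) (\<phi> x) \<partial>\<mu>) \<le> 1 / Suc k" for k
    by (rule almost_lipschitz_approx[OF X(1,4,3) Y(1) \<phi>, of "1 / Suc k"]) auto
  then obtain f where f: "\<And>k. f k \<in> measurable (config ?\<Gamma> X) Y" "\<And>k. almost_lipschitz ?\<Gamma> X d e \<mu> (1 / Suc k) (f k)"
    "\<And>k. (\<integral>x. e (f k x) (\<phi> x) \<partial>\<mu>) \<le> 1 / Suc k" by metis
  let ?f2 = "\<lambda>k. product_code ?\<Gamma> (f k)"
  have f2: "?f2 k \<in> measurable (config ?\<Gamma> ?X2) ?Y2" for k by (rule product_code_measurable[OF f(1)])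
  have f2al: "almost_lipschitz ?\<Gamma> ?X2 ?d2 ?e2 ?\<mu>2 (1 / Suc k) (?f2 k)" for k
    by (rule almost_lipschitz_product_code[OF X(1) X(4) f(2)])
  have f2L1: "(\<integral>z. ?e2 (?f2 k z) (?\<phi>2 z) \<partial>?\<mu>2) \<le> 1 / Suc k" for k
  proof -
    obtain C where C: "\<And>x y. x \<in> space Y \<Longrightarrow> y \<in> space Y \<Longrightarrow> e x y \<le> C" using measurably_precompact_bounded[OF Y(1)] by metis
    have b: "\<bar>e (f k x) (\<phi> x)\<bar> \<le> C" if "x \<in> space (config ?\<Gamma> X)" for x
      using C[OF measurable_space[OF f(1) that] measurable_space[OF \<phi> that]] by simp
    have "(\<integral>z. ?e2 (?f2 k z) (?\<phi>2 z) \<partial>?\<mu>2) = (\<integral>x. e (f k x) (\<phi> x) \<partial>\<mu>)"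
      unfolding pair_dist_def product_code_def fst_conv snd_conv
      by (rule integral_paired_mean[OF X(4) dist_compose_measurable[OF Y(1) f(1) \<phi>] b])
    then show ?thesis using f(3) by simp
  qed
  show ?thesis
  proof (rule joint_lift[where \<phi>'="?f2", OF X2 Y2 \<mu>2 inv2 \<phi>2 P2 oc2 f2 f2al f2L1])
    fix \<kappa> assume lim2: "\<And>F. window_lipschitz ?\<Gamma> (?X2 \<Otimes>\<^sub>M ?Y2) (pair_dist ?d2 ?e2) F \<Longrightarrow>
     (\<lambda>i. deviation (V i) (?\<mu>s2 i) (\<lambda>v x. F (pullback_name G (\<sigma> i) v (zip_config (V i) x (code_map G (V i) (\<sigma> i) (?f2 (\<kappa> i)) x))))
         (\<integral>z. F (zip_config ?\<Gamma> z (orbit_map G ?\<phi>2 z)) \<partial>?\<mu>2)) \<longlonglongrightarrow> 0"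
    let ?T = "\<lambda>i. code_map G (V i) (\<sigma> i) (f (\<kappa> i))" and ?T2 = "\<lambda>i. code_map G (V i) (\<sigma> i) (?f2 (\<kappa> i))"
    let ?\<nu>s = "\<lambda>i. distr (\<mu>s i) (config (V i) Y) (?T i)"
    have T: "?T i \<in> measurable (config (V i) X) (config (V i) Y)" for i by (rule code_map_measurable[OF perm f(1)])
    have T2: "?T2 i \<in> measurable (config (V i) ?X2) (config (V i) ?Y2)" for i by (rule code_map_measurable[OF perm f2])
    have \<nu>s: "?\<nu>s i \<in> Prob (config (V i) Y)" for i by (rule distr_in_Prob[OF P T])
    have \<nu>2: "distr ?\<mu>2 (config ?\<Gamma> ?Y2) (orbit_map G ?\<phi>2) = paired ?\<Gamma> Y \<nu> \<nu>"
      unfolding fac[symmetric]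
      by (rule paired_image[OF X(4) X(4) orbit_map_measurable[OF grp \<phi>] orbit_map_measurable[OF grp \<phi>2] orbit_map_product_code[OF grp]])
    have \<nu>s2: "distr (?\<mu>s2 i) (config (V i) ?Y2) (?T2 i) = paired (V i) Y (?\<nu>s i) (?\<nu>s i)" for i
      by (rule paired_image[OF P P T T2 code_map_product_code[OF perm]])
    have "observables_converge G ?Y2 ?e2 (paired ?\<Gamma> Y \<nu> \<nu>) V \<sigma> (\<lambda>i. paired (V i) Y (?\<nu>s i) (?\<nu>s i))"
      unfolding \<nu>2[symmetric] \<nu>s2[symmetric] by (rule observables_converge_image[where T="?T2", OF X2 Y2 \<mu>2 \<phi>2 P2 T2 lim2])
    then have "quenched_converges G ?Y2 ?e2 (paired ?\<Gamma> Y \<nu> \<nu>) V \<sigma> (\<lambda>i. paired (V i) Y (?\<nu>s i) (?\<nu>s i))"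
      using quenched_converges_iff_observables[where V=V and \<sigma>=\<sigma>, OF Y2 cY2 fin ne perm paired_in_Prob[OF Y(4) Y(4)]]
        paired_in_Prob[OF \<nu>s \<nu>s] by blast
    then have dq: "doubly_quenched_converges G Y e \<nu> V \<sigma> ?\<nu>s"
      unfolding doubly_quenched_converges_def avg_dist_eq_pair_dist using \<nu>s by blast
    \<comment> \<open>the first copy alone recovers the joint convergence needed for covering numbers\<close>
    have lim: "(\<lambda>i. average (V i) (\<mu>s i) (\<lambda>v x. F (pullback_name G (\<sigma> i) v (zip_config (V i) x (?T i x)))))
         \<longlonglongrightarrow> (\<integral>z. F (zip_config ?\<Gamma> z (orbit_map G \<phi> z)) \<partial>\<mu>)"
      if F: "window_lipschitz ?\<Gamma> (X \<Otimes>\<^sub>M Y) (pair_dist d e) F" for F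
    proof -
      note XY = measurably_precompact_pair[OF X(1) Y(1)]
      have mF: "F \<in> borel_measurable (config ?\<Gamma> (X \<Otimes>\<^sub>M Y))" by (rule window_lipschitz_measurable[OF XY F])
      define pr where "pr p = zip_config ?\<Gamma> (fst_config ?\<Gamma> (fst_config ?\<Gamma> p)) (fst_config ?\<Gamma> (snd_config ?\<Gamma> p))"
        for p :: "'g \<Rightarrow> ('a \<times> 'a) \<times> ('b \<times> 'b)"
      have FL: "window_lipschitz ?\<Gamma> (?X2 \<Otimes>\<^sub>M ?Y2) (pair_dist ?d2 ?e2) (\<lambda>p. F (pr p))"
      proof (rule window_lipschitz_reindex[OF _ _ F, where K=2 and r="\<lambda>g. g"])
        show "Metric_space (space (?X2 \<Otimes>\<^sub>M ?Y2)) (pair_dist ?d2 ?e2)"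
          using measurably_precompact_pair[OF X2 Y2] by (simp add: measurably_precompact_def)
        show "Metric_space (space (X \<Otimes>\<^sub>M Y)) (pair_dist d e)" using XY by (simp add: measurably_precompact_def)
        show "pr p \<in> space (config ?\<Gamma> (X \<Otimes>\<^sub>M Y))" if p: "p \<in> space (config ?\<Gamma> (?X2 \<Otimes>\<^sub>M ?Y2))" for p
        proof -
          note p1 = measurable_space[OF fst_config_measurable p] and p2 = measurable_space[OF snd_config_measurable p]
          show ?thesis unfolding pr_def
            by (rule zip_config_space[OF measurable_space[OF fst_config_measurable p1] measurable_space[OF fst_config_measurable p2]])
        qed
        show "pair_dist d e (pr p g) (pr q g) \<le> 2 * pair_dist ?d2 ?e2 (p g) (q g)" if "g \<in> ?\<Gamma>" for p q g
          using that d.nonneg[of "snd (fst (p g))" "snd (fst (q g))"] e.nonneg[of "snd (snd (p g))" "snd (snd (q g))"]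
          by (simp add: pr_def zip_config_def fst_config_def snd_config_def pair_dist_def field_simps del: d.nonneg e.nonneg)
      qed auto
      have c: "(\<integral>z. F (pr (zip_config ?\<Gamma> z (orbit_map G ?\<phi>2 z))) \<partial>?\<mu>2) = (\<integral>z. F (zip_config ?\<Gamma> z (orbit_map G \<phi> z)) \<partial>\<mu>)"
      proof -
        have m: "(\<lambda>z. F (zip_config ?\<Gamma> z (orbit_map G \<phi> z))) \<in> borel_measurable (config ?\<Gamma> X)"
          by (rule measurable_compose[OF zip_config_measurable[OF measurable_ident_sets[OF refl] orbit_map_measurable[OF grp \<phi>]] mF])
        have "pr (zip_config ?\<Gamma> z (orbit_map G ?\<phi>2 z)) = zip_config ?\<Gamma> (fst_config ?\<Gamma> z) (orbit_map G \<phi> (fst_config ?\<Gamma> z))"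
          if "z \<in> space ?\<mu>2" for z
        proof -
          have z: "z \<in> space (config ?\<Gamma> ?X2)" using that ProbD(3)[OF \<mu>2] by simp
          note z1 = measurable_space[OF fst_config_measurable z] and z2 = measurable_space[OF snd_config_measurable z]
          have orb: "orbit_map G ?\<phi>2 z = zip_config ?\<Gamma> (orbit_map G \<phi> (fst_config ?\<Gamma> z)) (orbit_map G \<phi> (snd_config ?\<Gamma> z))"
            using orbit_map_product_code[OF grp z1 z2] zip_fst_snd_config[OF z] by simp
          show ?thesis unfolding pr_def
            by (simp add: fst_zip_config[OF z] snd_zip_config[OF measurable_space[OF orbit_map_measurable[OF grp \<phi>2] z]])
              (simp add: orb fst_zip_config[OF measurable_space[OF orbit_map_measurable[OF grp \<phi>] z1]])
        qed
        then have "(\<integral>z. F (pr (zip_config ?\<Gamma> z (orbit_map G ?\<phi>2 z))) \<partial>?\<mu>2) =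
            (\<integral>z. F (zip_config ?\<Gamma> (fst_config ?\<Gamma> z) (orbit_map G \<phi> (fst_config ?\<Gamma> z))) \<partial>?\<mu>2)"
          by (intro Bochner_Integration.integral_cong refl) simp
        then show ?thesis using integral_paired_marginals(1)[OF X(4) X(4) m] by simp
      qed
      have a: "average (V i) (?\<mu>s2 i) (\<lambda>v x. F (pr (pullback_name G (\<sigma> i) v (zip_config (V i) x (?T2 i x))))) =
          average (V i) (\<mu>s i) (\<lambda>v x. F (pullback_name G (\<sigma> i) v (zip_config (V i) x (?T i x))))" for i
        unfolding average_def
      proof (rule arg_cong[where f="\<lambda>t. t / _"], rule sum.cong[OF refl])
        fix v assume v: "v \<in> V i"
        have m: "(\<lambda>x. F (pullback_name G (\<sigma> i) v (zip_config (V i) x (?T i x)))) \<in> borel_measurable (config (V i) X)"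
          by (rule measurable_compose[OF joint_observable_measurable[OF perm v T] mF])
        have "pr (pullback_name G (\<sigma> i) v (zip_config (V i) x (?T2 i x))) =
            pullback_name G (\<sigma> i) v (zip_config (V i) (fst_config (V i) x) (?T i (fst_config (V i) x)))"
          if "x \<in> space (?\<mu>s2 i)" for x
        proof -
          have x: "x \<in> space (config (V i) ?X2)" using that ProbD(3)[OF P2] by simp
          note x1 = measurable_space[OF fst_config_measurable x] and x2 = measurable_space[OF snd_config_measurable x]
          have Tx: "?T2 i x = zip_config (V i) (?T i (fst_config (V i) x)) (?T i (snd_config (V i) x))"
            using code_map_product_code[OF perm x1 x2] zip_fst_snd_config[OF x] by simp
          have xx: "x = zip_config (V i) (fst_config (V i) x) (snd_config (V i) x)" using zip_fst_snd_config[OF x] by simp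
          note pS = pullback_space[OF perm v]
          have "pullback_name G (\<sigma> i) v (zip_config (V i) x (?T2 i x)) = zip_config ?\<Gamma>
             (zip_config ?\<Gamma> (pullback_name G (\<sigma> i) v (fst_config (V i) x)) (pullback_name G (\<sigma> i) v (snd_config (V i) x)))
             (zip_config ?\<Gamma> (pullback_name G (\<sigma> i) v (?T i (fst_config (V i) x))) (pullback_name G (\<sigma> i) v (?T i (snd_config (V i) x))))"
            unfolding Tx pullback_zip_config[OF perm v] by (subst xx) (simp only: pullback_zip_config[OF perm v])
          moreover have "pullback_name G (\<sigma> i) v (?T i (fst_config (V i) x)) \<in> space (config ?\<Gamma> Y)"
              "pullback_name G (\<sigma> i) v (?T i (snd_config (V i) x)) \<in> space (config ?\<Gamma> Y)"
            using pS measurable_space[OF T] x1 x2 by auto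
          ultimately show ?thesis unfolding pr_def
            by (simp add: pullback_zip_config[OF perm v] fst_zip_config[OF pS[OF x1]] fst_zip_config[OF zip_config_space[OF pS[OF x1] pS[OF x2]]]
                snd_zip_config[OF zip_config_space[OF pS[OF measurable_space[OF T x1]] pS[OF measurable_space[OF T x2]]]]
                fst_zip_config[OF pS[OF measurable_space[OF T x1]]])
        qed
        then have "(\<integral>x. F (pr (pullback_name G (\<sigma> i) v (zip_config (V i) x (?T2 i x)))) \<partial>?\<mu>s2 i) =
            (\<integral>x. F (pullback_name G (\<sigma> i) v (zip_config (V i) (fst_config (V i) x) (?T i (fst_config (V i) x)))) \<partial>?\<mu>s2 i)"
          by (intro Bochner_Integration.integral_cong refl) simp
        then show "(\<integral>x. F (pr (pullback_name G (\<sigma> i) v (zip_config (V i) x (?T2 i x)))) \<partial>?\<mu>s2 i) =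
            (\<integral>x. F (pullback_name G (\<sigma> i) v (zip_config (V i) x (?T i x))) \<partial>\<mu>s i)"
          using integral_paired_marginals(1)[OF P P m] by simp
      qed
      show ?thesis using average_tendsto_of_deviation[OF lim2[OF FL]] unfolding c a .
    qed
    have "covering_rate V d \<mu>s \<le> covering_rate V e ?\<nu>s"
      by (rule covering_rate_le[where T="?T", OF X(1) Y(1,3) X(4) Y(4) \<phi> \<psi> fac invs P T lim])
    with dq show ?thesis by (rule that)
  qed
qed

end

section \<open>Invariance of the entropies\<close>

lemma entropies_le:
  assumes G: "group G" "countable (carrier G)" and s: "sofic_approximation G V \<sigma>"
    and mX: "metric_process G X d \<mu>" and mY: "metric_process G Y e \<nu>"
    and iso: "isomorphic_systems G \<mu> (right_shift G) \<nu> (right_shift G)"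
  shows "quenched_entropy G V \<sigma> X d \<mu> \<le> quenched_entropy G V \<sigma> Y e \<nu>"
    and "doubly_quenched_entropy G V \<sigma> X d \<mu> \<le> doubly_quenched_entropy G V \<sigma> Y e \<nu>"
proof -
  obtain \<phi> \<psi> where cf: "coded_factor G X \<mu> Y \<nu> \<phi> \<psi>"
    by (rule isomorphic_systems_coded_factor[OF G metric_processD(4)[OF G(1) mX] metric_processD(4)[OF G(1) mY] iso])
  show "quenched_entropy G V \<sigma> X d \<mu> \<le> quenched_entropy G V \<sigma> Y e \<nu>"
    unfolding quenched_entropy_def
  proof (rule Sup_least, clarify)
    fix n \<mu>s assume n: "strict_mono n" and q: "quenched_converges G X d \<mu> (V \<circ> n) (\<sigma> \<circ> n) \<mu>s"
    interpret approximate_action G "V \<circ> n" "\<sigma> \<circ> n" by (rule sofic_subsequence[OF G s n])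
    obtain \<nu>s where "quenched_converges G Y e \<nu> (V \<circ> n) (\<sigma> \<circ> n) \<nu>s" and le: "covering_rate (V \<circ> n) d \<mu>s \<le> covering_rate (V \<circ> n) e \<nu>s"
      by (rule quenched_lift[OF mX mY cf q])
    then show "covering_rate (V \<circ> n) d \<mu>s \<le> Sup {covering_rate (V \<circ> n) e \<nu>s |n \<nu>s.
        strict_mono n \<and> quenched_converges G Y e \<nu> (V \<circ> n) (\<sigma> \<circ> n) \<nu>s}"
      using n by (intro Sup_upper2[OF _ le]) blast
  qed
  show "doubly_quenched_entropy G V \<sigma> X d \<mu> \<le> doubly_quenched_entropy G V \<sigma> Y e \<nu>"
    unfolding doubly_quenched_entropy_def
  proof (rule Sup_least, clarify)
    fix n \<mu>s assume n: "strict_mono n" and q: "doubly_quenched_converges G X d \<mu> (V \<circ> n) (\<sigma> \<circ> n) \<mu>s"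
    interpret approximate_action G "V \<circ> n" "\<sigma> \<circ> n" by (rule sofic_subsequence[OF G s n])
    obtain \<nu>s where "doubly_quenched_converges G Y e \<nu> (V \<circ> n) (\<sigma> \<circ> n) \<nu>s" and le: "covering_rate (V \<circ> n) d \<mu>s \<le> covering_rate (V \<circ> n) e \<nu>s"
      by (rule doubly_quenched_lift[OF mX mY cf q])
    then show "covering_rate (V \<circ> n) d \<mu>s \<le> Sup {covering_rate (V \<circ> n) e \<nu>s |n \<nu>s.
        strict_mono n \<and> doubly_quenched_converges G Y e \<nu> (V \<circ> n) (\<sigma> \<circ> n) \<nu>s}"
      using n by (intro Sup_upper2[OF _ le]) blast
  qed
qed

lemma entropies_eq:
  assumes G: "group G" "countable (carrier G)" and s: "sofic_approximation G V \<sigma>"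
    and mX: "metric_process G X d \<mu>" and mY: "metric_process G Y e \<nu>"
    and iso: "isomorphic_systems G \<mu> (right_shift G) \<nu> (right_shift G)"
  shows "quenched_entropy G V \<sigma> X d \<mu> = quenched_entropy G V \<sigma> Y e \<nu> \<and>
    doubly_quenched_entropy G V \<sigma> X d \<mu> = doubly_quenched_entropy G V \<sigma> Y e \<nu>"
proof -
  have "right_shift G g \<in> measurable \<mu> \<mu> \<and> distr \<mu> \<mu> (right_shift G g) = \<mu>" if g: "g \<in> carrier G" for g
  proof
    note X = metric_processD[OF G(1) mX]
    have "measurable \<mu> \<mu> = measurable (config (carrier G) X) (config (carrier G) X)"
      by (rule measurable_cong_sets[OF ProbD(2)[OF X(4)] ProbD(2)[OF X(4)]])
    then show "right_shift G g \<in> measurable \<mu> \<mu>" using right_shift_measurable[OF G(1) g] by simp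
    have "distr \<mu> \<mu> (right_shift G g) = distr \<mu> (config (carrier G) X) (right_shift G g)"
      using ProbD(2)[OF X(4)] by (intro distr_cong) auto
    then show "distr \<mu> \<mu> (right_shift G g) = \<mu>" using X(5) g by simp
  qed
  from isomorphic_systems_sym[OF this iso]
  have iso': "isomorphic_systems G \<nu> (right_shift G) \<mu> (right_shift G)" .
  show ?thesis
    using entropies_le[OF G s mX mY iso] entropies_le[OF G s mY mX iso'] by (simp add: order_antisym)
qed

lemma isomorphic_systems_refl:
  "(\<And>g. g \<in> carrier G \<Longrightarrow> T g \<in> measurable M M) \<Longrightarrow> isomorphic_systems G M T M T"
  unfolding isomorphic_systems_def
  by (intro exI[of _ "\<lambda>x. x"]) (auto simp: distr_id2)

theorem theorem6p4:
  fixes G :: "('g, 'm) monoid_scheme"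
    and V :: "nat \<Rightarrow> 'v set" and \<sigma> :: "nat \<Rightarrow> 'g \<Rightarrow> 'v \<Rightarrow> 'v"
  assumes "group G" and "countable (carrier G)" and "sofic_approximation G V \<sigma>"
  shows "(\<forall>(X :: 'x measure) d\<^sub>X \<mu> (Y :: 'y measure) d\<^sub>Y \<nu>.
            metric_process G X d\<^sub>X \<mu> \<and> metric_process G Y d\<^sub>Y \<nu> \<and>
            isomorphic_systems G \<mu> (right_shift G) \<nu> (right_shift G) \<longrightarrow>
            quenched_entropy G V \<sigma> X d\<^sub>X \<mu> = quenched_entropy G V \<sigma> Y d\<^sub>Y \<nu> \<and>
            doubly_quenched_entropy G V \<sigma> X d\<^sub>X \<mu> = doubly_quenched_entropy G V \<sigma> Y d\<^sub>Y \<nu>) \<and>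
         (\<forall>(X :: 'x measure) d d' \<mu>.
            metric_process G X d \<mu> \<and> metric_process G X d' \<mu> \<longrightarrow>
            quenched_entropy G V \<sigma> X d \<mu> = quenched_entropy G V \<sigma> X d' \<mu> \<and>
            doubly_quenched_entropy G V \<sigma> X d \<mu> = doubly_quenched_entropy G V \<sigma> X d' \<mu>)"
proof (intro conjI)
  show "\<forall>(X :: 'x measure) d\<^sub>X \<mu> (Y :: 'y measure) d\<^sub>Y \<nu>.
            metric_process G X d\<^sub>X \<mu> \<and> metric_process G Y d\<^sub>Y \<nu> \<and>
            isomorphic_systems G \<mu> (right_shift G) \<nu> (right_shift G) \<longrightarrow>
            quenched_entropy G V \<sigma> X d\<^sub>X \<mu> = quenched_entropy G V \<sigma> Y d\<^sub>Y \<nu> \<and>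
            doubly_quenched_entropy G V \<sigma> X d\<^sub>X \<mu> = doubly_quenched_entropy G V \<sigma> Y d\<^sub>Y \<nu>"
    using entropies_eq[OF assms] by blast
  show "\<forall>(X :: 'x measure) d d' \<mu>.
            metric_process G X d \<mu> \<and> metric_process G X d' \<mu> \<longrightarrow>
            quenched_entropy G V \<sigma> X d \<mu> = quenched_entropy G V \<sigma> X d' \<mu> \<and>
            doubly_quenched_entropy G V \<sigma> X d \<mu> = doubly_quenched_entropy G V \<sigma> X d' \<mu>"
  proof (intro allI impI)
    fix X :: "'x measure" and d d' \<mu> assume m: "metric_process G X d \<mu> \<and> metric_process G X d' \<mu>"
    note X = metric_processD[OF assms(1) conjunct1[OF m]]
    have "right_shift G g \<in> measurable \<mu> \<mu>" if "g \<in> carrier G" for g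
      using right_shift_measurable[OF assms(1) that]
        measurable_cong_sets[OF ProbD(2)[OF X(4)] ProbD(2)[OF X(4)]] by blast
    then have "isomorphic_systems G \<mu> (right_shift G) \<mu> (right_shift G)" by (rule isomorphic_systems_refl)
    then show "quenched_entropy G V \<sigma> X d \<mu> = quenched_entropy G V \<sigma> X d' \<mu> \<and>
            doubly_quenched_entropy G V \<sigma> X d \<mu> = doubly_quenched_entropy G V \<sigma> X d' \<mu>"
      using entropies_eq[OF assms conjunct1[OF m] conjunct2[OF m]] by blast
  qed
qed

end
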